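(* Let $Q$ be a connected quandle of prime power order. Then $\mathrm{RMlt}(Q)$ is a solvable group.
   Context: A quandle is a set $Q$ with a binary operation such that for every $x\in Q$ the right translation $R_x:Q\to Q$, $y\mapsto yx$, is an automorphism of $Q$, and $xx=x$ for all $x\in Q$. $\mathrm{RMlt}(Q)=\langle R_x:x\in Q\rangle$ is the right multiplication group, a subgroup of $\mathrm{Aut}(Q)$. $Q$ is connected if $\mathrm{RMlt}(Q)$ acts transitively on $Q$. The order of $Q$ is its cardinality. *)

theory Defs
  imports "HOL-Algebra.Group_Action" "HOL-Algebra.Solvable_Groups" "HOL-Computational_Algebra.Primes"
begin

text \<open>As in \<^theory>\<open>HOL-Algebra.Bij\<close>, permutations of \<^term>\<open>Q\<close> are represented by functions
  that are extensional on \<^term>\<open>Q\<close>.\<close>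

definition magma_auto :: "'a set \<Rightarrow> ('a \<Rightarrow> 'a \<Rightarrow> 'a) \<Rightarrow> ('a \<Rightarrow> 'a) set"
  where "magma_auto Q m = {f \<in> Bij Q. \<forall>y\<in>Q. \<forall>z\<in>Q. f (m y z) = m (f y) (f z)}"

definition right_translation :: "'a set \<Rightarrow> ('a \<Rightarrow> 'a \<Rightarrow> 'a) \<Rightarrow> 'a \<Rightarrow> 'a \<Rightarrow> 'a"
  where "right_translation Q m x = (\<lambda>y\<in>Q. m y x)"

locale quandle =
  fixes Q :: "'a set" and m :: "'a \<Rightarrow> 'a \<Rightarrow> 'a"
  assumes closed: "\<lbrakk>x \<in> Q; y \<in> Q\<rbrakk> \<Longrightarrow> m x y \<in> Q"
    and right_translation_auto: "x \<in> Q \<Longrightarrow> right_translation Q m x \<in> magma_auto Q m"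
    and idem: "x \<in> Q \<Longrightarrow> m x x = x"

definition RMlt :: "'a set \<Rightarrow> ('a \<Rightarrow> 'a \<Rightarrow> 'a) \<Rightarrow> ('a \<Rightarrow> 'a) monoid"
  where "RMlt Q m = (BijGroup Q)\<lparr>carrier := generate (BijGroup Q) (right_translation Q m ` Q)\<rparr>"

locale connected_quandle = quandle +
  assumes connected: "transitive_action (RMlt Q m) Q (\<lambda>g. g)"

context quandle
begin

lemma right_translations_subset: "right_translation Q m ` Q \<subseteq> carrier (BijGroup Q)"
  using right_translation_auto by (auto simp: magma_auto_def BijGroup_def)

lemma subgroup_RMlt: "subgroup (carrier (RMlt Q m)) (BijGroup Q)"
  using group.generate_is_subgroup[OF group_BijGroup right_translations_subset]
  by (simp add: RMlt_def)

lemma group_RMlt: "group (RMlt Q m)"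
  using subgroup.subgroup_is_group[OF subgroup_RMlt group_BijGroup]
  by (simp add: RMlt_def)

lemma group_action_RMlt: "group_action (RMlt Q m) Q (\<lambda>g. g)"
  unfolding group_action_def group_hom_def group_hom_axioms_def
  using group_RMlt group_BijGroup subgroup.subset[OF subgroup_RMlt]
  by (auto simp: hom_def RMlt_def)

text \<open>The group-action part of \<^locale>\<open>transitive_action\<close> is automatic for a quandle, so
  connectedness is exactly the existence of the required group elements.\<close>

lemma connected_quandle_iff:
  "connected_quandle Q m \<longleftrightarrow> (\<forall>x\<in>Q. \<forall>y\<in>Q. \<exists>g\<in>carrier (RMlt Q m). g x = y)"
  using group_action_RMlt quandle_axioms
  by (auto simp: connected_quandle_def connected_quandle_axioms_def
      transitive_action_def transitive_action_axioms_def)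

end

end

theory Submission
  imports Defs "HOL-Algebra.Sylow" "HOL-Number_Theory.Residues" "Jordan_Normal_Form.Schur_Decomposition"
begin

text \<open>
  The right translations of a connected quandle \<open>Q\<close> form one conjugacy class of \<open>RMlt Q\<close>, and its
  size divides the order of \<open>Q\<close>. So the claim is an instance of Kazarin's theorem: a finite group
  \<open>G\<close> generated by a conjugacy class of \<open>p\<close>-power size is solvable. Let \<open>x\<close> be in that class. A Sylow
  argument shows that the \<open>p\<close>-part of \<open>x\<close> has a \<open>p\<close>-group as its normal closure; factoring it out, one
  may assume that the order \<open>n\<close> of \<open>x\<close> is prime to \<open>p\<close>, and then the derived subgroup is a \<open>p\<close>-group.

  Suppose that a prime \<open>s \<noteq> p\<close> divides the order of the derived subgroup. Let \<open>Z\<close> be the product of the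
  class sums of all powers of \<open>x\<close> in the complex group algebra. It acts on the block of an irreducible
  character \<open>\<chi>\<close> by a rational integer \<open>w \<chi>\<close>, and if \<open>w \<chi> \<noteq> 0\<close> and \<open>p\<close> does not divide \<open>\<chi> 1\<close>, then
  \<open>x\<close> acts by a scalar (Burnside's argument), whence \<open>\<chi>\<close> is linear. Let \<open>E\<close> be the sum of the
  central idempotents of those \<open>\<chi>\<close> for which \<open>s\<close> does not divide \<open>w \<chi>\<close>; this includes all linear \<open>\<chi>\<close>.
  Since \<open>E\<close> is the \<open>s\<close>-adic limit of the powers \<open>Z ^ ((s - 1) s^r)\<close>, whose coefficients can be counted
  by words, \<open>E\<close> vanishes on elements of order \<open>s\<close>. Evaluated at such an element of the derived
  subgroup, this says modulo \<open>p\<close> that the number of linear characters is divisible by \<open>p\<close>. But that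
  number is the index of the derived subgroup, which divides \<open>n\<close>.

  Characters enter only through their idempotents \<open>e\<close>: \<open>card G * e 1\<close> is \<open>(\<chi> 1)\<^sup>2\<close>, and degrees
  and multiplicities are integral because an idempotent matrix has a natural number as its trace.
\<close>

section \<open>Linear algebra over the complex numbers\<close>

definition mat_tr :: "'a :: comm_ring_1 mat \<Rightarrow> 'a" where
  "mat_tr A = (\<Sum>i<dim_row A. A $$ (i,i))"

lemma mat_tr_mult_comm:
  assumes "A \<in> carrier_mat n n" "B \<in> carrier_mat n n"
  shows "mat_tr (A * B) = mat_tr (B * A)"
proof -
  have "mat_tr (A * B) = (\<Sum>i<n. \<Sum>j<n. A $$ (i,j) * B $$ (j,i))"
    using assms by (simp add: mat_tr_def scalar_prod_def atLeast0LessThan)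
  also have "\<dots> = (\<Sum>j<n. \<Sum>i<n. B $$ (j,i) * A $$ (i,j))"
    by (subst sum.swap) (simp add: mult.commute)
  also have "\<dots> = mat_tr (B * A)"
    using assms by (simp add: mat_tr_def scalar_prod_def atLeast0LessThan)
  finally show ?thesis .
qed

text \<open>Schur triangularisation turns \<open>A\<close> into an upper triangular idempotent
  \<open>T\<close> of the same trace. Each diagonal entry of \<open>T\<close> equals its own square,
  so it is 0 or 1 and the trace counts the ones.\<close>

lemma idempotent_mat_tr_Nats:
  fixes A :: "complex mat"
  assumes A: "A \<in> carrier_mat n n" and idem: "A * A = A"
  shows "mat_tr A \<in> \<nat>"
proof -
  obtain es where es: "char_poly A = (\<Prod>a\<leftarrow>es. [:- a, 1:])"
    using char_poly_factorized[OF A] by auto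
  define T where "T = schur_upper_triangular A es"
  have T: "T \<in> carrier_mat n n" "upper_triangular T" "similar_mat A T"
    using schur_upper_triangular[OF A es] by (auto simp: T_def)
  obtain P Q where PQ: "similar_mat_wit A T P Q"
    using T(3) by (auto simp: similar_mat_def)
  have carr: "P \<in> carrier_mat n n" "Q \<in> carrier_mat n n" 
    and eqs: "P * Q = 1\<^sub>m n" "Q * P = 1\<^sub>m n" "A = P * T * Q"
    using similar_mat_witD2[OF A PQ] by auto
  have TA: "T = Q * A * P"
  proof -
    have "Q * A * P = Q * (P * T * Q) * P" using eqs(3) by simp
    also have "\<dots> = (Q * P) * T * (Q * P)"
      using carr T(1) by (simp add: assoc_mult_mat[where n\<^sub>2 = n and n\<^sub>3 = n and n\<^sub>4 = n])
    also have "\<dots> = T" using T(1) carr eqs by simp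
    finally show ?thesis by simp
  qed
  have TT: "T * T = T"
  proof -
    have "T * T = Q * A * (P * Q) * A * P"
      unfolding TA using carr A by (simp add: assoc_mult_mat[where n\<^sub>2 = n and n\<^sub>3 = n and n\<^sub>4 = n])
    also have "\<dots> = Q * (A * A) * P"
      using carr A eqs(1) by (simp add: assoc_mult_mat[where n\<^sub>2 = n and n\<^sub>3 = n and n\<^sub>4 = n])
    finally show ?thesis using idem TA by simp
  qed
  have diag: "T $$ (i,i) = 0 \<or> T $$ (i,i) = 1" if i: "i < n" for i
  proof -
    have "T $$ (i,i) = (T * T) $$ (i,i)" by (simp add: TT)
    also have "\<dots> = (\<Sum>j<n. T $$ (i,j) * T $$ (j,i))"
      using T(1) i by (simp add: scalar_prod_def atLeast0LessThan)
    also have "\<dots> = (\<Sum>j<n. if j = i then T $$ (i,i) * T $$ (i,i) else 0)"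
    proof (rule sum.cong, simp)
      fix j assume "j \<in> {..<n}"
      then show "T $$ (i,j) * T $$ (j,i) = (if j = i then T $$ (i,i) * T $$ (i,i) else 0)"
        using T(1,2) i by (cases i j rule: linorder_cases) (auto simp: upper_triangular_def)
    qed
    also have "\<dots> = T $$ (i,i) * T $$ (i,i)" using i by simp
    finally show ?thesis by (metis mult_cancel_left1 mult.commute mult_cancel_right1)
  qed
  have "mat_tr A = mat_tr (P * (T * Q))"
    using eqs(3) carr T(1) by (simp add: assoc_mult_mat[where n\<^sub>2 = n and n\<^sub>3 = n and n\<^sub>4 = n])
  also have "\<dots> = mat_tr (T * Q * P)"
    using carr T(1) by (subst mat_tr_mult_comm[of _ n]) auto
  also have "\<dots> = mat_tr T"
    using carr T(1) eqs(2) by (simp add: assoc_mult_mat[where n\<^sub>2 = n and n\<^sub>3 = n and n\<^sub>4 = n])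
  also have "\<dots> = of_nat (\<Sum>i<n. if T $$ (i,i) = 0 then 0 else 1)"
    unfolding mat_tr_def of_nat_sum using diag T(1) by (intro sum.cong) auto
  also have "\<dots> \<in> \<nat>" by (rule of_nat_in_Nats)
  finally show ?thesis .
qed

text \<open>The same for operators given by a kernel on an arbitrary finite index set, so that it
  applies to the group algebra without an enumeration of the group.\<close>

lemma idempotent_kernel_trace_Nats:
  fixes A :: "'a \<Rightarrow> 'a \<Rightarrow> complex"
  assumes fin: "finite S"
    and idem: "\<And>i k. i \<in> S \<Longrightarrow> k \<in> S \<Longrightarrow> (\<Sum>j\<in>S. A i j * A j k) = A i k"
  shows "(\<Sum>i\<in>S. A i i) \<in> \<nat>"
proof -
  obtain f where f: "bij_betw f {..<card S} S"
    using ex_bij_betw_nat_finite[OF fin] by (auto simp: atLeast0LessThan)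
  define M where "M = mat (card S) (card S) (\<lambda>(i,j). A (f i) (f j))"
  have M: "M \<in> carrier_mat (card S) (card S)" by (simp add: M_def)
  have fS: "f i \<in> S" if "i < card S" for i using f that by (auto simp: bij_betw_def)
  have "M * M = M"
  proof (rule eq_matI)
    fix i k assume "i < dim_row M" "k < dim_col M"
    then have ik: "i < card S" "k < card S" by (auto simp: M_def)
    then have "(M * M) $$ (i,k) = (\<Sum>j<card S. A (f i) (f j) * A (f j) (f k))"
      by (simp add: M_def scalar_prod_def atLeast0LessThan)
    also have "\<dots> = (\<Sum>j\<in>S. A (f i) j * A j (f k))"
      by (rule sum.reindex_bij_betw[OF f])
    also have "\<dots> = A (f i) (f k)" using ik fS idem by blast
    finally show "(M * M) $$ (i,k) = M $$ (i,k)" using ik by (simp add: M_def)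
  qed (auto simp: M_def)
  then have "mat_tr M \<in> \<nat>" by (rule idempotent_mat_tr_Nats[OF M])
  also have "mat_tr M = (\<Sum>i<card S. A (f i) (f i))" by (simp add: mat_tr_def M_def)
  also have "\<dots> = (\<Sum>i\<in>S. A i i)" by (rule sum.reindex_bij_betw[OF f])
  finally show ?thesis .
qed

text \<open>The eigenvalue is a root of the characteristic polynomial, which is monic with integer
  coefficients. The coordinate \<open>i\<^sub>0\<close> witnesses that the eigenvector is
  nonzero.\<close>

lemma int_matrix_eigenvalue_algebraic_int:
  fixes M :: "'a \<Rightarrow> 'a \<Rightarrow> int" and w :: complex
  assumes fin: "finite S" and nz: "i\<^sub>0 \<in> S" "v i\<^sub>0 \<noteq> 0"
    and eig: "\<And>i. i \<in> S \<Longrightarrow> (\<Sum>j\<in>S. of_int (M i j) * v j) = w * v i"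
  shows "algebraic_int w"
proof -
  obtain f where f: "bij_betw f {..<card S} S"
    using ex_bij_betw_nat_finite[OF fin] by (auto simp: atLeast0LessThan)
  define n where "n = card S"
  define A where "A = mat n n (\<lambda>(i,j). M (f i) (f j))"
  define x where "x = vec n (v \<circ> f)"
  have A: "A \<in> carrier_mat n n" by (simp add: A_def)
  have fS: "f i \<in> S" if "i < n" for i using f that by (auto simp: bij_betw_def n_def)
  obtain k where k: "k < n" "f k = i\<^sub>0"
    using nz(1) bij_betw_imp_surj_on[OF f] by (metis imageE lessThan_iff n_def)
  let ?B = "map_mat (of_int :: int \<Rightarrow> complex) A"
  have B: "?B \<in> carrier_mat n n" using A by simp
  have "x \<noteq> 0\<^sub>v n"
  proof
    assume "x = 0\<^sub>v n"
    then have "x $ k = 0" using k by simp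
    then show False using k nz by (simp add: x_def)
  qed
  moreover have "?B *\<^sub>v x = w \<cdot>\<^sub>v x"
  proof (rule eq_vecI)
    fix i assume "i < dim_vec (w \<cdot>\<^sub>v x)"
    then have i: "i < n" by (simp add: x_def)
    then have "(?B *\<^sub>v x) $ i = (\<Sum>j<n. of_int (M (f i) (f j)) * v (f j))"
      by (simp add: A_def x_def scalar_prod_def atLeast0LessThan)
    also have "\<dots> = (\<Sum>j\<in>S. of_int (M (f i) j) * v j)"
      unfolding n_def by (rule sum.reindex_bij_betw[OF f])
    also have "\<dots> = w * v (f i)" using eig fS i by blast
    finally show "(?B *\<^sub>v x) $ i = (w \<cdot>\<^sub>v x) $ i" using i by (simp add: x_def)
  qed (auto simp: A_def x_def)
  ultimately have "eigenvalue ?B w"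
    unfolding eigenvalue_def eigenvector_def using B by (intro exI[of _ x]) (auto simp: x_def)
  then have "poly (char_poly ?B) w = 0" using eigenvalue_root_char_poly[OF B] by simp
  then have "poly (map_poly of_int (char_poly A)) w = 0"
    by (simp only: of_int_hom.char_poly_hom[OF A])
  moreover have "lead_coeff (char_poly A) = 1" using degree_monic_char_poly[OF A] by simp
  ultimately show ?thesis unfolding algebraic_int_altdef_ipoly by blast
qed

section \<open>Roots of unity and circulant matrices\<close>

lemma mod_shift_cancel:
  fixes s :: nat assumes "i < s" "j < s"
  shows "((i + j) mod s + s - i) mod s = j"
proof -
  have "(i + j) mod s + s - i = (i + j) mod s + (s - i)" using assms by simp
  then have "((i + j) mod s + s - i) mod s = ((i + j) + (s - i)) mod s"
    by (simp add: mod_add_left_eq)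
  then show ?thesis using assms by simp
qed

lemma bij_betw_mod_shift:
  fixes s :: nat assumes "s > 0" "i < s"
  shows "bij_betw (\<lambda>j. (i + j) mod s) {..<s} {..<s}"
proof -
  have inj: "inj_on (\<lambda>j. (i + j) mod s) {..<s}"
  proof (rule inj_onI)
    fix a b assume "a \<in> {..<s}" "b \<in> {..<s}" "(i + a) mod s = (i + b) mod s"
    then show "a = b"
      using assms mod_shift_cancel by (metis lessThan_iff)
  qed
  moreover have "(\<lambda>j. (i + j) mod s) ` {..<s} \<subseteq> {..<s}" using assms by auto
  ultimately show ?thesis
    by (simp add: bij_betw_def endo_inj_surj)
qed

lemma power_mod_root_of_unity:
  fixes z :: "'a :: monoid_mult" assumes "z ^ s = 1" shows "z ^ (i mod s) = z ^ i"
proof -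
  have "z ^ i = z ^ (s * (i div s) + i mod s)" by simp
  also have "\<dots> = z ^ (i mod s)" by (simp only: power_add power_mult assms) simp
  finally show ?thesis by simp
qed

text \<open>The vector of the powers \<open>z ^ j\<close> is an eigenvector of the circulant integer
  matrix built from \<open>a\<close>, and the sum is its eigenvalue.\<close>

lemma cyclotomic_integer_algebraic_int:
  fixes z :: complex and a :: "nat \<Rightarrow> int"
  assumes "s > 0" "z ^ s = 1"
  shows "algebraic_int (\<Sum>j<s. of_int (a j) * z ^ j)"
proof (rule int_matrix_eigenvalue_algebraic_int[where S = "{..<s}" and i\<^sub>0 = 0 and v = "\<lambda>j. z ^ j"
      and M = "\<lambda>i l. a ((l + s - i) mod s)"])
  fix i assume i: "i \<in> {..<s}"
  have "(\<Sum>l<s. of_int (a ((l + s - i) mod s)) * z ^ l) =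
      (\<Sum>j<s. of_int (a (((i + j) mod s + s - i) mod s)) * z ^ ((i + j) mod s))"
    using sum.reindex_bij_betw[OF bij_betw_mod_shift[of s i], symmetric] assms i by simp
  also have "\<dots> = (\<Sum>j<s. of_int (a j) * (z ^ i * z ^ j))"
  proof (rule sum.cong, simp)
    fix j assume j: "j \<in> {..<s}"
    have "((i + j) mod s + s - i) mod s = j" using i j by (simp add: mod_shift_cancel)
    then show "of_int (a (((i + j) mod s + s - i) mod s)) * z ^ ((i + j) mod s) = of_int (a j) * (z ^ i * z ^ j)"
      using assms by (simp add: power_mod_root_of_unity power_add)
  qed
  finally show "(\<Sum>l<s. of_int (a ((l + s - i) mod s)) * z ^ l) = (\<Sum>j<s. of_int (a j) * z ^ j) * z ^ i"
    by (simp add: sum_distrib_left sum_distrib_right mult_ac)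
qed (use assms in auto)

lemma root_of_unity_sum:
  fixes z :: complex
  assumes "z ^ n = 1" "z \<noteq> 1" shows "(\<Sum>j<n. z ^ j) = 0"
  using assms geometric_sum[of z n] by simp

text \<open>A geometric sum with ratio \<open>z ^ i / z ^ j\<close>, which differs from 1 for
  distinct \<open>i\<close> and \<open>j\<close> because \<open>z\<close> is a primitive root of
  unity.\<close>

lemma root_of_unity_orthogonality:
  fixes i j n :: nat
  assumes ij: "i < n" "j < n"
  defines "z \<equiv> cis (2 * pi / n)"
  shows "(\<Sum>k<n. z ^ (i * k) * inverse z ^ (j * k)) = (if i = j then of_nat n else 0)"
proof -
  have n: "n > 0" using ij by simp
  have zn: "z ^ n = 1" using n by (simp add: z_def DeMoivre)
  have z0: "z \<noteq> 0" by (simp add: z_def)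
  have z1: "z ^ d \<noteq> 1" if "0 < d" "d < n" for d
  proof
    assume "z ^ d = 1"
    then have "cis (2 * pi * d / n) = cis (2 * pi * real 0 / n)" by (simp add: z_def DeMoivre mult_ac)
    then have "d = 0"
      using that bij_betw_imp_inj_on[OF bij_betw_roots_unity[OF n]] by (auto dest: inj_onD[where x = d and y = 0])
    then show False using that by simp
  qed
  have e: "(\<Sum>k<n. z ^ (i * k) * inverse z ^ (j * k)) = (\<Sum>k<n. (z ^ i * inverse z ^ j) ^ k)"
    by (simp add: power_mult_distrib power_mult)
  show ?thesis
  proof (cases "i = j")
    case True
    have "z ^ i * inverse z ^ i = 1" using z0 by (simp flip: power_mult_distrib)
    then show ?thesis using e True by simp
  next
    case False
    have "z ^ i * inverse z ^ j \<noteq> 1"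
    proof
      assume "z ^ i * inverse z ^ j = 1"
      then have "z ^ i = z ^ j" using z0 by (simp add: field_simps)
      then have "z ^ (max i j - min i j) = 1"
        using z0 by (cases "i \<le> j") (auto simp: power_diff max_def min_def)
      then show False using z1[of "max i j - min i j"] ij False by auto
    qed
    moreover have "(z ^ i * inverse z ^ j) ^ n = 1"
    proof -
      have "(z ^ i * inverse z ^ j) ^ n = (z ^ n) ^ i * inverse ((z ^ n) ^ j)"
        by (simp add: power_mult_distrib power_inverse mult.commute flip: power_mult)
      then show ?thesis by (simp add: zn)
    qed
    ultimately show ?thesis using e False root_of_unity_sum by simp
  qed
qed

text \<open>The product is the determinant of a circulant integer matrix, diagonalised by the
  discrete Fourier transform.\<close>

lemma cyclotomic_norm_Ints:
  fixes a :: "nat \<Rightarrow> int" and n :: nat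
  assumes n: "n > 0"
  defines "z \<equiv> cis (2 * pi / n)"
  shows "(\<Prod>j<n. \<Sum>k<n. of_int (a k) * z ^ (j * k)) \<in> \<int>"
proof -
  have zn: "z ^ n = 1" using n by (simp add: z_def DeMoivre)
  define C where "C = mat n n (\<lambda>(i,l). a ((l + n - i) mod n))"
  define F where "F = mat n n (\<lambda>(j,i). z ^ (j * i))"
  define F' where "F' = mat n n (\<lambda>(j,i). inverse z ^ (j * i))"
  define c where "c j = (\<Sum>k<n. of_int (a k) * z ^ (j * k))" for j
  define D where "D = mat n n (\<lambda>(i,j). if i = j then c j else 0)"
  let ?C = "map_mat (of_int :: int \<Rightarrow> complex) C"
  have carr: "?C \<in> carrier_mat n n" "F \<in> carrier_mat n n" "F' \<in> carrier_mat n n" "D \<in> carrier_mat n n"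
    by (auto simp: C_def F_def F'_def D_def)
  \<comment> \<open>Column \<open>j\<close> of the Fourier matrix \<open>F\<close> is an eigenvector
    of the circulant matrix with eigenvalue \<open>c j\<close>.\<close>
  have "?C * F = F * D"
  proof (rule eq_matI)
    fix i j assume "i < dim_row (F * D)" "j < dim_col (F * D)"
    then have ij: "i < n" "j < n" by (auto simp: F_def D_def)
    have zj: "(z ^ j) ^ n = 1" by (metis zn power_mult mult.commute power_one)
    have "(?C * F) $$ (i,j) = (\<Sum>l<n. of_int (a ((l + n - i) mod n)) * z ^ (l * j))"
      using ij by (simp add: C_def F_def scalar_prod_def atLeast0LessThan)
    also have "\<dots> = (\<Sum>k<n. of_int (a (((i + k) mod n + n - i) mod n)) * z ^ ((i + k) mod n * j))"
      using sum.reindex_bij_betw[OF bij_betw_mod_shift[of n i], symmetric] n ij by simp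
    also have "\<dots> = (\<Sum>k<n. z ^ (i * j) * (of_int (a k) * z ^ (j * k)))"
    proof (rule sum.cong, simp)
      fix k assume k: "k \<in> {..<n}"
      have "((i + k) mod n + n - i) mod n = k" using ij k by (simp add: mod_shift_cancel)
      moreover have "z ^ ((i + k) mod n * j) = (z ^ j) ^ ((i + k) mod n)" by (simp add: power_mult mult.commute)
      moreover have "\<dots> = z ^ (i * j) * z ^ (j * k)"
        by (subst power_mod_root_of_unity[OF zj]) (simp add: power_add add_mult_distrib2 mult.commute flip: power_mult)
      ultimately show "of_int (a (((i + k) mod n + n - i) mod n)) * z ^ ((i + k) mod n * j) =
          z ^ (i * j) * (of_int (a k) * z ^ (j * k))" by simp
    qed
    also have "\<dots> = z ^ (i * j) * c j" by (simp add: c_def sum_distrib_left)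
    also have "\<dots> = (\<Sum>k<n. z ^ (i * k) * (if k = j then c j else 0))"
      using ij by (subst sum.mono_neutral_cong_right[of _ "{j}"]) auto
    also have "\<dots> = (F * D) $$ (i,j)"
      using ij by (simp add: F_def D_def scalar_prod_def atLeast0LessThan)
    finally show "(?C * F) $$ (i,j) = (F * D) $$ (i,j)" .
  qed (auto simp: C_def F_def D_def)
  then have "det ?C * det F = det F * det D"
    using det_mult carr by metis
  moreover have "det F \<noteq> 0"
  proof -
    \<comment> \<open>Up to the factor \<open>n\<close>, the matrix \<open>F'\<close> is inverse to
      \<open>F\<close>, so \<open>det F\<close> can be cancelled.\<close>
    have "F * F' = of_nat n \<cdot>\<^sub>m 1\<^sub>m n"
    proof (rule eq_matI)
      fix i j assume "i < dim_row (of_nat n \<cdot>\<^sub>m 1\<^sub>m n)" "j < dim_col (of_nat n \<cdot>\<^sub>m 1\<^sub>m n)"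
      then have ij: "i < n" "j < n" by auto
      have "(F * F') $$ (i,j) = (\<Sum>k<n. z ^ (i * k) * inverse z ^ (j * k))"
        using ij by (simp add: F_def F'_def scalar_prod_def atLeast0LessThan mult.commute)
      also have "\<dots> = (if i = j then of_nat n else 0)"
        using ij root_of_unity_orthogonality unfolding z_def by blast
      finally show "(F * F') $$ (i,j) = (of_nat n \<cdot>\<^sub>m 1\<^sub>m n) $$ (i,j)" using ij by simp
    qed (auto simp: F_def F'_def)
    then have "det F * det F' = of_nat n ^ n"
      using det_mult[OF carr(2,3)] by (simp add: det_smult)
    then show ?thesis using n by auto
  qed
  ultimately have "det ?C = det D" by simp
  also have "det D = prod_list (map c [0..<n])"
    by (subst det_upper_triangular[OF _ carr(4)])
       (auto simp: D_def upper_triangular_def diag_mat_def intro!: arg_cong[where f = prod_list])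
  also have "\<dots> = (\<Prod>j<n. c j)"
    using prod.distinct_set_conv_list[of "[0..<n]" c] by (simp add: atLeast0LessThan)
  finally have "(\<Prod>j<n. c j) = of_int (det C)" by (simp add: of_int_hom.hom_det)
  then show ?thesis by (simp add: c_def)
qed

text \<open>Gaussian elimination: if some \<open>f l\<close> is nonzero at the new point
  \<open>x\<close>, a multiple of it is subtracted from the other functions so that they vanish at
  \<open>x\<close>, and the induction hypothesis applies to the differences.\<close>

lemma linear_dependence:
  fixes f :: "nat \<Rightarrow> 'a \<Rightarrow> 'b :: field"
  assumes "finite S" "card S < n"
  shows "\<exists>c. (\<exists>k<n. c k \<noteq> 0) \<and> (\<forall>i\<in>S. (\<Sum>k<n. c k * f k i) = 0)"
  using assms
proof (induction S arbitrary: f n rule: finite_induct)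
  case empty
  then show ?case by (intro exI[of _ "\<lambda>_. 1"]) auto
next
  case (insert x S)
  then obtain m where m: "n = Suc m" "card S < m" by (cases n) auto
  show ?case
  proof (cases "\<exists>l<n. f l x \<noteq> 0")
    case False
    obtain c where "\<exists>k<n. c k \<noteq> 0" "\<forall>i\<in>S. (\<Sum>k<n. c k * f k i) = 0"
      using insert.IH[of n f] m by auto
    then show ?thesis using False by (intro exI[of _ c]) auto
  next
    case True
    then obtain l where l: "l < n" "f l x \<noteq> 0" by blast
    \<comment> \<open>Enumerates the indices other than the pivot \<open>l\<close>.\<close>
    define \<sigma> where "\<sigma> k = (if k < l then k else Suc k)" for k
    have \<sigma>: "bij_betw \<sigma> {..<m} ({..<n} - {l})"
      by (rule bij_betwI[where g = "\<lambda>k. if k < l then k else k - 1"])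
         (use l m in \<open>auto simp: \<sigma>_def split: if_splits\<close>)
    define h where "h k i = f (\<sigma> k) i - f (\<sigma> k) x / f l x * f l i" for k i
    obtain c where c: "\<exists>k<m. c k \<noteq> 0" "\<forall>i\<in>S. (\<Sum>k<m. c k * h k i) = 0"
      using insert.IH[of m h] m by auto
    \<comment> \<open>The coefficient at \<open>l\<close> collects all multiples of the pivot that
      were subtracted in \<open>h\<close>.\<close>
    define d where "d k = (if k = l then - (\<Sum>k<m. c k * f (\<sigma> k) x / f l x) else c (if k < l then k else k - 1))" for k
    have d\<sigma>: "d (\<sigma> k) = c k" for k by (auto simp: d_def \<sigma>_def)
    have eq: "(\<Sum>k<n. d k * f k i) = (\<Sum>k<m. c k * h k i)" for i
    proof -
      have "(\<Sum>k<n. d k * f k i) = d l * f l i + (\<Sum>k\<in>{..<n}-{l}. d k * f k i)"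
        using l by (simp add: sum.remove)
      also have "(\<Sum>k\<in>{..<n}-{l}. d k * f k i) = (\<Sum>k<m. d (\<sigma> k) * f (\<sigma> k) i)"
        by (rule sum.reindex_bij_betw[OF \<sigma>, symmetric])
      also have "d l * f l i = - (\<Sum>k<m. c k * (f (\<sigma> k) x / f l x * f l i))"
        by (simp add: d_def sum_distrib_right mult.assoc)
      also have "- (\<Sum>k<m. c k * (f (\<sigma> k) x / f l x * f l i)) + (\<Sum>k<m. d (\<sigma> k) * f (\<sigma> k) i) = (\<Sum>k<m. c k * h k i)"
        by (simp add: d\<sigma> h_def right_diff_distrib sum_subtractf)
      finally show ?thesis .
    qed
    have "(\<Sum>k<m. c k * h k x) = 0" using l by (simp add: h_def)
    moreover obtain k where "k < m" "c k \<noteq> 0" using c(1) by blast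
    then have "\<sigma> k < n" "d (\<sigma> k) \<noteq> 0" using \<sigma> d\<sigma> by (auto simp: bij_betw_def)
    ultimately show ?thesis using c(2) eq by (intro exI[of _ d]) auto
  qed
qed

section \<open>Counting words with prescribed product\<close>

text \<open>The length of every orbit divides \<open>s ^ N\<close>, so it is a power of
  \<open>s\<close>; it exceeds \<open>s ^ e\<close> because \<open>f ^^ (s ^ e)\<close> has no fixed
  point. The weight is constant on orbits, and the induction removes one orbit at a time.\<close>

lemma prime_power_orbits_sum_dvd:
  fixes w :: "'a \<Rightarrow> int"
  assumes "finite T" and f: "\<And>x. x \<in> T \<Longrightarrow> f x \<in> T"
    and per: "\<And>x. x \<in> T \<Longrightarrow> (f ^^ (s ^ N)) x = x"
    and w: "\<And>x. x \<in> T \<Longrightarrow> w (f x) = w x"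
    and s: "Factorial_Ring.prime (s :: nat)"
    and nofix: "\<And>x. x \<in> T \<Longrightarrow> (f ^^ (s ^ e)) x \<noteq> x"
  shows "int (s ^ Suc e) dvd (\<Sum>x\<in>T. w x)"
  using assms(1) f per w nofix
proof (induction T rule: finite_psubset_induct)
  case (psubset T)
  show ?case
  proof (cases "T = {}")
    case False
    then obtain x where x: "x \<in> T" by blast
    have fT: "(f ^^ i) y \<in> T" if "y \<in> T" for i y
      using that psubset.prems(1) by (induction i) auto
    define d where "d = (LEAST d. d > 0 \<and> (f ^^ d) x = x)"
    have "s ^ N > 0 \<and> (f ^^ (s ^ N)) x = x"
      using psubset.prems(2)[OF x] s by (auto simp: prime_gt_0_nat)
    then have d: "d > 0" "(f ^^ d) x = x"
      unfolding d_def by (metis (mono_tags, lifting) LeastI_ex)+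
    have dmin: "(f ^^ k) x \<noteq> x" if "0 < k" "k < d" for k
      using that not_less_Least[of k] unfolding d_def by blast
    have "d dvd s ^ N"
    proof -
      have "(f ^^ (s ^ N mod d)) x = x"
        using funpow_mod_eq[OF d(2)] psubset.prems(2)[OF x] by metis
      then show ?thesis using dmin[of "s ^ N mod d"] d(1) by (auto simp: dvd_eq_mod_eq_0)
    qed
    then obtain j where j: "d = s ^ j" using s divides_primepow_nat by blast
    have "e < j"
    proof (rule ccontr)
      assume "\<not> e < j"
      then have "s ^ e mod d = 0" using j by (simp add: le_imp_power_dvd)
      then have "(f ^^ (s ^ e)) x = x" using funpow_mod_eq[OF d(2), of "s ^ e"] by simp
      then show False using psubset.prems(4) x by blast
    qed
    define Orb where "Orb = (\<lambda>i. (f ^^ i) x) ` {..<d}"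
    have inj: "inj_on (\<lambda>i. (f ^^ i) x) {..<d}"
    proof (rule linorder_inj_onI)
      fix a b assume ab: "a < b" "a \<in> {..<d}" "b \<in> {..<d}"
      show "(f ^^ a) x \<noteq> (f ^^ b) x"
      proof
        assume "(f ^^ a) x = (f ^^ b) x"
        then have "(f ^^ (d - b + a)) x = (f ^^ (d - b + b)) x" by (simp add: funpow_add)
        moreover have "0 < d - b + a" "d - b + a < d" "d - b + b = d" using ab by auto
        ultimately show False using dmin d(2) by metis
      qed
    qed (simp_all add: linear)
    have Oall: "(f ^^ i) x \<in> Orb" for i
      unfolding Orb_def using funpow_mod_eq[OF d(2), of i] d(1) by (metis imageI lessThan_iff mod_less_divisor)
    have OT: "Orb \<subseteq> T" using fT x by (auto simp: Orb_def)
    have Onz: "x \<in> Orb" using Oall[of 0] by simp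
    have wO: "w y = w x" if "y \<in> Orb" for y
    proof -
      have "w ((f ^^ i) x) = w x" for i
        using psubset.prems(3) fT x by (induction i) auto
      then show ?thesis using that by (auto simp: Orb_def)
    qed
    have sumO: "(\<Sum>y\<in>Orb. w y) = int (s ^ j) * w x"
      using wO card_image[OF inj] j by (simp add: Orb_def)
    have "int (s ^ Suc e) dvd int (s ^ j)"
      unfolding int_dvd_int_iff using \<open>e < j\<close> by (intro le_imp_power_dvd) simp
    then have 1: "int (s ^ Suc e) dvd (\<Sum>y\<in>Orb. w y)"
      unfolding sumO by (rule dvd_mult2)
    \<comment> \<open>By periodicity \<open>f ^^ (s ^ N - 1)\<close> undoes \<open>f\<close>, so a
      point that is mapped into the orbit already lies in it.\<close>
    have "f y \<in> T - Orb" if y: "y \<in> T - Orb" for y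
    proof -
      have "y \<in> Orb" if fy: "f y \<in> Orb"
      proof -
        obtain i where i: "f y = (f ^^ i) x" using fy by (auto simp: Orb_def)
        have "s ^ N > 0" using s by (simp add: prime_gt_0_nat)
        then have "y = (f ^^ (s ^ N - 1)) (f y)"
          using psubset.prems(2)[of y] y by (metis DiffD1 Suc_diff_1 comp_apply funpow_Suc_right)
        also have "\<dots> \<in> Orb" using Oall[of "s ^ N - 1 + i"] by (simp add: i funpow_add)
        finally show ?thesis .
      qed
      then show ?thesis using y psubset.prems(1) by blast
    qed
    then have 2: "int (s ^ Suc e) dvd (\<Sum>y\<in>T - Orb. w y)"
      using psubset.prems Onz x by (intro psubset.IH) auto
    have "(\<Sum>y\<in>T. w y) = (\<Sum>y\<in>Orb. w y) + (\<Sum>y\<in>T - Orb. w y)"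
      using OT psubset.hyps sum.subset_diff by (metis add.commute)
    then show ?thesis using 1 2 by simp
  qed simp
qed

text \<open>Comparing both sides of the equation shows that \<open>u\<close> is a prefix of
  \<open>v\<close>; the remainder again commutes with \<open>u\<close>.\<close>

lemma commuting_words_eq_power:
  assumes "v @ u = u @ v" "length v = q * length u" "u \<noteq> []"
  shows "v = concat (replicate q u)"
  using assms
proof (induction q arbitrary: v)
  case (Suc q)
  then have "length u \<le> length v" by simp
  then obtain v' where v: "v = u @ v'"
    using Suc.prems(1) by (metis append_eq_append_conv_if append_eq_conv_conj append_take_drop_id)
  then have "v' @ u = u @ v'" using Suc.prems(1) by simp
  then have "v' = concat (replicate q u)" using Suc v by simp
  then show ?case using v by simp
qed simp

section \<open>Words in a group and their twisted cyclic shift\<close>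

definition word_prod :: "('a, 'b) monoid_scheme \<Rightarrow> 'a list \<Rightarrow> 'a" where
  "word_prod G xs = foldr (\<lambda>x y. x \<otimes>\<^bsub>G\<^esub> y) xs \<one>\<^bsub>G\<^esub>"

definition words :: "('a, 'b) monoid_scheme \<Rightarrow> nat \<Rightarrow> 'a \<Rightarrow> 'a list set" where
  "words G n h = {xs. set xs \<subseteq> carrier G \<and> length xs = n \<and> word_prod G xs = h}"

text \<open>The coefficient at \<open>h\<close> of the \<open>n\<close>-th power of the element
  \<open>z\<close> of the integral group ring.\<close>

definition word_sum :: "('a, 'b) monoid_scheme \<Rightarrow> ('a \<Rightarrow> int) \<Rightarrow> nat \<Rightarrow> 'a \<Rightarrow> int" where
  "word_sum G z n h = (\<Sum>xs\<in>words G n h. \<Prod>x\<leftarrow>xs. z x)"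

context group
begin

lemma word_prod_closed: "set xs \<subseteq> carrier G \<Longrightarrow> word_prod G xs \<in> carrier G"
  by (induction xs) (auto simp: word_prod_def)

lemma word_prod_append:
  "set xs \<subseteq> carrier G \<Longrightarrow> set ys \<subseteq> carrier G \<Longrightarrow>
    word_prod G (xs @ ys) = word_prod G xs \<otimes> word_prod G ys"
  using word_prod_closed by (induction xs) (auto simp: word_prod_def m_assoc)

lemma word_prod_power:
  "set xs \<subseteq> carrier G \<Longrightarrow> word_prod G (concat (replicate q xs)) = word_prod G xs [^] (q::nat)"
proof (induction q)
  case 0
  then show ?case by (simp add: word_prod_def)
next
  case (Suc q)
  have sub: "set (concat (replicate q xs)) \<subseteq> carrier G" using Suc.prems by auto
  show ?case using Suc word_prod_append[OF Suc.prems sub] word_prod_closed[OF Suc.prems]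
    nat_pow_Suc2[OF word_prod_closed[OF Suc.prems]] by simp
qed

lemma finite_words: "finite (carrier G) \<Longrightarrow> finite (words G n h)"
  by (rule finite_subset[OF _ finite_lists_length_eq[of "carrier G" n]]) (auto simp: words_def)

lemma word_sum_0: "word_sum G z 0 h = (if h = \<one> then 1 else 0)"
proof -
  have "words G 0 h = (if h = \<one> then {[]} else {})" by (auto simp: words_def word_prod_def)
  then show ?thesis by (simp add: word_sum_def)
qed

lemma word_sum_Suc:
  assumes fin: "finite (carrier G)" and h: "h \<in> carrier G"
  shows "word_sum G z (Suc n) h = (\<Sum>a\<in>carrier G. z a * word_sum G z n (inv a \<otimes> h))"
proof -
  have "bij_betw (\<lambda>(a, xs). a # xs) (SIGMA a:carrier G. words G n (inv a \<otimes> h)) (words G (Suc n) h)"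
  proof (rule bij_betw_byWitness[where f' = "\<lambda>xs. (hd xs, tl xs)"])
    show "(\<lambda>(a, xs). a # xs) ` (SIGMA a:carrier G. words G n (inv a \<otimes> h)) \<subseteq> words G (Suc n) h"
      using h by (auto simp: words_def word_prod_def m_assoc[symmetric])
    show "(\<lambda>xs. (hd xs, tl xs)) ` words G (Suc n) h \<subseteq> (SIGMA a:carrier G. words G n (inv a \<otimes> h))"
    proof
      fix y assume "y \<in> (\<lambda>xs. (hd xs, tl xs)) ` words G (Suc n) h"
      then obtain a xs where y: "y = (a, xs)" and w: "a # xs \<in> words G (Suc n) h"
        by (auto simp: words_def length_Suc_conv)
      then show "y \<in> (SIGMA a:carrier G. words G n (inv a \<otimes> h))"
        using word_prod_closed[of xs] by (auto simp: words_def word_prod_def m_assoc[symmetric])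
    qed
  qed (auto simp: words_def length_Suc_conv)
  then have "word_sum G z (Suc n) h = (\<Sum>(a, xs)\<in>(SIGMA a:carrier G. words G n (inv a \<otimes> h)). \<Prod>x\<leftarrow>a # xs. z x)"
    unfolding word_sum_def by (subst sum.reindex_bij_betw[symmetric]) (auto simp: case_prod_unfold)
  also have "\<dots> = (\<Sum>a\<in>carrier G. \<Sum>xs\<in>words G n (inv a \<otimes> h). z a * (\<Prod>x\<leftarrow>xs. z x))"
    using fin finite_words[OF fin] by (subst sum.Sigma) auto
  finally show ?thesis by (simp add: word_sum_def sum_distrib_left)
qed

text \<open>A word with product \<open>g\<close> is read as the infinite sequence \<open>x\<close> with
  \<open>x (i + n) = inv g \<otimes> x i \<otimes> g\<close>; the map below is the shift of that sequence.\<close>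

definition word_shift :: "'a \<Rightarrow> 'a list \<Rightarrow> 'a list" where
  "word_shift g xs = tl xs @ [inv g \<otimes> hd xs \<otimes> g]"

text \<open>Removing the first letter \<open>a\<close> leaves a word with product
  \<open>inv a \<otimes> g\<close>, and the appended letter
  \<open>inv g \<otimes> a \<otimes> g\<close> restores \<open>g\<close>.\<close>

lemma word_shift_in_words:
  assumes "g \<in> carrier G" "xs \<in> words G n g" "n > 0"
  shows "word_shift g xs \<in> words G n g"
proof -
  obtain a ys where Cons: "xs = a # ys" using assms by (cases xs) (auto simp: words_def)
  have a: "a \<in> carrier G" "set ys \<subseteq> carrier G" "a \<otimes> word_prod G ys = g"
    using assms Cons by (auto simp: words_def word_prod_def)
  have p: "word_prod G ys = inv a \<otimes> g" using a word_prod_closed[OF a(2)] assms(1)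
    by (metis inv_solve_left)
  have "word_prod G (word_shift g xs) = inv a \<otimes> g \<otimes> (inv g \<otimes> a \<otimes> g)"
    using a assms(1) Cons p by (simp add: word_shift_def word_prod_append) (simp add: word_prod_def)
  also have "\<dots> = inv a \<otimes> (g \<otimes> (inv g \<otimes> (a \<otimes> g)))"
    using a assms(1) by (simp add: m_assoc)
  also have "\<dots> = inv a \<otimes> (a \<otimes> g)" using a assms(1) by (metis inv_closed inv_solve_left m_closed)
  also have "\<dots> = g" using a assms(1) by (metis inv_solve_left m_closed)
  finally show ?thesis using assms Cons a by (auto simp: words_def word_shift_def)
qed

lemma funpow_word_shift:
  "k \<le> length xs \<Longrightarrow>
    (word_shift g ^^ k) xs = drop k xs @ map (\<lambda>y. inv g \<otimes> y \<otimes> g) (take k xs)"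
proof (induction k)
  case (Suc k)
  then have "drop k xs = xs ! k # drop (Suc k) xs" by (simp add: Cons_nth_drop_Suc)
  then show ?case using Suc by (simp add: word_shift_def take_Suc_conv_app_nth)
qed simp

lemma funpow_conjugate:
  assumes "g \<in> carrier G" "y \<in> carrier G"
  shows "((\<lambda>y. inv g \<otimes> y \<otimes> g) ^^ k) y = inv (g [^] k) \<otimes> y \<otimes> g [^] k"
proof (induction k)
  case (Suc k)
  then show ?case using assms by (simp add: m_assoc inv_mult_group)
qed (use assms in simp)

text \<open>Every \<open>n\<close> shifts conjugate all letters by \<open>g\<close>, so
  \<open>n * s\<close> shifts conjugate them by \<open>g [^] s\<close>, which is trivial.\<close>

lemma word_shift_period:
  assumes "g \<in> carrier G" "xs \<in> words G n g" "g [^] (s::nat) = \<one>"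
  shows "(word_shift g ^^ (n * s)) xs = xs"
proof -
  have len: "length xs = n" and sub: "set xs \<subseteq> carrier G" using assms by (auto simp: words_def)
  have "(word_shift g ^^ (n * k)) xs = map ((\<lambda>y. inv g \<otimes> y \<otimes> g) ^^ k) xs" for k
  proof (induction k)
    case (Suc k)
    let ?ys = "map ((\<lambda>y. inv g \<otimes> y \<otimes> g) ^^ k) xs"
    have "(word_shift g ^^ (n * Suc k)) xs = (word_shift g ^^ n) ?ys"
      using Suc by (simp add: funpow_add)
    also have "\<dots> = map (\<lambda>y. inv g \<otimes> y \<otimes> g) ?ys" using len by (subst funpow_word_shift) auto
    finally show ?case by simp
  qed simp
  then have "(word_shift g ^^ (n * s)) xs = map ((\<lambda>y. inv g \<otimes> y \<otimes> g) ^^ s) xs" .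
  also have "\<dots> = map (\<lambda>y. y) xs"
    using sub by (intro map_cong) (auto simp: funpow_conjugate[OF assms(1)] assms(3))
  finally show ?thesis by simp
qed

text \<open>A word fixed by \<open>b\<close> shifts is fixed by \<open>b * q\<close> shifts, so its
  letters commute with \<open>g\<close>. The shift is then a plain rotation on it, and the word
  consists of \<open>q\<close> copies of its first \<open>b\<close> letters; \<open>h\<close> is
  their product.\<close>

lemma word_shift_fixed:
  assumes g: "g \<in> carrier G" and xs: "xs \<in> words G (b * q) g" and b: "b > 0"
    and fixp: "(word_shift g ^^ b) xs = xs"
  shows "\<exists>h\<in>carrier G. g = h [^] q"
proof (cases "q = 0")
  case True
  then have "g = \<one>" using xs by (auto simp: words_def word_prod_def)
  then show ?thesis using True by auto
next
  case False
  have len: "length xs = b * q" and sub: "set xs \<subseteq> carrier G" and wp: "word_prod G xs = g"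
    using xs by (auto simp: words_def)
  have "(word_shift g ^^ (b * k)) xs = xs" for k
    using fixp by (induction k) (simp_all add: funpow_add)
  then have "map (\<lambda>y. inv g \<otimes> y \<otimes> g) xs = xs"
    using funpow_word_shift[of "length xs" xs g] len by simp
  then have "map (\<lambda>y. inv g \<otimes> y \<otimes> g) (take b xs) = take b xs"
    by (metis take_map)
  then have rot: "drop b xs @ take b xs = take b xs @ drop b xs"
    using funpow_word_shift[of b xs g] fixp len False by simp
  have "drop b xs = concat (replicate (q - 1) (take b xs))"
  proof (rule commuting_words_eq_power[OF rot])
    show "length (drop b xs) = (q - 1) * length (take b xs)"
      using len False by (simp add: diff_mult_distrib2 mult.commute)
    show "take b xs \<noteq> []" using len b False by auto
  qed
  then have "take b xs @ drop b xs = concat (replicate q (take b xs))"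
    using False by (cases q) auto
  then have "xs = concat (replicate q (take b xs))" by simp
  moreover have "set (take b xs) \<subseteq> carrier G" using sub set_take_subset by fast
  ultimately show ?thesis
    using wp word_prod_power[of "take b xs" q] word_prod_closed[of "take b xs"] by metis
qed

text \<open>The shift has period \<open>s ^ Suc r\<close> on the words of length
  \<open>s ^ r\<close> with product \<open>g\<close>. If \<open>s ^ (r - c)\<close> shifts fixed one
  of them, \<open>g\<close> would be \<open>h [^] (s ^ c)\<close> for some \<open>h\<close> whose
  order is a power of \<open>s\<close>. That order is at most the group order, hence below
  \<open>s ^ c\<close>, so it divides \<open>s ^ c\<close> and \<open>g\<close> would be
  trivial.\<close>

lemma prime_power_dvd_word_sum:
  assumes fin: "finite (carrier G)" and g: "g \<in> carrier G" "g \<noteq> \<one>" "g [^] s = \<one>"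
    and s: "Factorial_Ring.prime (s :: nat)" and c: "Coset.order G < s ^ c" "c \<le> r"
    and z: "\<And>y. y \<in> carrier G \<Longrightarrow> z (inv g \<otimes> y \<otimes> g) = z y"
  shows "int (s ^ Suc (r - c)) dvd word_sum G z (s ^ r) g"
  unfolding word_sum_def
proof (rule prime_power_orbits_sum_dvd[where f = "word_shift g" and N = "Suc r", OF finite_words[OF fin] _ _ _ s])
  fix xs assume xs: "xs \<in> words G (s ^ r) g"
  show "word_shift g xs \<in> words G (s ^ r) g" using xs g s by (intro word_shift_in_words) (auto simp: prime_gt_0_nat)
  show "(word_shift g ^^ (s ^ Suc r)) xs = xs"
    using word_shift_period[OF g(1) xs g(3)] by (simp add: mult.commute)
  have ne: "xs \<noteq> []" using xs g by (auto simp: words_def word_prod_def)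
  then show "(\<Prod>x\<leftarrow>word_shift g xs. z x) = (\<Prod>x\<leftarrow>xs. z x)"
    using z xs by (cases xs) (auto simp: word_shift_def words_def)
  show "(word_shift g ^^ (s ^ (r - c))) xs \<noteq> xs"
  proof
    assume "(word_shift g ^^ (s ^ (r - c))) xs = xs"
    moreover have "s ^ r = s ^ (r - c) * s ^ c" using c by (simp flip: power_add)
    ultimately obtain h where h: "h \<in> carrier G" "g = h [^] (s ^ c)"
      using word_shift_fixed[OF g(1), of xs "s ^ (r - c)" "s ^ c"] xs s prime_gt_0_nat by auto
    have "h [^] (s ^ Suc c) = \<one>" using h g(3) by (simp add: nat_pow_pow mult.commute)
    then have "ord h dvd s ^ Suc c" using h pow_eq_id by blast
    then obtain j where j: "ord h = s ^ j" "j \<le> Suc c" using s divides_primepow_nat by blast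
    have "ord h \<le> Coset.order G" using ord_le_group_order[OF fin h(1)] .
    then have "s ^ j < s ^ c" using j c by simp
    then have "j < c" using s by (meson power_strict_increasing_iff prime_gt_1_nat)
    then have "ord h dvd s ^ c" using j by (simp add: le_imp_power_dvd)
    then have "g = \<one>" using h pow_eq_id by blast
    then show False using g by simp
  qed
qed

end

section \<open>Conjugacy classes and subgroups of prime power order\<close>

definition conj_class :: "('a, 'b) monoid_scheme \<Rightarrow> 'a \<Rightarrow> 'a set" where
  "conj_class G x = (\<lambda>g. g \<otimes>\<^bsub>G\<^esub> x \<otimes>\<^bsub>G\<^esub> inv\<^bsub>G\<^esub> g) ` carrier G"

text \<open>The maps \<open>f\<close> inject any fibre of \<open>\<pi>\<close> into any other one,
  so all fibres have the same size.\<close>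

lemma card_dvd_of_equal_fibers:
  assumes fin: "finite X"
    and tr: "\<And>u v. u \<in> X \<Longrightarrow> v \<in> X \<Longrightarrow> \<exists>f. inj_on f X \<and> f ` X \<subseteq> X \<and> (\<forall>u'\<in>X. \<pi> u' = \<pi> u \<longrightarrow> \<pi> (f u') = \<pi> v)"
  shows "card (\<pi> ` X) dvd card X"
proof (cases "X = {}")
  case False
  then obtain u where u: "u \<in> X" by blast
  let ?F = "\<lambda>y. {v\<in>X. \<pi> v = y}"
  have le: "card (?F (\<pi> a)) \<le> card (?F (\<pi> b))" if ab: "a \<in> X" "b \<in> X" for a b
  proof -
    obtain f where f: "inj_on f X" "f ` X \<subseteq> X" "\<forall>u'\<in>X. \<pi> u' = \<pi> a \<longrightarrow> \<pi> (f u') = \<pi> b"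
      using tr[OF ab] by blast
    show ?thesis
    proof (rule card_inj_on_le[where f = f])
      show "inj_on f (?F (\<pi> a))" using f(1) by (rule inj_on_subset) auto
    qed (use f fin in auto)
  qed
  have eq: "card (?F y) = card (?F (\<pi> u))" if "y \<in> \<pi> ` X" for y
    using that le u by (auto intro!: antisym)
  have "card X = card (\<Union>y\<in>\<pi> ` X. ?F y)" by (rule arg_cong[where f = card]) auto
  also have "\<dots> = (\<Sum>y\<in>\<pi> ` X. card (?F y))" using fin by (intro card_UN_disjoint) auto
  also have "\<dots> = card (\<pi> ` X) * card (?F (\<pi> u))" using eq by simp
  finally show ?thesis by simp
qed simp

lemma prime_order_comm_group:
  fixes G (structure)
  assumes "group G" "Factorial_Ring.prime (Coset.order G)"
  shows "comm_group G"
proof -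
  interpret group G by fact
  have fin: "finite (carrier G)"
    using prime_gt_0_nat[OF assms(2)] unfolding Coset.order_def by (rule card_ge_0_finite)
  have "card {\<one>} < card (carrier G)" using prime_gt_1_nat[OF assms(2)] by (simp add: Coset.order_def)
  then have "\<not> carrier G \<subseteq> {\<one>}" by (metis card_mono finite.simps finite_insert not_less)
  then obtain a where a: "a \<in> carrier G" "a \<noteq> \<one>" by blast
  have "ord a dvd Coset.order G" using ord_dvd_group_order a by blast
  moreover have "ord a \<noteq> 1" using a ord_eq_1 by blast
  ultimately have "card (generate G {a}) = card (carrier G)"
    using assms(2) unfolding generate_pow_card[OF a(1)] prime_nat_iff Coset.order_def by blast
  then have "generate G {a} = carrier G"
    using fin a(1) by (intro card_subset_eq generate_incl) auto
  then have all: "\<exists>k::nat. y = a [^] k" if "y \<in> carrier G" for y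
    using that generate_pow_on_finite_carrier[OF fin a(1)] by auto
  show ?thesis
  proof (rule group_comm_groupI)
    fix y z assume "y \<in> carrier G" "z \<in> carrier G"
    then obtain i j :: nat where "y = a [^] i" "z = a [^] j" using all by metis
    then show "y \<otimes> z = z \<otimes> y" using a(1) by (simp add: nat_pow_mult add.commute)
  qed
qed

context group
begin

section \<open>Conjugacy classes and centralizers\<close>

lemma inv_mult_cancel:
  assumes "g \<in> carrier G" "y \<in> carrier G"
  shows "inv g \<otimes> (g \<otimes> y) = y" "g \<otimes> (inv g \<otimes> y) = y"
  using assms by (simp_all add: m_assoc[symmetric])

lemma conj_class_subset: "x \<in> carrier G \<Longrightarrow> conj_class G x \<subseteq> carrier G"
  by (auto simp: conj_class_def)

lemma self_in_conj_class: "x \<in> carrier G \<Longrightarrow> x \<in> conj_class G x"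
  unfolding conj_class_def by (rule image_eqI[where x = \<one>]) auto

lemma conj_mult:
  assumes "g \<in> carrier G" "h \<in> carrier G" "x \<in> carrier G"
  shows "g \<otimes> (h \<otimes> x \<otimes> inv h) \<otimes> inv g = (g \<otimes> h) \<otimes> x \<otimes> inv (g \<otimes> h)"
  using assms by (simp add: inv_mult_group m_assoc)

lemma conj_inv_cancel:
  assumes "g \<in> carrier G" "x \<in> carrier G"
  shows "inv g \<otimes> (g \<otimes> x \<otimes> inv g) \<otimes> g = x"
  using assms by (simp add: m_assoc inv_mult_cancel)

lemma conj_pow:
  assumes "g \<in> carrier G" "x \<in> carrier G"
  shows "(g \<otimes> x \<otimes> inv g) [^] (k::nat) = g \<otimes> x [^] k \<otimes> inv g"
proof (induction k)
  case (Suc k)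
  then show ?case using assms by (simp add: m_assoc inv_mult_cancel)
qed (use assms in simp)

lemma conj_class_closed:
  assumes "x \<in> carrier G" "y \<in> conj_class G x" "g \<in> carrier G"
  shows "g \<otimes> y \<otimes> inv g \<in> conj_class G x"
  using assms conj_mult by (force simp: conj_class_def)

lemma conj_class_eq:
  assumes x: "x \<in> carrier G" and y: "y \<in> conj_class G x"
  shows "conj_class G y = conj_class G x"
proof
  show "conj_class G y \<subseteq> conj_class G x"
    using conj_class_closed[OF x y] by (auto simp: conj_class_def[of G y])
  obtain g where g: "g \<in> carrier G" "y = g \<otimes> x \<otimes> inv g" using y by (auto simp: conj_class_def)
  then have "x = inv g \<otimes> y \<otimes> inv (inv g)" using x conj_inv_cancel by simp
  then have "x \<in> conj_class G y" using g(1) unfolding conj_class_def by blast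
  moreover have "y \<in> carrier G" using x y conj_class_subset by blast
  ultimately show "conj_class G x \<subseteq> conj_class G y"
    using conj_class_closed by (auto simp: conj_class_def[of G x])
qed

text \<open>Conjugation carries fibres of \<open>\<pi>\<close> to fibres and is transitive on the
  class. This serves for power maps and for quotient maps.\<close>

lemma card_conj_class_image_dvd:
  assumes fin: "finite (carrier G)" and x: "x \<in> carrier G"
    and \<pi>: "\<And>u v g. u \<in> carrier G \<Longrightarrow> v \<in> carrier G \<Longrightarrow> g \<in> carrier G \<Longrightarrow> \<pi> u = \<pi> v \<Longrightarrow>
      \<pi> (g \<otimes> u \<otimes> inv g) = \<pi> (g \<otimes> v \<otimes> inv g)"
  shows "card (\<pi> ` conj_class G x) dvd card (conj_class G x)"
proof (rule card_dvd_of_equal_fibers)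
  note sub = conj_class_subset[OF x]
  show "finite (conj_class G x)" using fin sub by (rule finite_subset[rotated])
  fix u v assume uv: "u \<in> conj_class G x" "v \<in> conj_class G x"
  then have "v \<in> conj_class G u" using conj_class_eq[OF x] by blast
  then obtain g where g: "g \<in> carrier G" "v = g \<otimes> u \<otimes> inv g" by (auto simp: conj_class_def)
  show "\<exists>f. inj_on f (conj_class G x) \<and> f ` conj_class G x \<subseteq> conj_class G x \<and>
      (\<forall>u'\<in>conj_class G x. \<pi> u' = \<pi> u \<longrightarrow> \<pi> (f u') = \<pi> v)"
  proof (intro exI conjI ballI impI)
    show "inj_on (\<lambda>h. g \<otimes> h \<otimes> inv g) (conj_class G x)"
    proof (rule inj_onI)
      fix a b assume "a \<in> conj_class G x" "b \<in> conj_class G x" "g \<otimes> a \<otimes> inv g = g \<otimes> b \<otimes> inv g"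
      then show "a = b" using conj_inv_cancel[OF g(1)] sub by (metis subsetD)
    qed
  next
    show "(\<lambda>h. g \<otimes> h \<otimes> inv g) ` conj_class G x \<subseteq> conj_class G x"
      using conj_class_closed[OF x _ g(1)] by blast
  next
    fix u' assume "u' \<in> conj_class G x" "\<pi> u' = \<pi> u"
    then show "\<pi> (g \<otimes> u' \<otimes> inv g) = \<pi> v"
      unfolding g(2) using uv(1) sub g(1) by (intro \<pi>) auto
  qed
qed

lemma card_conj_class_pow_dvd:
  assumes fin: "finite (carrier G)" and x: "x \<in> carrier G"
  shows "card (conj_class G (x [^] (j::nat))) dvd card (conj_class G x)"
proof -
  have "conj_class G (x [^] j) = (\<lambda>u. u [^] j) ` conj_class G x"
    using x by (auto simp: conj_class_def conj_pow image_image)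
  then show ?thesis
    using card_conj_class_image_dvd[OF fin x, of "\<lambda>u. u [^] j"] by (simp add: conj_pow)
qed

lemma card_conj_class_centralizer:
  assumes x: "x \<in> carrier G"
  shows "card (conj_class G x) * card {g\<in>carrier G. g \<otimes> x = x \<otimes> g} = Coset.order G"
    and subgroup_centralizer: "subgroup {g\<in>carrier G. g \<otimes> x = x \<otimes> g} G"
proof -
  interpret A: group_action G "carrier G" "\<lambda>g. \<lambda>h\<in>carrier G. g \<otimes> h \<otimes> inv g"
    by (rule action_by_conjugation)
  have "orbit G (\<lambda>g. \<lambda>h\<in>carrier G. g \<otimes> h \<otimes> inv g) x = conj_class G x"
    using x by (auto simp: orbit_def conj_class_def)
  moreover have "stabilizer G (\<lambda>g. \<lambda>h\<in>carrier G. g \<otimes> h \<otimes> inv g) x = {g\<in>carrier G. g \<otimes> x = x \<otimes> g}"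
    using x by (auto simp: stabilizer_def inv_solve_right')
  ultimately show "card (conj_class G x) * card {g\<in>carrier G. g \<otimes> x = x \<otimes> g} = Coset.order G"
    and "subgroup {g\<in>carrier G. g \<otimes> x = x \<otimes> g} G"
    using A.orbit_stabilizer_theorem[OF x] A.stabilizer_subgroup[OF x] by simp_all
qed

section \<open>Actions on cosets and groups of prime power order\<close>

lemma funpow_r_coset:
  assumes "C \<subseteq> carrier G" "y \<in> carrier G"
  shows "((\<lambda>C. C #> y) ^^ j) C = C #> (y [^] (j::nat))"
  using assms by (induction j) (simp_all add: coset_mult_assoc coset_mult_one)

lemma r_coset_in_rcosets:
  assumes "subgroup K G" "y \<in> carrier G" "C \<in> rcosets K"
  shows "C #> y \<in> rcosets K"
proof -
  obtain a where "a \<in> carrier G" "C = K #> a" using assms(3) by (auto simp: RCOSETS_def)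
  then have "C #> y = K #> (a \<otimes> y)" using assms by (simp add: coset_mult_assoc subgroup.subset)
  then show ?thesis using \<open>a \<in> carrier G\<close> assms(2) by (auto simp: RCOSETS_def)
qed

text \<open>Right multiplication by \<open>y\<close> permutes the cosets in orbits of
  \<open>p\<close>-power length, and the moved cosets are those in orbits of length greater than
  1.\<close>

lemma card_moved_rcosets_dvd:
  assumes fin: "finite (carrier G)" and p: "Factorial_Ring.prime (p::nat)" and K: "subgroup K G"
    and y: "y \<in> carrier G" "y [^] (p ^ k) = \<one>"
  shows "p dvd card {C \<in> rcosets K. C #> y \<noteq> C}"
proof -
  let ?T = "{C \<in> rcosets K. C #> y \<noteq> C}"
  have carr: "C \<subseteq> carrier G" if "C \<in> rcosets K" for C
    using that rcosets_part_G[OF K] by blast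
  have "int (p ^ Suc 0) dvd (\<Sum>C\<in>?T. 1)"
  proof (rule prime_power_orbits_sum_dvd[where f = "\<lambda>C. C #> y" and N = k, OF _ _ _ _ p])
    have "finite (rcosets K)"
      using fin rcosets_part_G[OF K] by (metis finite_UnionD)
    then show "finite ?T" by simp
    fix C assume C: "C \<in> ?T"
    then have CK: "C \<in> rcosets K" by simp
    show "((\<lambda>C. C #> y) ^^ p ^ k) C = C"
      using funpow_r_coset[OF carr[OF CK] y(1)] carr[OF CK] y(2) by (simp add: coset_mult_one)
    have "(C #> y) #> y \<noteq> C #> y"
    proof
      assume "(C #> y) #> y = C #> y"
      then have "((C #> y) #> y) #> inv y = (C #> y) #> inv y" by simp
      then show False using C carr[OF CK] y(1) 
        by (simp add: coset_mult_assoc m_assoc coset_mult_one)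
    qed
    then show "C #> y \<in> ?T" using r_coset_in_rcosets[OF K y(1) CK] by simp
    show "((\<lambda>C. C #> y) ^^ p ^ 0) C \<noteq> C" using C by simp
  qed simp
  then show ?thesis by simp
qed

lemma card_subgroup_dvd:
  assumes "subgroup A G" "subgroup B G" "A \<subseteq> B"
  shows "card A dvd card B"
proof -
  have "card (rcosets\<^bsub>G\<lparr>carrier := B\<rparr>\<^esub> A) * card A = card B"
    using group.lagrange[OF subgroup_imp_group[OF assms(2)] subgroup_incl[OF assms]]
    by (simp add: Coset.order_def)
  from this[symmetric] show ?thesis by simp
qed

lemma conj_in_subgroup_if_coset_fixed:
  assumes K: "subgroup K G" and h: "h \<in> carrier G" and y: "y \<in> carrier G"
    and eq: "(K #> h) #> y = K #> h"
  shows "h \<otimes> y \<otimes> inv h \<in> K"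
proof -
  have "h \<otimes> y \<in> K #> h"
    using rcos_self[OF _ K, of "h \<otimes> y"] eq h y coset_mult_assoc[OF subgroup.subset[OF K] h y] by simp
  then obtain k where k: "k \<in> K" "h \<otimes> y = k \<otimes> h" unfolding r_coset_def by auto
  have "k \<in> carrier G" using subgroup.subset[OF K] k(1) by blast
  then have "h \<otimes> y \<otimes> inv h = k" unfolding k(2) using h by (simp add: m_assoc)
  then show ?thesis using k by simp
qed

lemma subgroup_pow_card:
  assumes "subgroup K G" "y \<in> K"
  shows "y [^] card K = \<one>"
proof -
  interpret K: group "G\<lparr>carrier := K\<rparr>" using assms(1) by (rule subgroup_imp_group)
  show ?thesis using K.pow_order_eq_1[of y] assms(2) by (simp add: Coset.order_def nat_pow_consistent[symmetric])
qed

text \<open>The number of cosets moved by an element \<open>y\<close> of \<open>K\<close> is a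
  multiple of \<open>p\<close>, but less than \<open>p\<close> because \<open>K\<close> itself is
  fixed. So all cosets are fixed, which places every conjugate of \<open>y\<close> in
  \<open>K\<close>.\<close>

lemma normal_prime_index:
  assumes fin: "finite (carrier G)" and p: "Factorial_Ring.prime (p::nat)"
    and K: "subgroup K G" "card K = p ^ k" and index: "card (rcosets K) = p"
  shows "K \<lhd> G"
proof (rule normal_invI[OF K(1)])
  fix h y assume h: "h \<in> carrier G" and yK: "y \<in> K"
  have y: "y \<in> carrier G" using yK subgroup.subset[OF K(1)] by blast
  let ?T = "{C \<in> rcosets K. C #> y \<noteq> C}"
  have finr: "finite (rcosets K)" using index p by (metis card_ge_0_finite prime_gt_0_nat)
  have "p dvd card ?T"
    using card_moved_rcosets_dvd[OF fin p K(1) y] subgroup_pow_card[OF K(1) yK] K(2) by simp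
  moreover have "card ?T < card (rcosets K)"
  proof (rule psubset_card_mono[OF finr])
    have "K #> \<one> \<in> rcosets K" by (auto simp: RCOSETS_def)
    then have "K \<in> rcosets K" using coset_mult_one[OF subgroup.subset[OF K(1)]] by simp
    moreover have "K #> y = K" using coset_join2[OF y K(1) yK] .
    ultimately show "?T \<subset> rcosets K" by auto
  qed
  ultimately have "card ?T = 0" unfolding index using nat_dvd_not_less by blast
  moreover have "finite ?T" using finr by simp
  ultimately have "?T = {}" using card_0_eq by blast
  moreover have "K #> h \<in> rcosets K" using h by (auto simp: RCOSETS_def)
  ultimately show "h \<otimes> y \<otimes> inv h \<in> K"
    by (intro conj_in_subgroup_if_coset_fixed[OF K(1) h y]) blast
qed

text \<open>Sylow's theorem inside \<open>H\<close> gives a subgroup of order \<open>p ^ k\<close>.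
  Its index is \<open>p\<close>, so it is normal and the quotient is cyclic of prime order.\<close>

lemma solvable_seq_prime_power_subgroup:
  assumes fin: "finite (carrier G)" and p: "Factorial_Ring.prime (p::nat)"
  shows "subgroup H G \<Longrightarrow> card H = p ^ k \<Longrightarrow> solvable_seq G H"
proof (induction k arbitrary: H)
  case 0
  then have "H = {\<one>}" using subgroup.one_closed[OF 0(1)] by (auto simp: card_1_singleton_iff)
  then show ?case using unity by simp
next
  case (Suc k)
  let ?H = "G\<lparr>carrier := H\<rparr>"
  interpret H: group ?H using Suc.prems(1) by (rule subgroup_imp_group)
  have finH: "finite (carrier ?H)" using fin finite_subset[OF subgroup.subset[OF Suc.prems(1)]] by simp
  obtain K where K: "subgroup K ?H" "card K = p ^ k"
    using sylow_thm[OF p H.is_group, of k p] Suc.prems finH by (auto simp: Coset.order_def mult.commute)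
  have "card (rcosets\<^bsub>?H\<^esub> K) * p ^ k = p * p ^ k"
    using H.lagrange[OF K(1)] K(2) Suc.prems by (simp add: Coset.order_def)
  then have index: "card (rcosets\<^bsub>?H\<^esub> K) = p"
    using prime_gt_0_nat[OF p] by (metis mult_right_cancel not_gr_zero power_not_zero)
  have normal: "K \<lhd> ?H" using H.normal_prime_index[OF finH p K index] .
  have "solvable_seq G K" using Suc.IH[OF incl_subgroup[OF Suc.prems(1) K(1)] K(2)] .
  moreover have "comm_group (?H Mod K)"
    using prime_order_comm_group[OF normal.factorgroup_is_group[OF normal]] index p
    by (simp add: Coset.order_def FactGroup_def)
  ultimately show ?case using normal Suc.prems(1) extension by blast
qed

text \<open>Some conjugate of \<open>y\<close> lies in a Sylow \<open>p\<close>-subgroup \<open>H\<close>, and \<open>H\<close> acts transitively on the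
  conjugacy class of \<open>y\<close> because the index of the centralizer is a power of \<open>p\<close>.\<close>

lemma generate_conj_class_prime_power:
  assumes fin: "finite (carrier G)" and p: "Factorial_Ring.prime (p::nat)"
    and y0: "y\<^sub>0 \<in> carrier G" "y\<^sub>0 [^] (p ^ b) = \<one>" and cls: "card (conj_class G y\<^sub>0) = p ^ a"
  shows "\<exists>c. card (generate G (conj_class G y\<^sub>0)) = p ^ c"
proof -
  define \<alpha> where "\<alpha> = multiplicity p (Coset.order G)"
  have o0: "Coset.order G \<noteq> 0" using fin by (simp add: order_gt_0_iff_finite)
  obtain m where m: "Coset.order G = p ^ \<alpha> * m" "\<not> p dvd m"
    using multiplicity_decompose'[of "Coset.order G" p] o0 prime_gt_1_nat[OF p] unfolding \<alpha>_def
    by (metis less_numeral_extra(4) nat_dvd_1_iff_1)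
  obtain H where H: "subgroup H G" "card H = p ^ \<alpha>"
    using sylow_thm[OF p is_group m(1) fin] by blast
  have "card (rcosets H) * p ^ \<alpha> = m * p ^ \<alpha>" using lagrange[OF H(1)] H(2) m(1) by (simp add: mult.commute)
  then have index: "card (rcosets H) = m" using prime_gt_0_nat[OF p] by simp
  \<comment> \<open>The number of moved cosets is divisible by \<open>p\<close>, while the number
    \<open>m\<close> of all cosets is not.\<close>
  have "\<exists>C\<in>rcosets H. C #> y\<^sub>0 = C"
  proof (rule ccontr)
    assume "\<not> ?thesis"
    then have "{C \<in> rcosets H. C #> y\<^sub>0 \<noteq> C} = rcosets H" by blast
    then show False using card_moved_rcosets_dvd[OF fin p H(1) y0] index m(2) by simp
  qed
  then obtain h where h: "h \<in> carrier G" "(H #> h) #> y\<^sub>0 = H #> h" by (auto simp: RCOSETS_def)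
  define y where "y = h \<otimes> y\<^sub>0 \<otimes> inv h"
  have yH: "y \<in> H" unfolding y_def by (rule conj_in_subgroup_if_coset_fixed[OF H(1) h(1) y0(1) h(2)])
  have ycl: "conj_class G y = conj_class G y\<^sub>0"
    using y0(1) h(1) by (intro conj_class_eq) (auto simp: y_def conj_class_def)
  have y: "y \<in> carrier G" using yH subgroup.subset[OF H(1)] by blast
  define C where "C = {g\<in>carrier G. g \<otimes> y = y \<otimes> g}"
  have C: "subgroup C G" using subgroup_centralizer[OF y] by (simp add: C_def)
  have cardC: "p ^ a * card C = p ^ \<alpha> * m"
    using card_conj_class_centralizer[OF y] cls ycl m(1) by (simp add: C_def)
  have HC: "subgroup (H \<inter> C) G" using subgroups_Inter_pair[OF H(1) C] .
  have d1: "card (H \<inter> C) dvd card H" and d2: "card (H \<inter> C) dvd card C"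
    using card_subgroup_dvd[OF HC] H(1) C by auto
  obtain c where c: "card (H \<inter> C) = p ^ c" using d1 H(2) p divides_primepow_nat by metis
  have "p ^ a * p ^ c dvd p ^ \<alpha> * m" using d2 c cardC by (metis dvd_refl mult_dvd_mono)
  then have ac: "a + c \<le> \<alpha>"
  proof -
    assume "p ^ a * p ^ c dvd p ^ \<alpha> * m"
    then have "p ^ (a + c) dvd Coset.order G" by (simp add: power_add m(1))
    then show ?thesis using o0 p unfolding \<alpha>_def by (intro multiplicity_geI) auto
  qed
  define \<phi> where "\<phi> = (\<lambda>h. h \<otimes> y \<otimes> inv h)"
  have finH: "finite H" using fin H(1) subgroup.subset finite_subset by blast
  \<comment> \<open>Elements of \<open>H\<close> that conjugate \<open>y\<close> to the same element
    differ by an element of \<open>H \<inter> C\<close>. So \<open>\<phi>\<close> takes at least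
    \<open>p ^ (\<alpha> - c)\<close> values on \<open>H\<close>, hence at least
    \<open>p ^ a\<close>, and these exhaust the class.\<close>
  have fiber: "card {h\<in>H. \<phi> h = z} \<le> p ^ c" if z: "z \<in> \<phi> ` H" for z
  proof -
    obtain h0 where h0: "h0 \<in> H" "z = \<phi> h0" using z by blast
    note HG = subgroup.subset[OF H(1), THEN subsetD]
    have "card {h\<in>H. \<phi> h = z} \<le> card (H \<inter> C)"
    proof (rule card_inj_on_le[where f = "\<lambda>h. inv h0 \<otimes> h"])
      show "inj_on (\<lambda>h. inv h0 \<otimes> h) {h\<in>H. \<phi> h = z}"
      proof (rule inj_onI)
        fix h k assume "h \<in> {h\<in>H. \<phi> h = z}" "k \<in> {h\<in>H. \<phi> h = z}" "inv h0 \<otimes> h = inv h0 \<otimes> k"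
        then show "h = k" using HG[of h] HG[of k] HG[OF h0(1)] by simp
      qed
      show "(\<lambda>h. inv h0 \<otimes> h) ` {h\<in>H. \<phi> h = z} \<subseteq> H \<inter> C"
      proof
        fix w assume "w \<in> (\<lambda>h. inv h0 \<otimes> h) ` {h\<in>H. \<phi> h = z}"
        then obtain h where w: "h \<in> H" "\<phi> h = \<phi> h0" "w = inv h0 \<otimes> h" using h0 by auto
        have carr: "h \<in> carrier G" "h0 \<in> carrier G" using HG w(1) h0(1) by blast+
        have "h \<otimes> y = \<phi> h \<otimes> h" using carr y by (simp add: m_assoc \<phi>_def)
        then have hy: "h \<otimes> y = \<phi> h0 \<otimes> h" using w(2) by simp
        have "w \<otimes> y = inv h0 \<otimes> (h \<otimes> y)" unfolding w(3) using carr y by (simp add: m_assoc)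
        also have "\<dots> = y \<otimes> w"
          unfolding hy w(3) using carr y by (simp add: m_assoc \<phi>_def inv_mult_cancel)
        finally have "w \<otimes> y = y \<otimes> w" .
        moreover have "w \<in> H" using w(1,3) h0(1) H(1) by (simp add: subgroup.m_closed subgroup.m_inv_closed)
        ultimately show "w \<in> H \<inter> C" using HG[of w] by (simp add: C_def)
      qed
    qed (use finH in simp)
    then show ?thesis using c by simp
  qed
  have "card H = card (\<Union>z\<in>\<phi> ` H. {h\<in>H. \<phi> h = z})" by (rule arg_cong[where f = card]) auto
  also have "\<dots> = (\<Sum>z\<in>\<phi> ` H. card {h\<in>H. \<phi> h = z})" using finH by (intro card_UN_disjoint) auto
  also have "\<dots> \<le> (\<Sum>z\<in>\<phi> ` H. p ^ c)" using fiber by (intro sum_mono) auto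
  finally have "p ^ \<alpha> \<le> card (\<phi> ` H) * p ^ c" using H(2) by simp
  moreover have "p ^ (a + c) \<le> p ^ \<alpha>" using ac prime_gt_0_nat[OF p] by (intro power_increasing) auto
  ultimately have "p ^ a * p ^ c \<le> card (\<phi> ` H) * p ^ c" unfolding power_add by (rule order_trans[rotated])
  then have "p ^ a \<le> card (\<phi> ` H)" using prime_gt_0_nat[OF p] by simp
  moreover have sub: "\<phi> ` H \<subseteq> conj_class G y" using subgroup.subset[OF H(1)] by (auto simp: \<phi>_def conj_class_def)
  moreover have "finite (conj_class G y)" using fin conj_class_subset[OF y] finite_subset by blast
  ultimately have "\<phi> ` H = conj_class G y"
    using cls ycl by (intro card_seteq) auto
  moreover have "\<phi> ` H \<subseteq> H"
    using yH H(1) by (auto simp: \<phi>_def subgroup.m_closed subgroup.m_inv_closed)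
  ultimately have "generate G (conj_class G y) \<subseteq> H"
    using H(1) by (intro generate_subgroup_incl) auto
  then have "card (generate G (conj_class G y)) dvd card H"
    using card_subgroup_dvd[OF generate_is_subgroup[OF conj_class_subset[OF y]] H(1)] by blast
  then show ?thesis using H(2) p divides_primepow_nat ycl by metis
qed

end

section \<open>The complex group algebra\<close>

locale finite_group = group G for G (structure) +
  assumes fin: "finite (carrier G)"
begin

definition conv :: "('a \<Rightarrow> complex) \<Rightarrow> ('a \<Rightarrow> complex) \<Rightarrow> 'a \<Rightarrow> complex" (infixl "\<star>" 70) where
  "f \<star> g = (\<lambda>h. if h \<in> carrier G then \<Sum>a\<in>carrier G. f a * g (inv a \<otimes> h) else 0)"

text \<open>Elements of the group algebra vanish outside the carrier, so that equality in the
  algebra is equality of functions.\<close>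

definition group_alg :: "('a \<Rightarrow> complex) set" where
  "group_alg = {f. \<forall>h. h \<notin> carrier G \<longrightarrow> f h = 0}"

definition delta :: "'a \<Rightarrow> 'a \<Rightarrow> complex" where "delta a = (\<lambda>h. if h = a then 1 else 0)"

text \<open>Convolution by \<open>star f\<close> is adjoint to convolution by \<open>f\<close> for
  the inner product in which the group elements are orthonormal.\<close>

definition star :: "('a \<Rightarrow> complex) \<Rightarrow> 'a \<Rightarrow> complex" where
  "star f = (\<lambda>h. if h \<in> carrier G then cnj (f (inv h)) else 0)"

text \<open>Class functions; \<open>central_iff_delta\<close> identifies them with the centre of the
  group algebra.\<close>

definition central :: "('a \<Rightarrow> complex) \<Rightarrow> bool" where
  "central f \<longleftrightarrow> f \<in> group_alg \<and> (\<forall>g\<in>carrier G. \<forall>h\<in>carrier G. f (g \<otimes> h \<otimes> inv g) = f h)"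

lemma group_algD: "f \<in> group_alg \<Longrightarrow> h \<notin> carrier G \<Longrightarrow> f h = 0" by (simp add: group_alg_def)

lemma group_alg_eqI:
  "f \<in> group_alg \<Longrightarrow> g \<in> group_alg \<Longrightarrow> (\<And>h. h \<in> carrier G \<Longrightarrow> f h = g h) \<Longrightarrow> f = g"
  by (rule ext) (metis group_algD)

lemma group_alg_closed [simp, intro]:
  "f \<star> g \<in> group_alg" "a \<in> carrier G \<Longrightarrow> delta a \<in> group_alg" "star f \<in> group_alg" "(\<lambda>_. 0) \<in> group_alg"
  "f \<in> group_alg \<Longrightarrow> (\<lambda>h. c * f h) \<in> group_alg"
  "f \<in> group_alg \<Longrightarrow> g \<in> group_alg \<Longrightarrow> (\<lambda>h. f h + g h) \<in> group_alg"
  "f \<in> group_alg \<Longrightarrow> g \<in> group_alg \<Longrightarrow> (\<lambda>h. f h - g h) \<in> group_alg"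
  "(\<And>i. i \<in> I \<Longrightarrow> F i \<in> group_alg) \<Longrightarrow> (\<lambda>h. \<Sum>i\<in>I. F i h) \<in> group_alg"
  by (auto simp: group_alg_def conv_def delta_def star_def intro!: sum.neutral)

lemma conv_linear:
  "(\<lambda>h. f h + g h) \<star> k = (\<lambda>h. (f \<star> k) h + (g \<star> k) h)"
  "k \<star> (\<lambda>h. f h + g h) = (\<lambda>h. (k \<star> f) h + (k \<star> g) h)"
  "(\<lambda>h. f h - g h) \<star> k = (\<lambda>h. (f \<star> k) h - (g \<star> k) h)"
  "k \<star> (\<lambda>h. f h - g h) = (\<lambda>h. (k \<star> f) h - (k \<star> g) h)"
  "(\<lambda>h. c * f h) \<star> k = (\<lambda>h. c * (f \<star> k) h)"
  "k \<star> (\<lambda>h. c * f h) = (\<lambda>h. c * (k \<star> f) h)"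
  "(\<lambda>_. 0) \<star> k = (\<lambda>_. 0)"
  "k \<star> (\<lambda>_. 0) = (\<lambda>_. 0)"
  by (auto simp: conv_def fun_eq_iff sum.distrib sum_subtractf sum_distrib_left algebra_simps)

lemma conv_sum:
  "(\<lambda>h. \<Sum>i\<in>I. F i h) \<star> k = (\<lambda>h. \<Sum>i\<in>I. (F i \<star> k) h)"
  "k \<star> (\<lambda>h. \<Sum>i\<in>I. F i h) = (\<lambda>h. \<Sum>i\<in>I. (k \<star> F i) h)"
  using sum.swap[of _ I "carrier G"]
  by (auto simp: conv_def fun_eq_iff sum_distrib_left sum_distrib_right)

lemma bij_left_mult: "a \<in> carrier G \<Longrightarrow> bij_betw (\<lambda>b. a \<otimes> b) (carrier G) (carrier G)"
  by (rule bij_betwI[where g = "\<lambda>b. inv a \<otimes> b"]) (auto simp: inv_mult_cancel)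

lemma bij_inv_left_mult: "h \<in> carrier G \<Longrightarrow> bij_betw (\<lambda>b. h \<otimes> inv b) (carrier G) (carrier G)"
  by (rule bij_betwI[where g = "\<lambda>b. inv b \<otimes> h"])
     (auto simp: inv_mult_group m_assoc inv_mult_cancel)

lemma bij_inv: "bij_betw (\<lambda>b. inv b) (carrier G) (carrier G)"
  by (rule bij_betwI[where g = "\<lambda>b. inv b"]) auto

lemma conv_assoc: "(f \<star> g) \<star> k = f \<star> (g \<star> k)"
proof (rule group_alg_eqI)
  fix h assume h: "h \<in> carrier G"
  have "((f \<star> g) \<star> k) h = (\<Sum>a\<in>carrier G. \<Sum>b\<in>carrier G. f b * g (inv b \<otimes> a) * k (inv a \<otimes> h))"
    using h by (simp add: conv_def sum_distrib_right)
  also have "\<dots> = (\<Sum>b\<in>carrier G. \<Sum>a\<in>carrier G. f b * g (inv b \<otimes> a) * k (inv a \<otimes> h))"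
    by (rule sum.swap)
  also have "\<dots> = (\<Sum>b\<in>carrier G. \<Sum>c\<in>carrier G. f b * g c * k (inv c \<otimes> (inv b \<otimes> h)))"
  proof (rule sum.cong, simp)
    fix b assume b: "b \<in> carrier G"
    have "(\<Sum>a\<in>carrier G. f b * g (inv b \<otimes> a) * k (inv a \<otimes> h)) =
      (\<Sum>c\<in>carrier G. f b * g (inv b \<otimes> (b \<otimes> c)) * k (inv (b \<otimes> c) \<otimes> h))"
      by (rule sum.reindex_bij_betw[OF bij_left_mult[OF b], symmetric])
    also have "\<dots> = (\<Sum>c\<in>carrier G. f b * g c * k (inv c \<otimes> (inv b \<otimes> h)))"
      using b h by (intro sum.cong) (auto simp: inv_mult_cancel inv_mult_group m_assoc)
    finally show "(\<Sum>a\<in>carrier G. f b * g (inv b \<otimes> a) * k (inv a \<otimes> h)) =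
      (\<Sum>c\<in>carrier G. f b * g c * k (inv c \<otimes> (inv b \<otimes> h)))" .
  qed
  also have "\<dots> = (f \<star> (g \<star> k)) h"
    using h by (simp add: conv_def sum_distrib_left mult.assoc)
  finally show "((f \<star> g) \<star> k) h = (f \<star> (g \<star> k)) h" .
qed auto

lemma delta_conv: "a \<in> carrier G \<Longrightarrow> h \<in> carrier G \<Longrightarrow> (delta a \<star> f) h = f (inv a \<otimes> h)"
  by (simp add: conv_def delta_def fin if_distrib if_distribR cong: if_cong)

lemma conv_alt: "h \<in> carrier G \<Longrightarrow> (f \<star> g) h = (\<Sum>b\<in>carrier G. f (h \<otimes> inv b) * g b)"
proof -
  assume h: "h \<in> carrier G"
  have "(f \<star> g) h = (\<Sum>b\<in>carrier G. f (h \<otimes> inv b) * g (inv (h \<otimes> inv b) \<otimes> h))"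
    using h by (simp add: conv_def) (rule sum.reindex_bij_betw[OF bij_inv_left_mult[OF h], symmetric])
  also have "\<dots> = (\<Sum>b\<in>carrier G. f (h \<otimes> inv b) * g b)"
    using h by (intro sum.cong) (auto simp: inv_mult_group m_assoc)
  finally show ?thesis .
qed

lemma conv_delta: "a \<in> carrier G \<Longrightarrow> h \<in> carrier G \<Longrightarrow> (f \<star> delta a) h = f (h \<otimes> inv a)"
  by (simp add: conv_alt delta_def fin if_distrib if_distribR cong: if_cong)

lemma delta_delta: "a \<in> carrier G \<Longrightarrow> b \<in> carrier G \<Longrightarrow> delta a \<star> delta b = delta (a \<otimes> b)"
  by (rule group_alg_eqI, simp, simp) (simp add: delta_conv, auto simp: delta_def inv_solve_left')

lemma conv_one: "f \<in> group_alg \<Longrightarrow> delta \<one> \<star> f = f" "f \<in> group_alg \<Longrightarrow> f \<star> delta \<one> = f"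
  by (rule group_alg_eqI; simp add: delta_conv conv_delta)+

lemma conv_at_one: "(f \<star> g) \<one> = (\<Sum>a\<in>carrier G. f a * g (inv a))"
  by (simp add: conv_def)

lemma centralD: "central f \<Longrightarrow> f \<in> group_alg"
  "central f \<Longrightarrow> g \<in> carrier G \<Longrightarrow> h \<in> carrier G \<Longrightarrow> f (g \<otimes> h \<otimes> inv g) = f h"
  by (auto simp: central_def)

lemma central_comm:
  assumes "central f" shows "f \<star> g = g \<star> f"
proof (rule group_alg_eqI)
  fix h assume h: "h \<in> carrier G"
  have "f (h \<otimes> inv b) = f (inv b \<otimes> h)" if b: "b \<in> carrier G" for b
    using centralD(2)[OF assms, of "inv b" "h \<otimes> inv b"] b h by (simp add: m_assoc)
  then show "(f \<star> g) h = (g \<star> f) h"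
    using h unfolding conv_alt[OF h, of f g] by (simp add: conv_def mult.commute)
qed auto

lemma central_iff_delta:
  "central f \<longleftrightarrow> f \<in> group_alg \<and> (\<forall>a\<in>carrier G. delta a \<star> f = f \<star> delta a)"
proof (intro iffI conjI ballI)
  assume f: "f \<in> group_alg \<and> (\<forall>a\<in>carrier G. delta a \<star> f = f \<star> delta a)"
  show "central f"
    unfolding central_def
  proof (intro conjI ballI)
    fix g h assume gh: "g \<in> carrier G" "h \<in> carrier G"
    have "(delta g \<star> f) (g \<otimes> h) = (f \<star> delta g) (g \<otimes> h)" using f gh by simp
    then show "f (g \<otimes> h \<otimes> inv g) = f h" using gh by (simp add: delta_conv conv_delta inv_mult_cancel)
  qed (use f in simp)
next
  assume "central f"
  then show "f \<in> group_alg" "delta a \<star> f = f \<star> delta a" for a using central_comm[of f] by (auto simp: central_def)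
qed

lemma central_conv: "central f \<Longrightarrow> central g \<Longrightarrow> central (f \<star> g)"
  unfolding central_iff_delta by (metis conv_assoc group_alg_closed(1))

lemma central_linear:
  "central (delta \<one>)" "central (\<lambda>_. 0)"
  "central f \<Longrightarrow> central (\<lambda>h. c * f h)"
  "central f \<Longrightarrow> central g \<Longrightarrow> central (\<lambda>h. f h + g h)"
  "central f \<Longrightarrow> central g \<Longrightarrow> central (\<lambda>h. f h - g h)"
  "(\<And>i. i \<in> I \<Longrightarrow> central (F i)) \<Longrightarrow> central (\<lambda>h. \<Sum>i\<in>I. F i h)"
  by (auto simp: central_iff_delta conv_one conv_linear conv_sum)

section \<open>Adjoints and positivity\<close>

lemma star_star: "f \<in> group_alg \<Longrightarrow> star (star f) = f"
  by (rule group_alg_eqI, simp, simp) (simp add: star_def)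

lemma star_conv: "star (f \<star> g) = star g \<star> star f"
proof (rule group_alg_eqI)
  fix h assume h: "h \<in> carrier G"
  have "star (f \<star> g) h = (\<Sum>b\<in>carrier G. cnj (f (inv h \<otimes> inv b)) * cnj (g b))"
    using h by (simp add: star_def conv_alt cnj_sum)
  also have "\<dots> = (\<Sum>b\<in>carrier G. cnj (f (inv h \<otimes> inv (inv b))) * cnj (g (inv b)))"
    by (rule sum.reindex_bij_betw[OF bij_inv, symmetric])
  also have "\<dots> = (star g \<star> star f) h"
    using h by (simp add: star_def conv_def inv_mult_group mult.commute cong: sum.cong)
  finally show "star (f \<star> g) h = (star g \<star> star f) h" .
qed auto

lemma conv_star_at_one: "(f \<star> star f) \<one> = of_real (\<Sum>a\<in>carrier G. (cmod (f a))\<^sup>2)"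
  by (simp add: conv_at_one star_def complex_norm_square of_real_sum del: of_real_power cong: sum.cong)

text \<open>At the identity, \<open>f \<star> star f\<close> takes the squared norm of
  \<open>f\<close> as its value.\<close>

lemma conv_star_eq_0:
  assumes "f \<in> group_alg" "f \<star> star f = (\<lambda>_. 0)" shows "f = (\<lambda>_. 0)"
proof (rule group_alg_eqI[OF assms(1)])
  fix h assume h: "h \<in> carrier G"
  have "(\<Sum>a\<in>carrier G. (cmod (f a))\<^sup>2) = 0"
    using conv_star_at_one[of f] assms(2) by (metis of_real_eq_0_iff)
  then show "f h = 0" using h fin by (subst (asm) sum_nonneg_eq_0_iff) auto
qed auto

text \<open>Let \<open>b\<close> be \<open>f \<star> star f\<close>. Since \<open>f\<close> commutes
  with its adjoint, \<open>b \<star> star b\<close> contains the factor \<open>f \<star> f\<close>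
  and vanishes; positivity then gives first \<open>b = 0\<close> and then
  \<open>f = 0\<close>.\<close>

lemma central_square_eq_0:
  assumes f: "central f" "f \<star> f = (\<lambda>_. 0)" shows "f = (\<lambda>_. 0)"
proof -
  let ?b = "f \<star> star f"
  have "?b \<star> star ?b = (\<lambda>_. 0)"
  proof -
    have "star ?b = ?b" using f centralD(1) by (simp add: star_conv star_star)
    then have "?b \<star> star ?b = f \<star> (star f \<star> f) \<star> star f" by (simp add: conv_assoc)
    also have "star f \<star> f = f \<star> star f" using f central_comm by metis
    also have "f \<star> (f \<star> star f) \<star> star f = (f \<star> f) \<star> (star f \<star> star f)" by (simp add: conv_assoc)
    finally show ?thesis using f by (simp add: conv_linear)
  qed
  from conv_star_eq_0[OF group_alg_closed(1) this] have "?b = (\<lambda>_. 0)" .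
  then show ?thesis by (rule conv_star_eq_0[OF centralD(1)[OF f(1)]])
qed

section \<open>Idempotents and their traces\<close>

definition idem :: "('a \<Rightarrow> complex) \<Rightarrow> bool" where "idem f \<longleftrightarrow> f \<in> group_alg \<and> f \<star> f = f"

lemma idemD: "idem f \<Longrightarrow> f \<in> group_alg" "idem f \<Longrightarrow> f \<star> f = f" by (auto simp: idem_def)

lemma idem_conv:
  assumes "idem f" "idem g" "f \<star> g = g \<star> f" shows "idem (f \<star> g)"
proof -
  have "f \<star> g \<star> (f \<star> g) = f \<star> (g \<star> f) \<star> g" by (simp add: conv_assoc)
  also have "\<dots> = f \<star> f \<star> (g \<star> g)" by (simp only: assms(3)[symmetric] conv_assoc)
  finally show ?thesis using assms by (simp add: idem_def)
qed

text \<open>The difference \<open>d\<close> of \<open>e\<close> and \<open>e \<star> star e\<close>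
  satisfies \<open>d \<star> star d = 0\<close>, so \<open>e\<close> equals the self-adjoint element
  \<open>e \<star> star e\<close>.\<close>

lemma central_idem_star:
  assumes "central e" "idem e" shows "star e = e"
proof -
  note comm = central_comm[OF assms(1), of "star e"]
  note e = idemD[OF assms(2)]
  have ss: "star e \<star> star e = star e" using e by (metis star_conv)
  let ?f = "e \<star> star e"
  have f: "star ?f = ?f" using e by (simp add: star_conv star_star)
  have 1: "e \<star> ?f = ?f" "?f \<star> star e = ?f" using e ss by (simp_all add: conv_assoc[symmetric]) (simp add: conv_assoc ss)
  have 2: "?f \<star> ?f = ?f"
    by (metis 1 comm conv_assoc)
  let ?d = "\<lambda>h. e h - ?f h"
  have "star ?d = (\<lambda>h. star e h - ?f h)"
  proof -
    have "star ?d = (\<lambda>h. star e h - star ?f h)" by (auto simp: star_def fun_eq_iff)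
    then show ?thesis by (simp only: f)
  qed
  then have "?d \<star> star ?d = ?d \<star> (\<lambda>h. star e h - ?f h)" by (rule arg_cong)
  also have "\<dots> = (\<lambda>_. 0)" by (simp only: conv_linear 1 2) simp
  finally have "?d = (\<lambda>_. 0)" by (rule conv_star_eq_0[rotated]) (use e in auto)
  then have "e = ?f" by (simp add: fun_eq_iff)
  then show ?thesis using f by metis
qed

lemma central_idem_at_one:
  assumes "central e" "idem e" shows "e \<one> = of_real (\<Sum>a\<in>carrier G. (cmod (e a))\<^sup>2)"
  using conv_star_at_one[of e] central_idem_star[OF assms] idemD[OF assms(2)] by simp

lemma central_idem_at_one_nz:
  assumes "central e" "idem e" "e \<noteq> (\<lambda>_. 0)" shows "e \<one> \<noteq> 0"
proof
  assume "e \<one> = 0"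
  then have "(\<Sum>a\<in>carrier G. (cmod (e a))\<^sup>2) = 0" using central_idem_at_one[OF assms(1,2)] by (metis of_real_eq_0_iff)
  then have "e = (\<lambda>_. 0)" using fin assms(2)
    by (intro group_alg_eqI) (auto simp: sum_nonneg_eq_0_iff dest: idemD)
  then show False using assms by simp
qed

text \<open>This number is the trace of the idempotent operator of left convolution by
  \<open>u\<close>, whose kernel \<open>u (i \<otimes> inv j)\<close> is constant on the
  diagonal.\<close>

lemma idem_at_one_Nats:
  assumes "idem u" shows "of_nat (card (carrier G)) * u \<one> \<in> \<nat>"
proof -
  have "(\<Sum>i\<in>carrier G. u (i \<otimes> inv i)) \<in> \<nat>"
  proof (rule idempotent_kernel_trace_Nats[OF fin, of "\<lambda>i j. u (i \<otimes> inv j)"])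
    fix i k assume ik: "i \<in> carrier G" "k \<in> carrier G"
    have "(\<Sum>j\<in>carrier G. u (i \<otimes> inv j) * u (j \<otimes> inv k)) = (u \<star> (u \<star> delta k)) i"
      unfolding conv_alt[OF ik(1), of u] using ik by (intro sum.cong) (simp_all add: conv_delta)
    also have "\<dots> = u (i \<otimes> inv k)" using ik idemD[OF assms] by (simp add: conv_assoc[symmetric] conv_delta)
    finally show "(\<Sum>j\<in>carrier G. u (i \<otimes> inv j) * u (j \<otimes> inv k)) = u (i \<otimes> inv k)" .
  qed
  then show ?thesis by (simp cong: sum.cong)
qed

lemma group_alg_expand: "f \<in> group_alg \<Longrightarrow> (\<lambda>h. \<Sum>j\<in>carrier G. f j * delta j h) = f"
  by (rule ext) (auto simp: delta_def fin group_alg_def if_distrib cong: if_cong)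

text \<open>The sum is the trace of the idempotent operator that sends \<open>f\<close> to
  \<open>u \<star> f \<star> v\<close>.\<close>

lemma two_sided_trace_Nats:
  assumes u: "idem u" and v: "idem v"
  shows "(\<Sum>i\<in>carrier G. (u \<star> delta i \<star> v) i) \<in> \<nat>"
proof (rule idempotent_kernel_trace_Nats[OF fin, of "\<lambda>i j. (u \<star> delta j \<star> v) i"])
  fix i k assume ik: "i \<in> carrier G" "k \<in> carrier G"
  let ?f = "u \<star> delta k \<star> v"
  have "(\<Sum>j\<in>carrier G. (u \<star> delta j \<star> v) i * ?f j) = (u \<star> (\<lambda>h. \<Sum>j\<in>carrier G. ?f j * delta j h) \<star> v) i"
    by (simp only: conv_sum conv_linear) (simp only: mult.commute)
  also have "(\<lambda>h. \<Sum>j\<in>carrier G. ?f j * delta j h) = ?f" by (rule group_alg_expand) simp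
  also have "u \<star> ?f \<star> v = (u \<star> u) \<star> delta k \<star> (v \<star> v)" by (simp add: conv_assoc)
  also have "\<dots> = ?f" using u v by (simp add: idemD)
  finally show "(\<Sum>j\<in>carrier G. (u \<star> delta j \<star> v) i * ?f j) = ?f i" .
qed

text \<open>These are the idempotents of the irreducible characters. The scalar action of the centre
  on a block is made the definition; \<open>non_primitive_split\<close> relates it to
  indecomposability.\<close>

definition primitive :: "('a \<Rightarrow> complex) \<Rightarrow> bool" where
  "primitive e \<longleftrightarrow> central e \<and> idem e \<and> e \<noteq> (\<lambda>_. 0) \<and> (\<forall>z. central z \<longrightarrow> (\<exists>c. z \<star> e = (\<lambda>h. c * e h)))"

lemma primitiveD: "primitive e \<Longrightarrow> central e" "primitive e \<Longrightarrow> idem e" "primitive e \<Longrightarrow> e \<noteq> (\<lambda>_. 0)"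
  "primitive e \<Longrightarrow> e \<in> group_alg" "primitive e \<Longrightarrow> e \<star> e = e" "primitive e \<Longrightarrow> e \<one> \<noteq> 0"
  "primitive e \<Longrightarrow> central z \<Longrightarrow> (\<exists>c. z \<star> e = (\<lambda>h. c * e h))"
  using central_idem_at_one_nz by (auto simp: primitive_def idem_def)

text \<open>In terms of the irreducible character \<open>\<chi>\<close> belonging to \<open>e\<close>, the factor \<open>card (carrier G) * e \<one>\<close>
  is \<open>\<chi> \<one> ^ 2\<close> and \<open>t\<close> is the square of the rank of \<open>v\<close> in that representation.\<close>

lemma primitive_multiplicity_square:
  assumes e: "primitive e" and v: "idem v"
  shows "\<exists>t\<in>\<nat>. (of_nat (card (carrier G)) * (v \<star> e) \<one>)\<^sup>2 = of_nat (card (carrier G)) * e \<one> * t"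
proof -
  define u where "u = v \<star> e"
  have ve: "v \<star> e = e \<star> v" using central_comm[OF primitiveD(1)[OF e]] by simp
  have u: "idem u" unfolding u_def using idem_conv[OF v primitiveD(2)[OF e] ve] .
  have ue: "u \<star> e = u" unfolding u_def using primitiveD(5)[OF e] by (simp add: conv_assoc)
  \<comment> \<open>The sum \<open>z\<close> of the conjugates of \<open>v\<close> is central, so it
    acts on the block of \<open>e\<close> by a scalar \<open>\<theta>\<close>; evaluation at the
    identity determines \<open>\<theta>\<close>.\<close>
  define c where "c i = delta i \<star> v \<star> delta (inv i)" for i
  define z where "z = (\<lambda>h. \<Sum>i\<in>carrier G. c i h)"
  have "central z"
    unfolding central_iff_delta
  proof (intro conjI ballI)
    show "z \<in> group_alg" by (auto simp: z_def c_def)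
    fix a assume a: "a \<in> carrier G"
    have "delta a \<star> c i = c (a \<otimes> i) \<star> delta a" if "i \<in> carrier G" for i
    proof -
      have "c (a \<otimes> i) \<star> delta a = (delta a \<star> delta i) \<star> v \<star> (delta (inv i) \<star> delta (inv a) \<star> delta a)"
        using a that by (simp add: c_def delta_delta inv_mult_group conv_assoc)
      also have "delta (inv i) \<star> delta (inv a) \<star> delta a = delta (inv i)"
        using a that by (simp add: delta_delta m_assoc)
      finally show ?thesis by (simp add: c_def conv_assoc)
    qed
    then have "delta a \<star> z = (\<lambda>h. \<Sum>i\<in>carrier G. (c (a \<otimes> i) \<star> delta a) h)"
      by (simp add: z_def conv_sum cong: sum.cong)
    also have "\<dots> = (\<lambda>h. \<Sum>i\<in>carrier G. (c i \<star> delta a) h)"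
      using sum.reindex_bij_betw[OF bij_left_mult[OF a]] by (intro ext) 
    finally show "delta a \<star> z = z \<star> delta a" by (simp add: z_def conv_sum)
  qed
  then obtain \<theta> where \<theta>: "z \<star> e = (\<lambda>h. \<theta> * e h)" using primitiveD(7)[OF e] by blast
  have "\<theta> * e \<one> = (z \<star> e) \<one>" by (simp add: \<theta>)
  also have "\<dots> = (\<Sum>i\<in>carrier G. u \<one>)"
    unfolding z_def conv_sum
  proof (rule sum.cong, simp)
    fix i assume i: "i \<in> carrier G"
    have "c i \<star> e = delta i \<star> (v \<star> (delta (inv i) \<star> e))" by (simp add: c_def conv_assoc)
    also have "delta (inv i) \<star> e = e \<star> delta (inv i)" using central_comm[OF primitiveD(1)[OF e]] by simp
    also have "delta i \<star> (v \<star> (e \<star> delta (inv i))) = delta i \<star> u \<star> delta (inv i)" by (simp add: u_def conv_assoc)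
    finally show "(c i \<star> e) \<one> = u \<one>" using i by (simp add: conv_delta delta_conv)
  qed
  finally have 1: "\<theta> * e \<one> = of_nat (card (carrier G)) * u \<one>" by simp
  \<comment> \<open>The trace of the two-sided operator is expressed by \<open>z\<close> and turns
    out to be \<open>\<theta> * u \<one>\<close>, which is the required \<open>t\<close>.\<close>
  have "(\<Sum>i\<in>carrier G. (u \<star> delta i \<star> v) i) = (\<Sum>i\<in>carrier G. (u \<star> c i) \<one>)"
  proof (rule sum.cong, simp)
    fix i assume i: "i \<in> carrier G"
    have "u \<star> c i = u \<star> delta i \<star> v \<star> delta (inv i)" by (simp add: c_def conv_assoc)
    then show "(u \<star> delta i \<star> v) i = (u \<star> c i) \<one>" using i by (simp add: conv_delta)
  qed
  also have "\<dots> = (u \<star> z) \<one>" by (simp add: z_def conv_sum)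
  also have "u \<star> z = u \<star> (e \<star> z)" by (metis ue conv_assoc)
  also have "e \<star> z = (\<lambda>h. \<theta> * e h)" using central_comm[OF primitiveD(1)[OF e], of z] \<theta> by simp
  also have "(u \<star> (\<lambda>h. \<theta> * e h)) \<one> = \<theta> * u \<one>" by (simp add: conv_linear ue)
  finally have "\<theta> * u \<one> \<in> \<nat>" using two_sided_trace_Nats[OF u v] by simp
  moreover have "(of_nat (card (carrier G)) * u \<one>)\<^sup>2 = of_nat (card (carrier G)) * e \<one> * (\<theta> * u \<one>)"
    unfolding power2_eq_square by (subst 1[symmetric]) (simp only: mult_ac)
  ultimately show ?thesis unfolding u_def by blast
qed

end

section \<open>Primitive central idempotents\<close>

context finite_group
begin

section \<open>Polynomials in a central element\<close>

text \<open>The value of \<open>p\<close> at \<open>z\<close> in the ideal of \<open>e\<close>,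
  where \<open>e\<close> is the unit, computed by Horner's scheme.\<close>

definition poly_action :: "('a \<Rightarrow> complex) \<Rightarrow> ('a \<Rightarrow> complex) \<Rightarrow> complex poly \<Rightarrow> 'a \<Rightarrow> complex" where
  "poly_action z e p = fold_coeffs (\<lambda>a w h. a * e h + (z \<star> w) h) p (\<lambda>_. 0)"

lemma poly_action_0: "poly_action z e 0 = (\<lambda>_. 0)"
  by (simp add: poly_action_def)

lemma poly_action_pCons: "poly_action z e (pCons a p) = (\<lambda>h. a * e h + (z \<star> poly_action z e p) h)"
  by (cases "a = 0 \<and> p = 0") (auto simp: poly_action_def conv_linear)

lemma poly_action_add: "poly_action z e (p + q) = (\<lambda>h. poly_action z e p h + poly_action z e q h)"
proof (induction p q rule: poly_induct2)
  case (pCons a p b q)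
  then show ?case by (simp add: poly_action_pCons conv_linear algebra_simps)
qed (simp add: poly_action_0)

lemma poly_action_smult: "poly_action z e (smult c p) = (\<lambda>h. c * poly_action z e p h)"
  by (induction p) (simp_all add: poly_action_0 poly_action_pCons conv_linear algebra_simps)

lemma poly_action_sum: "poly_action z e (\<Sum>i\<in>I. f i) = (\<lambda>h. \<Sum>i\<in>I. poly_action z e (f i) h)"
  by (induction I rule: infinite_finite_induct) (simp_all add: poly_action_0 poly_action_add)

lemma poly_action_monom: "poly_action z e (Polynomial.monom c k) = (\<lambda>h. c * ((\<star>) z ^^ k) e h)"
  by (induction k) (simp_all add: monom_0 monom_Suc poly_action_0 poly_action_pCons conv_linear)

lemma poly_action_central: "central z \<Longrightarrow> central e \<Longrightarrow> central (poly_action z e p)"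
  by (induction p) (auto simp: poly_action_0 poly_action_pCons intro!: central_linear central_conv)

lemma poly_action_ideal:
  assumes "central z" "central e" "idem e"
  shows "e \<star> poly_action z e p = poly_action z e p"
proof (induction p)
  case (pCons a p)
  have "e \<star> (z \<star> poly_action z e p) = z \<star> (e \<star> poly_action z e p)"
    using central_comm[OF assms(1), of e] by (metis conv_assoc)
  then show ?case using pCons assms(3) by (simp add: poly_action_pCons conv_linear idemD)
qed (simp add: poly_action_0 conv_linear)

lemma poly_action_eigen:
  assumes "e \<star> w = w" "z \<star> w = (\<lambda>h. l * w h)"
  shows "poly_action z e p \<star> w = (\<lambda>h. poly p l * w h)"
proof (induction p)
  case (pCons a p)
  have "poly_action z e (pCons a p) \<star> w = (\<lambda>h. a * w h + (z \<star> (poly_action z e p \<star> w)) h)"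
    by (simp add: poly_action_pCons conv_linear conv_assoc assms)
  also have "\<dots> = (\<lambda>h. a * w h + poly p l * (l * w h))"
    by (simp only: pCons conv_linear assms)
  finally show ?case by (simp add: algebra_simps)
qed (simp add: poly_action_0 conv_linear)

text \<open>The elements obtained by applying powers of \<open>z\<close> to \<open>e\<close>, with
  exponents up to the group order, outnumber the dimension of the algebra.\<close>

lemma annihilating_poly:
  assumes e: "e \<in> group_alg" shows "\<exists>p. p \<noteq> 0 \<and> poly_action z e p = (\<lambda>_. 0)"
proof -
  let ?n = "Suc (card (carrier G))"
  obtain c where c: "\<exists>k<?n. c k \<noteq> 0"
    "\<forall>h\<in>carrier G. (\<Sum>k<?n. c k * ((\<star>) z ^^ k) e h) = 0"
    using linear_dependence[OF fin, of ?n "\<lambda>k. ((\<star>) z ^^ k) e"] by auto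
  have ga: "((\<star>) z ^^ k) e \<in> group_alg" for k using e by (cases k) auto
  define p where "p = (\<Sum>k<?n. Polynomial.monom (c k) k)"
  have "Polynomial.coeff p j = (if j < ?n then c j else 0)" for j
    unfolding p_def coeff_sum by (simp only: coeff_monom) (simp add: if_distrib)
  then have "p \<noteq> 0" using c(1) by (metis coeff_0)
  moreover have "poly_action z e p = (\<lambda>_. 0)"
  proof (rule group_alg_eqI)
    show "poly_action z e p \<in> group_alg" using ga unfolding p_def poly_action_sum poly_action_monom by (intro group_alg_closed) auto
  qed (use c(2) in \<open>simp_all add: p_def poly_action_sum poly_action_monom del: sum.lessThan_Suc\<close>)
  ultimately show ?thesis by blast
qed

text \<open>Let \<open>z\<close> be central and not scalar on \<open>e\<close>, let \<open>p\<close>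
  be an annihilating polynomial of least degree, \<open>l\<close> a root of it and \<open>q\<close>
  the cofactor. Then \<open>w\<close>, the value of \<open>q\<close> at \<open>z\<close>, is a
  nonzero eigenvector of \<open>z\<close>, so its square is \<open>\<mu>\<close> times
  \<open>w\<close> with \<open>\<mu>\<close> the value of \<open>q\<close> at \<open>l\<close>. Here
  \<open>\<mu>\<close> is nonzero since the centre has no nilpotents, and \<open>w / \<mu>\<close>
  is the idempotent.\<close>

lemma non_primitive_split:
  assumes e: "central e" "idem e" "e \<noteq> (\<lambda>_. 0)" and np: "\<not> primitive e"
  shows "\<exists>f. central f \<and> idem f \<and> f \<noteq> (\<lambda>_. 0) \<and> f \<noteq> e \<and> e \<star> f = f"
proof -
  obtain z where z: "central z" "\<And>c. z \<star> e \<noteq> (\<lambda>h. c * e h)"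
    using e np by (auto simp: primitive_def)
  define P where "P = (\<lambda>p. p \<noteq> 0 \<and> poly_action z e p = (\<lambda>_. 0))"
  obtain p where p: "P p" "\<And>q. Polynomial.degree q < Polynomial.degree p \<Longrightarrow> \<not> P q"
    using annihilating_poly[of e z] idemD(1)[OF e(2)] ex_has_least_nat[of P _ Polynomial.degree]
    unfolding P_def by (metis not_le)
  have "Polynomial.degree p \<noteq> 0"
  proof
    assume "Polynomial.degree p = 0"
    then obtain c where c: "p = [:c:]" by (rule degree_eq_zeroE)
    then have "c \<noteq> 0" "\<And>h. c * e h = 0" using p(1) by (auto simp: P_def poly_action_pCons poly_action_0 conv_linear fun_eq_iff)
    then show False using e(3) by (auto simp: fun_eq_iff)
  qed
  then obtain l where "poly p l = 0"
    using fundamental_theorem_of_algebra[of p] by (auto simp: constant_degree)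
  then obtain q where q: "p = [:- l, 1:] * q" by (auto simp: poly_eq_0_iff_dvd elim: dvdE)
  have q0: "q \<noteq> 0" using p(1) q by (auto simp: P_def)
  then have "Polynomial.degree q < Polynomial.degree p" unfolding q by (subst degree_mult_eq) auto
  then have wnz: "poly_action z e q \<noteq> (\<lambda>_. 0)" using p(2)[of q] q0 by (auto simp: P_def)
  define w where "w = poly_action z e q"
  have w: "central w" "e \<star> w = w" "w \<noteq> (\<lambda>_. 0)"
    using poly_action_central[OF z(1) e(1)] poly_action_ideal[OF z(1) e(1,2)] wnz by (simp_all add: w_def)
  have "p = smult (- l) q + pCons 0 q" by (simp add: q)
  then have "poly_action z e p = (\<lambda>h. - l * w h + (0 * e h + (z \<star> w) h))"
    by (simp only: poly_action_add poly_action_smult poly_action_pCons w_def)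
  then have zw: "z \<star> w = (\<lambda>h. l * w h)"
    using p(1) by (auto simp: P_def fun_eq_iff)
  define \<mu> where "\<mu> = poly q l"
  have ww: "w \<star> w = (\<lambda>h. \<mu> * w h)" using poly_action_eigen[OF w(2) zw, of q] by (simp add: w_def \<mu>_def)
  have \<mu>0: "\<mu> \<noteq> 0" using central_square_eq_0[OF w(1)] ww w(3) by auto
  define f where "f = (\<lambda>h. inverse \<mu> * w h)"
  have f: "central f" "f \<noteq> (\<lambda>_. 0)" "e \<star> f = f"
    using w \<mu>0 central_linear(3)[OF w(1)] by (auto simp: f_def conv_linear fun_eq_iff)
  have "f \<star> f = (\<lambda>h. inverse \<mu> * (inverse \<mu> * (w \<star> w) h))" by (simp add: f_def conv_linear)
  also have "\<dots> = f" using \<mu>0 by (simp add: ww f_def mult.assoc[symmetric])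
  finally have "idem f" using centralD(1)[OF f(1)] by (simp add: idem_def)
  moreover have "z \<star> f = (\<lambda>h. l * f h)" by (simp add: f_def conv_linear zw mult.left_commute)
  then have "f \<noteq> e" using z(2) by auto
  ultimately show ?thesis using f by blast
qed

definition orth_family :: "('a \<Rightarrow> complex) set \<Rightarrow> bool" where
  "orth_family B \<longleftrightarrow> finite B \<and> (\<forall>b\<in>B. primitive b) \<and> (\<forall>b\<in>B. \<forall>c\<in>B. b \<noteq> c \<longrightarrow> b \<star> c = (\<lambda>_. 0))"

lemma orth_family_sum_conv:
  assumes "orth_family B" "b \<in> B"
  shows "b \<star> (\<lambda>h. \<Sum>c\<in>B. c h) = b"
proof -
  have "(b \<star> (\<lambda>h. \<Sum>c\<in>B. c h)) h = b h" for h
  proof -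
    have "(b \<star> (\<lambda>h. \<Sum>c\<in>B. c h)) h = (\<Sum>c\<in>B. (b \<star> c) h)" by (simp add: conv_sum)
    also have "\<dots> = (\<Sum>c\<in>B. if c = b then b h else 0)"
      using assms primitiveD(5) by (intro sum.cong) (auto simp: orth_family_def)
    also have "\<dots> = b h" using assms by (simp add: orth_family_def)
    finally show ?thesis .
  qed
  then show ?thesis by blast
qed

lemma orth_family_union:
  assumes B: "orth_family B" "(\<lambda>h. \<Sum>b\<in>B. b h) = e" and C: "orth_family C" "(\<lambda>h. \<Sum>b\<in>C. b h) = f"
    and ef: "central e" "central f" "e \<star> f = (\<lambda>_. 0)"
  shows "orth_family (B \<union> C) \<and> B \<inter> C = {}"
proof -
  have zero: "b \<star> c = (\<lambda>_. 0)" if bc: "b \<in> B" "c \<in> C" for b c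
  proof -
    have "b \<star> c = (b \<star> e) \<star> (c \<star> f)"
      using orth_family_sum_conv[OF B(1) bc(1)] orth_family_sum_conv[OF C(1) bc(2)] B(2) C(2) by simp
    also have "\<dots> = b \<star> (e \<star> f) \<star> c" by (simp add: central_comm[OF ef(2), of c, symmetric] conv_assoc)
    finally show ?thesis by (simp add: ef conv_linear)
  qed
  have "B \<inter> C = {}"
  proof (rule ccontr)
    assume "B \<inter> C \<noteq> {}"
    then obtain b where b: "b \<in> B" "b \<in> C" by blast
    then have "primitive b" using B(1) by (simp add: orth_family_def)
    then show False using zero[OF b] primitiveD(3,5) by metis
  qed
  moreover have "c \<star> b = (\<lambda>_. 0)" if "b \<in> B" "c \<in> C" for b c
    using zero[OF that] that central_comm[OF primitiveD(1), of b c] B(1) by (auto simp: orth_family_def)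
  then have "orth_family (B \<union> C)"
    using B(1) C(1) zero by (auto simp: orth_family_def)
  ultimately show ?thesis by blast
qed

text \<open>Induction on the natural number \<open>card (carrier G) * e \<one>\<close>. It is
  positive for nonzero central idempotents and additive when \<open>e\<close> is split into
  \<open>f\<close> and \<open>e - f\<close>.\<close>

lemma primitive_decomposition:
  assumes "central e" "idem e"
  shows "\<exists>B. orth_family B \<and> (\<lambda>h. \<Sum>b\<in>B. b h) = e"
proof -
  let ?N = "of_nat (card (carrier G)) :: complex"
  have N0: "?N \<noteq> 0" using fin by (auto simp: card_eq_0_iff)
  have pos: "d > 0" if "central e" "idem e" "e \<noteq> (\<lambda>_. 0)" "?N * e \<one> = of_nat d" for e d
    using that central_idem_at_one_nz[of e] N0 by (cases d) auto
  have "?N * e \<one> = of_nat d \<Longrightarrow> central e \<Longrightarrow> idem e \<Longrightarrow>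
      \<exists>B. orth_family B \<and> (\<lambda>h. \<Sum>b\<in>B. b h) = e" for d e
  proof (induction d arbitrary: e rule: less_induct)
    case (less d)
    consider "e = (\<lambda>_. 0)" | "primitive e" | "e \<noteq> (\<lambda>_. 0)" "\<not> primitive e" by blast
    then show ?case
    proof cases
      case 1
      then show ?thesis by (intro exI[of _ "{}"]) (auto simp: orth_family_def)
    next
      case 2
      then show ?thesis by (intro exI[of _ "{e}"]) (auto simp: orth_family_def)
    next
      case 3
      obtain f where f: "central f" "idem f" "f \<noteq> (\<lambda>_. 0)" "f \<noteq> e" "e \<star> f = f"
        using non_primitive_split[OF less.prems(2,3) 3] by blast
      have fe: "f \<star> e = f" using central_comm[OF f(1), of e] f(5) by simp
      define k where "k = (\<lambda>h. e h - f h)"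
      have k: "central k" "idem k" "k \<noteq> (\<lambda>_. 0)"
      proof -
        show "central k" unfolding k_def using less.prems f by (intro central_linear)
        moreover have "k \<star> k = k"
          using f fe less.prems by (simp add: k_def conv_linear idemD)
        ultimately show "idem k" by (simp add: idem_def centralD)
        show "k \<noteq> (\<lambda>_. 0)"
        proof
          assume "k = (\<lambda>_. 0)"
          then have "e = f" by (simp add: k_def fun_eq_iff)
          then show False using f(4) by simp
        qed
      qed
      have kf: "k \<star> f = (\<lambda>_. 0)" using f by (simp add: k_def conv_linear idemD)
      obtain d1 d2 where d: "?N * f \<one> = of_nat d1" "?N * k \<one> = of_nat d2"
        using idem_at_one_Nats f(2) k(2) by (metis Nats_cases)
      have "?N * e \<one> = ?N * k \<one> + ?N * f \<one>" by (simp add: k_def algebra_simps)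
      then have "d = d2 + d1" using d less.prems(1) by (metis of_nat_add of_nat_eq_iff)
      moreover have "d1 > 0" "d2 > 0" using pos d f k by blast+
      ultimately have "d1 < d" "d2 < d" by auto
      then obtain B C where B: "orth_family B" "(\<lambda>h. \<Sum>b\<in>B. b h) = k"
        and C: "orth_family C" "(\<lambda>h. \<Sum>b\<in>C. b h) = f"
        using less.IH d f k by metis
      have U: "orth_family (B \<union> C)" "B \<inter> C = {}"
        using orth_family_union[OF B C k(1) f(1) kf] by auto
      have "(\<Sum>b\<in>B \<union> C. b h) = e h" for h
      proof -
        have "(\<Sum>b\<in>B \<union> C. b h) = (\<Sum>b\<in>B. b h) + (\<Sum>b\<in>C. b h)"
          using B(1) C(1) U(2) by (intro sum.union_disjoint) (auto simp: orth_family_def)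
        also have "\<dots> = k h + f h" using B(2) C(2) by metis
        finally show ?thesis by (simp add: k_def)
      qed
      then show ?thesis using U(1) by blast
    qed
  qed
  then show ?thesis using assms idem_at_one_Nats[OF assms(2)] by (metis Nats_cases)
qed

end

section \<open>Eigenvalues of class sums\<close>

context group
begin

lemma pow_mod_exponent:
  assumes "y \<in> carrier G" "y [^] n = \<one>" shows "y [^] (i mod n) = y [^] (i :: nat)"
proof -
  have "y [^] i = y [^] (n * (i div n) + i mod n)" by simp
  also have "\<dots> = (y [^] n) [^] (i div n) \<otimes> y [^] (i mod n)"
    using assms(1) by (simp only: nat_pow_mult[symmetric] nat_pow_pow)
  finally show ?thesis using assms by simp
qed

end

context finite_group
begin

section \<open>Eigenvalue multiplicities of a single element\<close>

text \<open>The projection onto the eigenspace of \<open>y\<close> for the eigenvalue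
  \<open>cis (2 * pi / n) ^ k\<close>, as an element of the algebra of the cyclic group of
  \<open>y\<close>.\<close>

definition spectral_idem :: "'a \<Rightarrow> nat \<Rightarrow> nat \<Rightarrow> 'a \<Rightarrow> complex" where
  "spectral_idem y n k = (\<lambda>h. inverse (of_nat n) * (\<Sum>j<n. inverse (cis (2 * pi / n)) ^ (j * k) * delta (y [^] j) h))"

lemma spectral_idem_conv:
  assumes y: "y \<in> carrier G"
  shows "(spectral_idem y n k \<star> f) h =
    inverse (of_nat n) * (\<Sum>j<n. inverse (cis (2 * pi / n)) ^ (j * k) * (delta (y [^] j) \<star> f) h)"
  by (simp add: spectral_idem_def conv_linear conv_sum)

lemma spectral_idem_idem:
  assumes y: "y \<in> carrier G" "y [^] n = \<one>" and n: "n > 0"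
  shows "idem (spectral_idem y n k)"
proof -
  define z where "z = inverse (cis (2 * pi / n)) ^ k"
  have zn: "z ^ n = 1"
  proof -
    have "z ^ n = inverse ((cis (2 * pi / n) ^ n) ^ k)" by (simp add: z_def power_inverse mult.commute del: cis_inverse flip: power_mult)
    also have "cis (2 * pi / n) ^ n = 1" using n by (simp add: DeMoivre)
    finally show ?thesis by simp
  qed
  have spectral_idem: "spectral_idem y n k = (\<lambda>h. inverse (of_nat n) * (\<Sum>j<n. z ^ j * delta (y [^] j) h))"
    by (simp add: spectral_idem_def z_def mult.commute flip: power_mult)
  have "(spectral_idem y n k \<star> spectral_idem y n k) h = spectral_idem y n k h" for h
  proof -
    have "(spectral_idem y n k \<star> spectral_idem y n k) h =
      inverse (of_nat n) * (inverse (of_nat n) * (\<Sum>i<n. \<Sum>j<n. z ^ i * (z ^ j * (delta (y [^] i) \<star> delta (y [^] j)) h)))"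
      by (simp add: spectral_idem conv_linear conv_sum sum_distrib_left mult_ac)
    also have "(\<Sum>i<n. \<Sum>j<n. z ^ i * (z ^ j * (delta (y [^] i) \<star> delta (y [^] j)) h)) =
      (\<Sum>i<n. \<Sum>j<n. z ^ ((i + j) mod n) * delta (y [^] ((i + j) mod n)) h)"
      using y by (intro sum.cong) (simp_all add: power_mod_root_of_unity[OF zn] pow_mod_exponent power_add delta_delta nat_pow_mult)
    also have "\<dots> = (\<Sum>i<n. \<Sum>j<n. z ^ j * delta (y [^] j) h)"
    proof (rule sum.cong, simp)
      fix i assume "i \<in> {..<n}"
      then show "(\<Sum>j<n. z ^ ((i + j) mod n) * delta (y [^] ((i + j) mod n)) h) = (\<Sum>j<n. z ^ j * delta (y [^] j) h)"
        using sum.reindex_bij_betw[OF bij_betw_mod_shift[OF n, of i], of "\<lambda>j. z ^ j * delta (y [^] j) h"] by simp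
    qed
    also have "\<dots> = of_nat n * (\<Sum>j<n. z ^ j * delta (y [^] j) h)" by simp
    finally show ?thesis using n by (simp add: spectral_idem)
  qed
  moreover have "spectral_idem y n k \<in> group_alg" unfolding spectral_idem_def using y by (intro group_alg_closed) auto
  ultimately show ?thesis by (auto simp: idem_def)
qed

text \<open>For the irreducible character \<open>\<chi>\<close> belonging to \<open>e\<close>, this is \<open>\<chi> \<one>\<close> times the multiplicity of
  \<open>cis (2 * pi * k / n)\<close> as an eigenvalue of \<open>y\<close>.\<close>

definition eigen_mult :: "'a \<Rightarrow> nat \<Rightarrow> ('a \<Rightarrow> complex) \<Rightarrow> nat \<Rightarrow> complex" where
  "eigen_mult y n e k = of_nat (card (carrier G)) * (spectral_idem y n k \<star> e) \<one>"

lemma eigen_mult_alt: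
  assumes "y \<in> carrier G"
  shows "eigen_mult y n e k = of_nat (card (carrier G)) * (inverse (of_nat n) *
    (\<Sum>j<n. inverse (cis (2 * pi / n)) ^ (j * k) * e (inv (y [^] j))))"
  using assms by (simp add: eigen_mult_def spectral_idem_conv delta_conv)

lemma eigen_mult_Nats:
  assumes y: "y \<in> carrier G" "y [^] n = \<one>" "n > 0" and e: "central e" "idem e"
  shows "eigen_mult y n e k \<in> \<nat>"
proof -
  have "idem (spectral_idem y n k \<star> e)"
    using idem_conv[OF spectral_idem_idem[OF y] e(2)] central_comm[OF e(1)] by simp
  then show ?thesis unfolding eigen_mult_def by (rule idem_at_one_Nats)
qed

lemma eigen_mult_square:
  assumes y: "y \<in> carrier G" "y [^] n = \<one>" "n > 0" and e: "primitive e"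
  shows "\<exists>t\<in>\<nat>. (eigen_mult y n e k)\<^sup>2 = of_nat (card (carrier G)) * e \<one> * t"
  unfolding eigen_mult_def by (rule primitive_multiplicity_square[OF e spectral_idem_idem[OF y]])

text \<open>Fourier inversion of \<open>eigen_mult_alt\<close>: up to the degree, a character value
  is the sum of the eigenvalues with their multiplicities.\<close>

lemma eigen_mult_inversion:
  assumes y: "y \<in> carrier G" and j: "j < n"
  shows "of_nat (card (carrier G)) * e (inv (y [^] j)) = (\<Sum>k<n. eigen_mult y n e k * cis (2 * pi / n) ^ (j * k))"
proof -
  let ?z = "cis (2 * pi / n)" and ?N = "of_nat (card (carrier G)) :: complex"
  have "(\<Sum>k<n. eigen_mult y n e k * ?z ^ (j * k)) =
    ?N * inverse (of_nat n) * (\<Sum>k<n. \<Sum>i<n. e (inv (y [^] i)) * (?z ^ (j * k) * inverse ?z ^ (i * k)))"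
    by (simp add: eigen_mult_alt[OF y] sum_distrib_left sum_distrib_right mult_ac)
  also have "(\<Sum>k<n. \<Sum>i<n. e (inv (y [^] i)) * (?z ^ (j * k) * inverse ?z ^ (i * k))) =
    (\<Sum>i<n. e (inv (y [^] i)) * (\<Sum>k<n. ?z ^ (j * k) * inverse ?z ^ (i * k)))"
    by (subst sum.swap) (simp add: sum_distrib_left)
  also have "\<dots> = (\<Sum>i<n. e (inv (y [^] i)) * (if j = i then of_nat n else 0))"
    using j by (intro sum.cong refl) (simp add: root_of_unity_orthogonality del: cis_inverse)
  also have "\<dots> = e (inv (y [^] j)) * of_nat n"
    using j by (simp add: if_distrib cong: if_cong)
  finally show ?thesis using j by simp
qed

section \<open>Class sums and normalized characters\<close>

definition class_sum :: "'a \<Rightarrow> 'a \<Rightarrow> complex" where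
  "class_sum x = (\<lambda>h. if h \<in> conj_class G x then 1 else 0)"

lemma class_sum_expand: "x \<in> carrier G \<Longrightarrow> class_sum x = (\<lambda>h. \<Sum>k\<in>conj_class G x. delta k h)"
  using fin conj_class_subset[of x] by (auto simp: class_sum_def delta_def fun_eq_iff finite_subset)

lemma finite_conj_class: "x \<in> carrier G \<Longrightarrow> finite (conj_class G x)"
  using fin conj_class_subset[of x] finite_subset by blast

lemma central_class_sum: assumes x: "x \<in> carrier G" shows "central (class_sum x)"
  unfolding central_def
proof (intro conjI ballI)
  show "class_sum x \<in> group_alg" using conj_class_subset[OF x] by (auto simp: group_alg_def class_sum_def)
  fix g h assume gh: "g \<in> carrier G" "h \<in> carrier G"
  have "h \<in> conj_class G x" if "g \<otimes> h \<otimes> inv g \<in> conj_class G x"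
    using conj_class_closed[OF x that, of "inv g"] gh conj_inv_cancel by simp
  then show "class_sum x (g \<otimes> h \<otimes> inv g) = class_sum x h"
    using conj_class_closed[OF x _ gh(1), of h] by (auto simp: class_sum_def)
qed

text \<open>This is \<open>\<chi> y / \<chi> \<one>\<close>, since \<open>e (inv y) = \<chi> \<one> * \<chi> y / card (carrier G)\<close>.\<close>

definition norm_char :: "('a \<Rightarrow> complex) \<Rightarrow> 'a \<Rightarrow> complex" where
  "norm_char e y = e (inv y) / e \<one>"

text \<open>The class sum is central, so it acts by a scalar, which is read off at the identity:
  every conjugate of \<open>x\<close> contributes \<open>e (inv x)\<close> there.\<close>

lemma class_sum_eigenvalue:
  assumes e: "primitive e" and x: "x \<in> carrier G"
  shows "class_sum x \<star> e = (\<lambda>h. of_nat (card (conj_class G x)) * norm_char e x * e h)"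
proof -
  obtain c where c: "class_sum x \<star> e = (\<lambda>h. c * e h)" using primitiveD(7)[OF e central_class_sum[OF x]] by blast
  have "c * e \<one> = (class_sum x \<star> e) \<one>" by (simp add: c)
  also have "\<dots> = (\<Sum>k\<in>conj_class G x. (delta k \<star> e) \<one>)" by (simp add: class_sum_expand[OF x] conv_sum)
  also have "\<dots> = (\<Sum>k\<in>conj_class G x. e (inv x))"
  proof (rule sum.cong, simp)
    fix k assume "k \<in> conj_class G x"
    then obtain g where g: "g \<in> carrier G" "k = g \<otimes> x \<otimes> inv g" by (auto simp: conj_class_def)
    have "inv k = g \<otimes> inv x \<otimes> inv g" using g x by (simp add: inv_mult_group m_assoc)
    then show "(delta k \<star> e) \<one> = e (inv x)" using g x centralD(2)[OF primitiveD(1)[OF e]] by (simp add: delta_conv)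
  qed
  finally have "c * e \<one> = of_nat (card (conj_class G x)) * e (inv x)" by simp
  then have "c = of_nat (card (conj_class G x)) * norm_char e x"
    using primitiveD(6)[OF e] by (simp add: norm_char_def field_simps)
  then show ?thesis using c by simp
qed

text \<open>Convolution by \<open>f\<close> has the integer matrix
  \<open>f (i \<otimes> inv j)\<close>, and \<open>e\<close> is a nonzero eigenvector of it.\<close>

lemma int_valued_eigenvalue:
  assumes f: "\<And>h. h \<in> carrier G \<Longrightarrow> f h \<in> \<int>" and e: "e \<in> group_alg" "e \<noteq> (\<lambda>_. 0)" and eig: "f \<star> e = (\<lambda>h. c * e h)"
  shows "algebraic_int c"
proof -
  define M where "M i j = (THE m. f (i \<otimes> inv j) = of_int m)" for i j
  have M: "of_int (M i j) = f (i \<otimes> inv j)" if "i \<in> carrier G" "j \<in> carrier G" for i j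
  proof -
    have "f (i \<otimes> inv j) \<in> \<int>" using f that by simp
    then obtain m where "f (i \<otimes> inv j) = of_int m" by (auto elim!: Ints_cases)
    then show ?thesis unfolding M_def by simp
  qed
  obtain h where h: "h \<in> carrier G" "e h \<noteq> 0" using e by (metis group_alg_closed(4) group_alg_eqI)
  show ?thesis
  proof (rule int_matrix_eigenvalue_algebraic_int[where S = "carrier G" and i\<^sub>0 = h and v = e and M = M])
    fix i assume i: "i \<in> carrier G"
    have "(\<Sum>j\<in>carrier G. of_int (M i j) * e j) = (f \<star> e) i"
      using i M by (simp add: conv_alt)
    then show "(\<Sum>j\<in>carrier G. of_int (M i j) * e j) = c * e i" by (simp add: eig)
  qed (use fin h in auto)
qed

lemma int_valued_conv:
  assumes "\<And>h. h \<in> carrier G \<Longrightarrow> f h \<in> \<int>" "\<And>h. h \<in> carrier G \<Longrightarrow> g h \<in> \<int>"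
  shows "(f \<star> g) h \<in> \<int>"
  unfolding conv_def using assms by (auto intro!: Ints_sum Ints_mult)

text \<open>Triangle inequality for the expansion into eigenvalues. The multiplicities are natural
  numbers, and by the case of exponent 0 they add up to
  \<open>card (carrier G) * e \<one>\<close>.\<close>

lemma cmod_norm_char_le_1:
  assumes e: "primitive e" and y: "y \<in> carrier G" "y [^] (n::nat) = \<one>" and j: "j < n"
  shows "cmod (norm_char e (y [^] j)) \<le> 1"
proof -
  let ?z = "cis (2 * pi / n)" and ?N = "of_nat (card (carrier G)) :: complex"
  have n: "n > 0" using j by simp
  have N0: "?N \<noteq> 0" using fin by (auto simp: card_eq_0_iff)
  have m: "eigen_mult y n e k = of_real (cmod (eigen_mult y n e k))" for k
    using eigen_mult_Nats[OF y n primitiveD(1,2)[OF e], of k] by (auto elim!: Nats_cases)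
  have "cmod (?N * e (inv (y [^] j))) \<le> (\<Sum>k<n. cmod (eigen_mult y n e k * ?z ^ (j * k)))"
    unfolding eigen_mult_inversion[OF y(1) j] by (rule norm_sum)
  also have "\<dots> = (\<Sum>k<n. cmod (eigen_mult y n e k))" by (simp add: norm_mult norm_power)
  also have "\<dots> = cmod (of_real (\<Sum>k<n. cmod (eigen_mult y n e k)))"
    unfolding norm_of_real by (simp add: sum_nonneg)
  also have "of_real (\<Sum>k<n. cmod (eigen_mult y n e k)) = (\<Sum>k<n. eigen_mult y n e k)"
    unfolding of_real_sum using m by simp
  also have "\<dots> = ?N * e \<one>" using eigen_mult_inversion[OF y(1) n, of e] by simp
  finally have "cmod (e (inv (y [^] j))) \<le> cmod (e \<one>)" using N0 by (simp add: norm_mult)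
  then show ?thesis using primitiveD(6)[OF e] by (simp add: norm_char_def norm_divide)
qed

lemma star_delta: "a \<in> carrier G \<Longrightarrow> star (delta a) = delta (inv a)"
  by (rule group_alg_eqI, simp, simp) (auto simp: star_def delta_def)

text \<open>With \<open>\<beta>\<close> the normalized character value, the squared norm of
  \<open>delta x \<star> e - \<beta> * e\<close> is
  \<open>e \<one> * (1 - \<beta> * cnj \<beta>)\<close>, which is zero.\<close>

lemma scalar_if_cmod_norm_char_1:
  assumes e: "primitive e" and x: "x \<in> carrier G" and one: "cmod (norm_char e x) = 1"
  shows "delta x \<star> e = (\<lambda>h. norm_char e x * e h)"
proof -
  define \<beta> where "\<beta> = norm_char e x"
  note se = central_idem_star[OF primitiveD(1,2)[OF e]]
  have ec: "delta a \<star> e = e \<star> delta a" for a using central_comm[OF primitiveD(1)[OF e]] by simp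
  have \<beta>1: "\<beta> * cnj \<beta> = 1" using one by (simp add: \<beta>_def complex_norm_square[symmetric])
  have ex: "e (inv x) = \<beta> * e \<one>" using primitiveD(6)[OF e] by (simp add: \<beta>_def norm_char_def)
  have e1: "cnj (e \<one>) = e \<one>" using se by (metis (full_types) inv_one one_closed star_def)
  have ex': "e x = cnj \<beta> * e \<one>"
  proof -
    have "e x = cnj (e (inv x))" using se x by (metis (full_types) star_def)
    then show ?thesis by (simp add: ex e1)
  qed
  define v where "v = (\<lambda>h. (delta x \<star> e) h - \<beta> * e h)"
  have "star v = (\<lambda>h. star (delta x \<star> e) h - cnj \<beta> * star e h)" by (auto simp: v_def star_def fun_eq_iff)
  also have "star (delta x \<star> e) = e \<star> delta (inv x)" by (simp add: star_conv se star_delta x)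
  finally have sv: "star v = (\<lambda>h. (e \<star> delta (inv x)) h - cnj \<beta> * e h)" by (simp add: se)
  have 1: "(delta x \<star> e) \<star> (e \<star> delta (inv x)) = e"
  proof -
    have "(delta x \<star> e) \<star> (e \<star> delta (inv x)) = (delta x \<star> (e \<star> e)) \<star> delta (inv x)" by (simp add: conv_assoc)
    also have "\<dots> = e \<star> (delta x \<star> delta (inv x))" by (simp add: primitiveD(5)[OF e] ec conv_assoc)
    finally show ?thesis using x primitiveD(4)[OF e] by (simp add: delta_delta conv_one)
  qed
  have 2: "(delta x \<star> e) \<star> e = delta x \<star> e" "e \<star> (e \<star> delta (inv x)) = e \<star> delta (inv x)"
    using primitiveD(5)[OF e] by (simp_all add: conv_assoc) (simp add: conv_assoc[symmetric])
  have "(v \<star> star v) \<one> = e \<one> - \<beta> * (e \<star> delta (inv x)) \<one> - (cnj \<beta> * (delta x \<star> e) \<one> - cnj \<beta> * (\<beta> * e \<one>))"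
    unfolding sv unfolding v_def
    by (simp add: conv_linear 1 2 primitiveD(5)[OF e] algebra_simps)
  also have "(e \<star> delta (inv x)) \<one> = cnj \<beta> * e \<one>" using x ex' by (simp add: conv_delta)
  also have "(delta x \<star> e) \<one> = \<beta> * e \<one>" using x ex by (simp add: delta_conv)
  finally have "(v \<star> star v) \<one> = 0" using \<beta>1 by (simp add: mult.assoc[symmetric] mult.commute)
  then have "(\<Sum>a\<in>carrier G. (cmod (v a))\<^sup>2) = 0" unfolding conv_star_at_one by (simp only: of_real_eq_0_iff)
  moreover have "v \<in> group_alg" using primitiveD(4)[OF e] by (simp add: v_def)
  ultimately have "v = (\<lambda>_. 0)"
    using fin by (intro group_alg_eqI) (auto simp: sum_nonneg_eq_0_iff)
  then show ?thesis by (simp add: v_def \<beta>_def fun_eq_iff)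
qed

text \<open>The idempotents of the linear characters.\<close>

definition derived_trivial :: "('a \<Rightarrow> complex) \<Rightarrow> bool" where
  "derived_trivial e \<longleftrightarrow> (\<forall>h\<in>derived G (carrier G). delta h \<star> e = e)"

text \<open>The elements that act on \<open>e\<close> by scalars form a subgroup containing the
  class of \<open>x\<close>, hence the whole group. Scalars commute, so commutators act
  trivially.\<close>

lemma derived_trivial_if_scalar:
  assumes e: "primitive e" and x: "x \<in> carrier G" and gen: "generate G (conj_class G x) = carrier G"
    and sc: "delta x \<star> e = (\<lambda>h. c * e h)"
  shows "derived_trivial e"
proof -
  have ec: "delta a \<star> e = e \<star> delta a" for a using central_comm[OF primitiveD(1)[OF e]] by simp
  define S where "S = {g\<in>carrier G. \<exists>c. delta g \<star> e = (\<lambda>h. c * e h)}"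
  have scal_inv: "delta (inv g) \<star> e = (\<lambda>h. inverse c * e h) \<and> c \<noteq> 0"
    if g: "g \<in> carrier G" "delta g \<star> e = (\<lambda>h. c * e h)" for g c
  proof -
    have "e = delta (inv g) \<star> (delta g \<star> e)" using g(1) primitiveD(4)[OF e] by (simp add: conv_assoc[symmetric] delta_delta conv_one)
    also have "\<dots> = (\<lambda>h. c * (delta (inv g) \<star> e) h)" by (simp add: g conv_linear)
    finally have eq: "e h = c * (delta (inv g) \<star> e) h" for h by metis
    then have "c \<noteq> 0" using primitiveD(3)[OF e] by auto
    moreover have "(delta (inv g) \<star> e) h = inverse c * e h" for h using eq[of h] \<open>c \<noteq> 0\<close> by simp
    ultimately show ?thesis by blast
  qed
  have scal_mult: "delta (g \<otimes> h) \<star> e = (\<lambda>t. c * d * e t)"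
    if "g \<in> carrier G" "h \<in> carrier G" "delta g \<star> e = (\<lambda>t. c * e t)" "delta h \<star> e = (\<lambda>t. d * e t)" for g h c d
  proof -
    have "delta (g \<otimes> h) \<star> e = delta g \<star> (delta h \<star> e)" using that by (simp add: delta_delta[symmetric] conv_assoc)
    also have "\<dots> = (\<lambda>t. d * (c * e t))" using that by (simp add: conv_linear)
    finally show ?thesis by (simp add: mult_ac)
  qed
  have "subgroup S G"
  proof (rule subgroupI)
    have "delta \<one> \<star> e = (\<lambda>h. 1 * e h)" using primitiveD(4)[OF e] by (simp add: conv_one)
    then show "S \<noteq> {}" unfolding S_def by blast
  next
    fix a assume "a \<in> S"
    then show "inv a \<in> S" using scal_inv by (auto simp: S_def)
  next
    fix a b assume "a \<in> S" "b \<in> S"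
    then obtain c d where "a \<in> carrier G" "b \<in> carrier G" "delta a \<star> e = (\<lambda>t. c * e t)" "delta b \<star> e = (\<lambda>t. d * e t)"
      by (auto simp: S_def)
    then show "a \<otimes> b \<in> S" using scal_mult by (auto simp: S_def)
  qed (auto simp: S_def)
  moreover have "conj_class G x \<subseteq> S"
  proof
    fix k assume "k \<in> conj_class G x"
    then obtain g where g: "g \<in> carrier G" "k = g \<otimes> x \<otimes> inv g" by (auto simp: conj_class_def)
    have "delta k \<star> e = delta g \<star> (delta x \<star> (delta (inv g) \<star> e))" using g x by (simp add: delta_delta[symmetric] conv_assoc)
    also have "\<dots> = delta g \<star> ((delta x \<star> e) \<star> delta (inv g))"
      by (simp only: ec[of "inv g"] conv_assoc)
    also have "\<dots> = (\<lambda>h. c * (delta g \<star> (e \<star> delta (inv g))) h)" by (simp add: sc conv_linear)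
    also have "delta g \<star> (e \<star> delta (inv g)) = e"
      using g primitiveD(4)[OF e] by (simp add: ec[symmetric] conv_assoc[symmetric] delta_delta conv_one)
    finally show "k \<in> S" using g x by (auto simp: S_def)
  qed
  ultimately have "carrier G \<subseteq> S" using gen generate_subgroup_incl by metis
  have stab: "subgroup {g\<in>carrier G. delta g \<star> e = e} G"
  proof (rule subgroupI)
    show "{g\<in>carrier G. delta g \<star> e = e} \<noteq> {}" using primitiveD(4)[OF e] conv_one by blast
    fix g assume g: "g \<in> {g\<in>carrier G. delta g \<star> e = e}"
    show "inv g \<in> {g\<in>carrier G. delta g \<star> e = e}" using scal_inv[of g 1] g by simp
    fix h assume "h \<in> {g\<in>carrier G. delta g \<star> e = e}"
    then show "g \<otimes> h \<in> {g\<in>carrier G. delta g \<star> e = e}" using scal_mult[of g h 1 1] g by simp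
  qed auto
  have "derived G (carrier G) \<subseteq> {g\<in>carrier G. delta g \<star> e = e}"
    unfolding derived_def
  proof (rule generate_subgroup_incl[OF _ stab], safe)
    fix g h assume gh: "g \<in> carrier G" "h \<in> carrier G"
    then have "g \<in> S" "h \<in> S" using \<open>carrier G \<subseteq> S\<close> by auto
    then obtain c d where cd: "delta g \<star> e = (\<lambda>t. c * e t)" "delta h \<star> e = (\<lambda>t. d * e t)"
      by (auto simp: S_def)
    note i = scal_inv[OF gh(1) cd(1)] scal_inv[OF gh(2) cd(2)]
    have "delta (g \<otimes> h \<otimes> inv g \<otimes> inv h) \<star> e = (\<lambda>t. c * d * inverse c * inverse d * e t)"
      using gh cd i by (intro scal_mult) auto
    moreover have "c * d * inverse c * inverse d = 1" using i by (simp add: field_simps)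
    ultimately show "delta (g \<otimes> h \<otimes> inv g \<otimes> inv h) \<star> e = e" by simp
    show "g \<otimes> h \<otimes> inv g \<otimes> inv h \<in> carrier G" using gh by simp
  qed
  then show ?thesis by (auto simp: derived_trivial_def)
qed

text \<open>All conjugates of \<open>x\<close> differ from \<open>x\<close> by commutators and so
  act on \<open>e\<close> as \<open>x\<close> does. Thus the class sum acts as a multiple of
  \<open>x\<close>, but also by a scalar.\<close>

lemma derived_trivial_scalar:
  assumes e: "primitive e" "derived_trivial e" and x: "x \<in> carrier G"
  shows "delta x \<star> e = (\<lambda>h. norm_char e x * e h)"
proof -
  have "class_sum x \<star> e = (\<lambda>h. \<Sum>k\<in>conj_class G x. (delta k \<star> e) h)" by (simp add: class_sum_expand[OF x] conv_sum)
  also have "\<dots> = (\<lambda>h. \<Sum>k\<in>conj_class G x. (delta x \<star> e) h)"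
  proof (intro ext sum.cong)
    fix h k assume "k \<in> conj_class G x"
    then obtain g where g: "g \<in> carrier G" "k = g \<otimes> x \<otimes> inv g" by (auto simp: conj_class_def)
    define d where "d = g \<otimes> x \<otimes> inv g \<otimes> inv x"
    have "d \<in> derived_set G (carrier G)" unfolding d_def using g(1) x by blast
    then have d: "d \<in> derived G (carrier G)" unfolding derived_def by (rule generate.incl)
    have dG: "d \<in> carrier G" "k = d \<otimes> x" using g x by (auto simp: d_def m_assoc)
    have "delta k \<star> e = delta d \<star> e \<star> delta x"
      using dG x central_comm[OF primitiveD(1)[OF e(1)], of "delta x"] by (simp add: delta_delta[symmetric] conv_assoc)
    also have "\<dots> = delta x \<star> e"
      using d e(2) central_comm[OF primitiveD(1)[OF e(1)], of "delta x"] by (simp add: derived_trivial_def)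
    finally show "(delta k \<star> e) h = (delta x \<star> e) h" by simp
  qed simp
  also have "\<dots> = (\<lambda>h. of_nat (card (conj_class G x)) * (delta x \<star> e) h)" by simp
  finally have "(\<lambda>h. of_nat (card (conj_class G x)) * (delta x \<star> e) h) =
      (\<lambda>h. of_nat (card (conj_class G x)) * norm_char e x * e h)"
    using class_sum_eigenvalue[OF e(1) x] by simp
  moreover have "card (conj_class G x) \<noteq> 0" using finite_conj_class[OF x] self_in_conj_class[OF x] by auto
  ultimately show ?thesis by (simp add: fun_eq_iff mult.assoc)
qed

text \<open>For a linear block \<open>norm_char e\<close> is the linear character itself.\<close>

lemma derived_trivial_norm_char_pow:
  assumes e: "primitive e" "derived_trivial e" and x: "x \<in> carrier G"
  shows "norm_char e (x [^] (j::nat)) = norm_char e x ^ j"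
proof (induction j)
  case 0
  then show ?case using primitiveD(6)[OF e(1)] by (simp add: norm_char_def)
next
  case (Suc j)
  have "delta (x [^] Suc j) \<star> e = delta x \<star> (delta (x [^] j) \<star> e)"
    using x by (simp add: conv_assoc[symmetric] delta_delta nat_pow_Suc2[symmetric] del: nat_pow_Suc)
  also have "delta (x [^] j) \<star> e = (\<lambda>h. norm_char e x ^ j * e h)"
    using derived_trivial_scalar[OF e, of "x [^] j"] x Suc by simp
  also have "delta x \<star> (\<lambda>h. norm_char e x ^ j * e h) = (\<lambda>h. norm_char e x ^ Suc j * e h)"
    by (simp only: conv_linear derived_trivial_scalar[OF e x]) (simp add: mult_ac)
  finally have "(delta (x [^] Suc j) \<star> e) \<one> = norm_char e x ^ Suc j * e \<one>" by simp
  then have "norm_char e (x [^] Suc j) * e \<one> = norm_char e x ^ Suc j * e \<one>"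
    using derived_trivial_scalar[OF e, of "x [^] Suc j"] x by simp
  then show ?case using primitiveD(6)[OF e(1)] by simp
qed

end

section \<open>Balance of multiplicities\<close>

text \<open>For \<open>w\<close> prime to \<open>s\<close> this is Euler's theorem modulo
  \<open>s ^ Suc r\<close>, whose totient is \<open>(s - 1) * s ^ r\<close>. Otherwise the exponent
  is at least \<open>r\<close>.\<close>

lemma prime_power_teichmueller:
  fixes w :: int and s :: nat
  assumes s: "Factorial_Ring.prime s"
  shows "int s ^ r dvd (w ^ (s - 1)) ^ (s ^ r) - (if int s dvd w then 0 else 1)"
proof (cases "int s dvd w")
  case True
  have "r \<le> s ^ r" using prime_gt_1_nat[OF s] by (simp add: less_imp_le_nat power_gt_expt)
  also have "\<dots> \<le> (s - 1) * s ^ r" using prime_gt_1_nat[OF s] by simp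
  finally have "w ^ r dvd w ^ ((s - 1) * s ^ r)" by (rule le_imp_power_dvd)
  moreover have "int s ^ r dvd w ^ r" using True by (rule dvd_power_same)
  ultimately show ?thesis using True by (simp add: power_mult dvd_trans)
next
  case False
  define S where "S = s ^ Suc r"
  have S: "S > 0" using prime_gt_0_nat[OF s] by (simp add: S_def)
  \<comment> \<open>A natural number congruent to \<open>w\<close>, as Euler's theorem is stated for
    naturals.\<close>
  define a where "a = nat (w mod int S)"
  have a: "int a = w mod int S" using S by (simp add: a_def)
  have cw: "[int a = w] (mod int S)" by (simp add: a cong_def)
  have "\<not> s dvd a"
  proof
    assume "s dvd a"
    then have "int s dvd w mod int S" using a by (metis int_dvd_int_iff)
    moreover have "int s dvd int S" by (simp add: S_def)
    ultimately show False using False by (simp add: dvd_mod_iff)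
  qed
  then have "coprime a S" unfolding S_def
    using prime_imp_coprime[OF s] by (metis coprime_commute coprime_power_right_iff)
  then have "[a ^ totient S = 1] (mod S)" by (rule euler_theorem)
  then have "[int a ^ totient S = 1] (mod int S)" by (metis cong_int_iff of_nat_1 of_nat_power)
  then have "[w ^ totient S = 1] (mod int S)" using cong_pow[OF cw] cong_trans cong_sym by blast
  moreover have "totient S = (s - 1) * s ^ r" using totient_prime_power_Suc[OF s, of r] by (simp add: S_def mult.commute del: power_Suc)
  ultimately have "int S dvd (w ^ (s - 1)) ^ (s ^ r) - 1" by (simp add: cong_iff_dvd_diff power_mult)
  moreover have "int s ^ r dvd int S" by (simp add: S_def)
  ultimately show ?thesis using False dvd_trans by auto
qed

context finite_group
begin

text \<open>All powers of \<open>x\<close> are used, not only the generators of its cyclic group, so that the eigenvalues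
  are rational by \<open>cyclotomic_norm_Ints\<close> alone.\<close>

primrec class_sum_prod :: "'a \<Rightarrow> nat \<Rightarrow> 'a \<Rightarrow> complex" where
  "class_sum_prod x 0 = delta \<one>"
| "class_sum_prod x (Suc j) = class_sum_prod x j \<star> class_sum (x [^] j)"

lemma class_sum_prod_central: "x \<in> carrier G \<Longrightarrow> central (class_sum_prod x j)"
  by (induction j) (auto intro: central_linear central_conv central_class_sum)

lemma class_sum_prod_Ints: "x \<in> carrier G \<Longrightarrow> h \<in> carrier G \<Longrightarrow> class_sum_prod x j h \<in> \<int>"
proof (induction j arbitrary: h)
  case (Suc j)
  then show ?case by (simp, intro int_valued_conv) (auto simp: class_sum_def)
qed (simp add: delta_def)

section \<open>Integrality and size of the weights\<close>

text \<open>The eigenvalue of \<open>class_sum_prod x n\<close> on the block of \<open>e\<close>, a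
  product of central character values.\<close>

definition weight :: "('a \<Rightarrow> complex) \<Rightarrow> 'a \<Rightarrow> nat \<Rightarrow> complex" where
  "weight e x n = (\<Prod>i<n. of_nat (card (conj_class G (x [^] i))) * norm_char e (x [^] i))"

lemma class_sum_prod_eigenvalue:
  assumes e: "primitive e" and x: "x \<in> carrier G"
  shows "class_sum_prod x n \<star> e = (\<lambda>h. weight e x n * e h)"
proof (induction n)
  case 0
  then show ?case using primitiveD(4)[OF e] by (simp add: weight_def conv_one)
next
  case (Suc n)
  have "class_sum_prod x (Suc n) \<star> e = class_sum_prod x n \<star> (class_sum (x [^] n) \<star> e)" by (simp add: conv_assoc)
  also have "\<dots> = (\<lambda>h. of_nat (card (conj_class G (x [^] n))) * norm_char e (x [^] n) * (weight e x n * e h))"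
    using x by (simp only: class_sum_eigenvalue[OF e] nat_pow_closed conv_linear Suc)
  finally show ?case by (simp add: weight_def mult_ac)
qed

text \<open>As an eigenvalue of an integral element the weight is an algebraic integer. It is
  rational because the normalized characters, scaled by \<open>d\<close>, multiply to a cyclotomic
  norm \<open>I\<close>. The second equation records the power of \<open>p\<close> that comes from
  the class sizes.\<close>

lemma weight_int:
  assumes e: "primitive e" and x: "x \<in> carrier G" "x [^] (n::nat) = \<one>" and n: "n > 0"
    and a: "\<And>i. card (conj_class G (x [^] (i::nat))) = p ^ a i"
    and d: "of_nat (card (carrier G)) * e \<one> = of_nat d"
  shows "\<exists>w I. weight e x n = of_int w \<and> w * int d ^ n = int p ^ (\<Sum>i<n. a i) * I"
proof -
  let ?N = "of_nat (card (carrier G)) :: complex" and ?z = "cis (2 * pi / n)"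
  have N0: "?N \<noteq> 0" using fin by (auto simp: card_eq_0_iff)
  have d0: "d \<noteq> 0" using d N0 primitiveD(6)[OF e] by (metis mult_eq_0_iff of_nat_0)
  have "\<exists>m. eigen_mult x n e k = of_int m" for k
    using eigen_mult_Nats[OF x n primitiveD(1,2)[OF e], of k] by (metis Nats_cases of_int_of_nat_eq)
  then obtain m where m: "\<And>k. eigen_mult x n e k = of_int (m k)" by metis
  have "(\<Prod>i<n. \<Sum>k<n. of_int (m k) * ?z ^ (i * k)) \<in> \<int>" by (rule cyclotomic_norm_Ints[OF n])
  then obtain I where I: "(\<Prod>i<n. \<Sum>k<n. of_int (m k) * ?z ^ (i * k)) = of_int I" by (auto elim: Ints_cases)
  have "(\<Prod>i<n. norm_char e (x [^] i) * of_nat d) = (\<Prod>i<n. \<Sum>k<n. of_int (m k) * ?z ^ (i * k))"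
  proof (rule prod.cong, simp)
    fix i assume "i \<in> {..<n}"
    then have "?N * e (inv (x [^] i)) = (\<Sum>k<n. of_int (m k) * ?z ^ (i * k))"
      using eigen_mult_inversion[OF x(1), of i n e] m by simp
    moreover have "norm_char e (x [^] i) * of_nat d = ?N * e (inv (x [^] i))"
      using primitiveD(6)[OF e] by (simp add: norm_char_def d[symmetric])
    ultimately show "norm_char e (x [^] i) * of_nat d = (\<Sum>k<n. of_int (m k) * ?z ^ (i * k))" by simp
  qed
  then have "(\<Prod>i<n. norm_char e (x [^] i)) * of_nat d ^ n = of_int I" using I by (simp add: prod.distrib)
  then have W: "weight e x n * of_nat d ^ n = of_int (int p ^ (\<Sum>i<n. a i) * I)"
    by (simp add: weight_def prod.distrib a power_sum mult.assoc)
  then have "weight e x n = of_int (int p ^ (\<Sum>i<n. a i) * I) / of_nat d ^ n"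
    using d0 by (simp add: field_simps)
  then have "weight e x n \<in> \<rat>" by simp
  moreover have "algebraic_int (weight e x n)"
    using int_valued_eigenvalue[OF class_sum_prod_Ints[OF x(1)] primitiveD(4)[OF e] primitiveD(3)[OF e] class_sum_prod_eigenvalue[OF e x(1)]] .
  ultimately have "weight e x n \<in> \<int>" using rational_algebraic_int_is_int by blast
  then obtain w where w: "weight e x n = of_int w" by (auto elim: Ints_cases)
  have "(of_int (w * int d ^ n) :: complex) = of_int (int p ^ (\<Sum>i<n. a i) * I)" using W w by simp
  then have "w * int d ^ n = int p ^ (\<Sum>i<n. a i) * I" by (simp only: of_int_eq_iff)
  then show ?thesis using w by blast
qed

text \<open>As \<open>d\<close> is prime to \<open>p\<close>, the product of the class sizes divides
  the nonzero weight. But the weight is that product times factors of modulus at most 1, so all of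
  these have modulus 1.\<close>

lemma derived_trivial_if_weight:
  assumes e: "primitive e" and x: "x \<in> carrier G" "x [^] (n::nat) = \<one>" and n: "n > 0"
    and gen: "generate G (conj_class G x) = carrier G"
    and p: "Factorial_Ring.prime p" and a: "\<And>i. card (conj_class G (x [^] (i::nat))) = p ^ a i"
    and d: "of_nat (card (carrier G)) * e \<one> = of_nat d" "\<not> p dvd d" and w: "weight e x n \<noteq> 0"
  shows "derived_trivial e"
proof -
  obtain w I where wI: "weight e x n = of_int w" "w * int d ^ n = int p ^ (\<Sum>i<n. a i) * I"
    using weight_int[OF e x n a d(1)] by blast
  let ?A = "\<Sum>i<n. a i" and ?f = "\<lambda>i. cmod (norm_char e (x [^] i))"
  have "coprime (int p ^ ?A) (int d ^ n)"
    using prime_imp_coprime[OF p d(2)] by simp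
  moreover have "int p ^ ?A dvd w * int d ^ n" using wI(2) by simp
  ultimately have "int p ^ ?A dvd w" by (simp add: coprime_dvd_mult_left_iff)
  then have "int p ^ ?A \<le> \<bar>w\<bar>" using wI(1) \<open>weight e x n \<noteq> 0\<close> by (intro zdvd_imp_le) auto
  then have "real_of_int (int p ^ ?A) \<le> real_of_int \<bar>w\<bar>" by (rule of_int_le_iff[THEN iffD2])
  also have "\<dots> = cmod (weight e x n)" by (simp add: wI(1))
  also have "\<dots> = real p ^ ?A * (\<Prod>i<n. ?f i)"
    by (simp add: weight_def a prod.distrib norm_mult norm_power power_sum prod_norm[symmetric])
  finally have ge: "1 \<le> (\<Prod>i<n. ?f i)" using prime_gt_0_nat[OF p] by simp
  \<comment> \<open>The index of \<open>x\<close> among its powers; the remainder covers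
    \<open>n = 1\<close>, where \<open>x\<close> is the identity.\<close>
  let ?j = "1 mod n"
  have j: "?j < n" using n by simp
  have le: "?f i \<le> 1" if "i < n" for i using cmod_norm_char_le_1[OF e x that] .
  have "(\<Prod>i<n. ?f i) = ?f ?j * (\<Prod>i\<in>{..<n} - {?j}. ?f i)" using j by (simp add: prod.remove)
  also have "\<dots> \<le> ?f ?j * 1" using le by (intro mult_left_mono prod_le_1) auto
  finally have "?f ?j = 1" using ge le[OF j] by simp
  moreover have "x [^] ?j = x" using pow_mod_exponent[OF x, of 1] x(1) by simp
  ultimately have "cmod (norm_char e x) = 1" by simp
  from scalar_if_cmod_norm_char_1[OF e x(1) this] show ?thesis by (rule derived_trivial_if_scalar[OF e x(1) gen])
qed

text \<open>Linear characters take roots of unity as values, so only the class sizes contribute to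
  the modulus.\<close>

lemma cmod_weight_derived_trivial:
  assumes e: "primitive e" "derived_trivial e" and x: "x \<in> carrier G" "x [^] (n::nat) = \<one>" and n: "n > 0"
    and a: "\<And>i. card (conj_class G (x [^] (i::nat))) = p ^ a i"
  shows "cmod (weight e x n) = real p ^ (\<Sum>i<n. a i)"
proof -
  have "norm_char e x ^ n = 1"
    using derived_trivial_norm_char_pow[OF e x(1), of n] x(2) primitiveD(6)[OF e(1)] by (simp add: norm_char_def)
  then have "cmod (norm_char e x) ^ n = 1" by (metis norm_one norm_power)
  then have "cmod (norm_char e x) = 1" using power_eq_imp_eq_base[of "cmod (norm_char e x)" n 1] n by simp
  then show ?thesis
    by (simp add: weight_def derived_trivial_norm_char_pow[OF e x(1)] a prod.distrib norm_mult norm_power power_sum prod_norm[symmetric])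
qed

section \<open>Powers of integral central elements\<close>

definition conv_pow :: "('a \<Rightarrow> complex) \<Rightarrow> nat \<Rightarrow> 'a \<Rightarrow> complex" where
  "conv_pow f k = ((\<star>) f ^^ k) (delta \<one>)"

lemma conv_pow_central: "central f \<Longrightarrow> central (conv_pow f k)"
  by (induction k) (auto simp: conv_pow_def intro: central_linear central_conv)

lemma conv_pow_Ints:
  assumes "\<And>h. h \<in> carrier G \<Longrightarrow> f h \<in> \<int>" "h \<in> carrier G" shows "conv_pow f k h \<in> \<int>"
  using assms(2)
proof (induction k arbitrary: h)
  case (Suc k)
  then show ?case unfolding conv_pow_def by (simp, intro int_valued_conv) (use assms(1) in auto)
qed (simp add: conv_pow_def delta_def)

lemma conv_pow_eigenvalue:
  assumes "e \<in> group_alg" "f \<star> e = (\<lambda>h. w * e h)"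
  shows "conv_pow f k \<star> e = (\<lambda>h. w ^ k * e h)"
proof (induction k)
  case (Suc k)
  have "conv_pow f (Suc k) \<star> e = f \<star> (conv_pow f k \<star> e)" by (simp add: conv_pow_def conv_assoc)
  also have "\<dots> = (\<lambda>h. w ^ k * (w * e h))" by (simp only: Suc conv_linear assms)
  finally show ?case by (simp add: mult_ac)
qed (use assms in \<open>simp add: conv_pow_def conv_one\<close>)

lemma conv_pow_word_sum:
  assumes z: "\<And>h. h \<in> carrier G \<Longrightarrow> f h = of_int (z h)" and h: "h \<in> carrier G"
  shows "conv_pow f k h = of_int (word_sum G z k h)"
  using h
proof (induction k arbitrary: h)
  case 0
  then show ?case by (simp add: conv_pow_def delta_def word_sum_0)
next
  case (Suc k)
  have "conv_pow f (Suc k) h = (\<Sum>a\<in>carrier G. f a * conv_pow f k (inv a \<otimes> h))"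
    using Suc.prems by (simp add: conv_pow_def conv_def)
  also have "\<dots> = (\<Sum>a\<in>carrier G. of_int (z a) * of_int (word_sum G z k (inv a \<otimes> h)))"
    using Suc by (intro sum.cong) (auto simp: z)
  finally show ?case using Suc.prems by (simp add: word_sum_Suc[OF fin])
qed

lemma eigen_mult_sum:
  "eigen_mult y n (\<lambda>h. \<Sum>e\<in>B. c e * e h) k = (\<Sum>e\<in>B. c e * eigen_mult y n e k)"
  unfolding eigen_mult_def conv_sum conv_linear by (simp add: sum_distrib_left mult_ac)

lemma spectral_sum:
  assumes B: "orth_family B" "(\<lambda>h. \<Sum>b\<in>B. b h) = delta \<one>" and F: "F \<in> group_alg"
    and eig: "\<And>e. e \<in> B \<Longrightarrow> F \<star> e = (\<lambda>h. c e * e h)"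
  shows "F = (\<lambda>h. \<Sum>e\<in>B. c e * e h)"
proof -
  have "F = F \<star> (\<lambda>h. \<Sum>b\<in>B. b h)" using F B(2) by (simp add: conv_one)
  then show ?thesis by (simp add: conv_sum eig)
qed

text \<open>The powers \<open>f ^ ((s - 1) s^r)\<close> converge \<open>s\<close>-adically to the sum of those \<open>e\<close> whose
  eigenvalue is a unit, while their coefficients at elements of order \<open>s\<close> converge to \<open>0\<close>.\<close>

lemma multiplicity_balance:
  assumes B: "orth_family B" "(\<lambda>h. \<Sum>b\<in>B. b h) = delta \<one>"
    and f: "central f" "\<And>h. h \<in> carrier G \<Longrightarrow> f h \<in> \<int>"
    and eig: "\<And>e. e \<in> B \<Longrightarrow> f \<star> e = (\<lambda>h. of_int (w e) * e h)"
    and s: "Factorial_Ring.prime (s::nat)" and g: "g \<in> carrier G" "g \<noteq> \<one>" "g [^] s = \<one>"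
    and m: "\<And>e k. e \<in> B \<Longrightarrow> eigen_mult g s e k = of_int (m e k)"
  shows "(\<Sum>e | e \<in> B \<and> \<not> int s dvd w e. m e 0 - m e k) = 0"
proof -
  define M where "M = (\<Sum>e | e \<in> B \<and> \<not> int s dvd w e. m e 0 - m e k)"
  have finB: "finite B" using B(1) by (simp add: orth_family_def)
  have s0: "s > 0" "s > 1" using s prime_gt_0_nat prime_gt_1_nat by auto
  have Bg: "e \<in> group_alg" if "e \<in> B" for e using B(1) that primitiveD(4) by (auto simp: orth_family_def)
  let ?N = "int (card (carrier G))"
  \<comment> \<open>Any \<open>c\<close> with \<open>s ^ c\<close> above the group order would do;
    word counting loses the factor \<open>s ^ c\<close>.\<close>
  define c where "c = card (carrier G)"
  have c: "Coset.order G < s ^ c"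
    using s0 by (simp add: Coset.order_def c_def power_gt_expt)
  define f1 where "f1 = conv_pow f (s - 1)"
  have f1: "central f1" "\<And>h. h \<in> carrier G \<Longrightarrow> f1 h \<in> \<int>"
    unfolding f1_def using conv_pow_central[OF f(1)] conv_pow_Ints[of f] f(2) by auto
  have eig1: "f1 \<star> e = (\<lambda>h. of_int (w e ^ (s - 1)) * e h)" if "e \<in> B" for e
    unfolding f1_def using conv_pow_eigenvalue[OF Bg[OF that] eig[OF that]] by simp
  have "\<forall>h. \<exists>i. h \<in> carrier G \<longrightarrow> f1 h = of_int i" using f1(2) by (metis Ints_cases)
  then obtain z where z: "\<And>h. h \<in> carrier G \<Longrightarrow> f1 h = of_int (z h)" by metis
  have zc: "z (inv u \<otimes> y \<otimes> u) = z y" if uy: "u \<in> carrier G" "y \<in> carrier G" for u y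
  proof -
    have "f1 (inv u \<otimes> y \<otimes> inv (inv u)) = f1 y" using uy centralD(2)[OF f1(1)] by blast
    then have "(of_int (z (inv u \<otimes> y \<otimes> u)) :: complex) = of_int (z y)" using uy z by simp
    then show ?thesis by simp
  qed
  \<comment> \<open>The number \<open>M\<close> is independent of \<open>q\<close>, so divisibility
    by all powers of \<open>s\<close> forces it to vanish.\<close>
  have main: "int s ^ q dvd M" for q
  proof -
    \<comment> \<open>Then the word sums are divisible by \<open>s ^ Suc q\<close>; the extra factor
      \<open>s\<close> cancels the \<open>1 / s\<close> in the spectral idempotents.\<close>
    define r where "r = q + c"
    define F where "F = conv_pow f1 (s ^ r)"
    define \<omega> where "\<omega> e = (w e ^ (s - 1)) ^ (s ^ r)" for e
    have F: "F = (\<lambda>h. \<Sum>e\<in>B. of_int (\<omega> e) * e h)"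
    proof (rule spectral_sum[OF B])
      show "F \<in> group_alg" unfolding F_def by (rule centralD(1)[OF conv_pow_central[OF f1(1)]])
      fix e assume e: "e \<in> B"
      show "F \<star> e = (\<lambda>h. of_int (\<omega> e) * e h)"
        unfolding F_def \<omega>_def using conv_pow_eigenvalue[OF Bg[OF e] eig1[OF e]] by simp
    qed
    define V where "V = (\<Sum>e\<in>B. \<omega> e * (m e 0 - m e k))"
    have "\<exists>t. F (inv (g [^] j)) = of_int (int s ^ Suc q * t)" if j: "0 < j" "j < s" for j
    proof -
      let ?u = "inv (g [^] j)"
      have u: "?u \<in> carrier G" using g by simp
      have "g [^] j \<noteq> \<one>"
      proof
        assume "g [^] j = \<one>"
        then have "ord g dvd j" "ord g dvd s" using g pow_eq_id by auto
        then have "ord g = 1" using s j by (metis nat_dvd_not_less prime_nat_iff)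
        then show False using g ord_eq_1 by simp
      qed
      then have u1: "?u \<noteq> \<one>" using g by (metis inv_inv inv_one nat_pow_closed)
      have "g [^] (j * s) = \<one>" using g by (metis mult.commute nat_pow_one nat_pow_pow)
      then have "?u [^] s = \<one>" using g by (simp add: nat_pow_inv nat_pow_pow)
      from prime_power_dvd_word_sum[OF fin u u1 this s c, of r z] zc[OF u]
      have "int (s ^ Suc (r - c)) dvd word_sum G z (s ^ r) ?u" by (simp add: r_def)
      then obtain t where "word_sum G z (s ^ r) ?u = int s ^ Suc q * t" by (auto simp: r_def)
      then show ?thesis using conv_pow_word_sum[of f1 z ?u "s ^ r"] z u by (auto simp: F_def)
    qed
    then obtain t where t: "\<And>j. 0 < j \<Longrightarrow> j < s \<Longrightarrow> F (inv (g [^] j)) = of_int (int s ^ Suc q * t j)" by metis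
    define y where "y = inverse (cis (2 * pi / s)) ^ k"
    have ys: "y ^ s = 1"
    proof -
      have "y ^ s = inverse ((cis (2 * pi / s) ^ s) ^ k)"
        by (simp add: y_def power_inverse mult.commute del: cis_inverse flip: power_mult)
      also have "cis (2 * pi / s) ^ s = 1" using s0 by (simp add: DeMoivre)
      finally show ?thesis by simp
    qed
    \<comment> \<open>The coefficient of \<open>F\<close> at the identity is not controlled by word
      counting, but at \<open>j = 0\<close> the factor \<open>1 - y ^ j\<close> vanishes.\<close>
    define b where "b j = (if j = 0 then 0 else ?N * t j)" for j
    \<comment> \<open>Rewrites the sum of the terms \<open>b j * (1 - y ^ j)\<close> as an integer
      combination of powers of \<open>y\<close>.\<close>
    define a where "a j = (if j = 0 then \<Sum>i<s. b i else 0) - b j" for j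
    define \<alpha> where "\<alpha> = (\<Sum>j<s. of_int (a j) * y ^ j)"
    have \<alpha>: "\<alpha> = (\<Sum>j<s. of_int (b j) * (1 - y ^ j))"
    proof -
      have "\<alpha> = (\<Sum>j<s. (if j = 0 then of_int (\<Sum>i<s. b i) else 0)) - (\<Sum>j<s. of_int (b j) * y ^ j)"
        unfolding \<alpha>_def a_def sum_subtractf[symmetric] by (intro sum.cong) (auto simp: algebra_simps)
      also have "(\<Sum>j<s. (if j = 0 then of_int (\<Sum>i<s. b i) else 0)) = (of_int (\<Sum>i<s. b i) :: complex)"
        using s0 by simp
      finally show ?thesis by (simp add: algebra_simps sum_subtractf)
    qed
    have "of_int V = eigen_mult g s F 0 - eigen_mult g s F k"
      unfolding F eigen_mult_sum V_def using m
      by (simp add: sum_subtractf[symmetric] algebra_simps)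
    also have "\<dots> = of_int ?N * (inverse (of_nat s) * (\<Sum>j<s. (1 - y ^ j) * F (inv (g [^] j))))"
      unfolding eigen_mult_alt[OF g(1)] y_def
      by (simp add: sum_subtractf algebra_simps del: cis_inverse flip: power_mult)
    also have "(\<Sum>j<s. (1 - y ^ j) * F (inv (g [^] j))) = (\<Sum>j<s. (1 - y ^ j) * of_int (int s ^ Suc q * (if j = 0 then 0 else t j)))"
      using t by (intro sum.cong) auto
    also have "of_int ?N * (inverse (of_nat s) * (\<Sum>j<s. (1 - y ^ j) * of_int (int s ^ Suc q * (if j = 0 then 0 else t j)))) =
      of_nat s ^ q * \<alpha>"
      unfolding \<alpha> b_def sum_distrib_left using s0 by (intro sum.cong refl) simp
    finally have V: "of_int V = of_nat s ^ q * \<alpha>" .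
    then have "\<alpha> = of_int V / of_nat s ^ q" using s0 by simp
    then have "\<alpha> \<in> \<rat>" by simp
    moreover have "algebraic_int \<alpha>" unfolding \<alpha>_def by (rule cyclotomic_integer_algebraic_int[OF s0(1) ys])
    ultimately obtain i where "\<alpha> = of_int i" using rational_algebraic_int_is_int by (metis Ints_cases)
    then have "(of_int V :: complex) = of_int (int s ^ q * i)" using V by simp
    then have "V = int s ^ q * i" by (simp only: of_int_eq_iff)
    then have dV: "int s ^ q dvd V" by simp
    \<comment> \<open>Modulo \<open>s ^ q\<close> each \<open>\<omega> e\<close> is 0 or 1 according
      to whether \<open>s\<close> divides \<open>w e\<close>, so \<open>V\<close> and
      \<open>M\<close> are congruent.\<close>
    have "M = (\<Sum>e\<in>B. (if int s dvd w e then 0 else 1) * (m e 0 - m e k))"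
      unfolding M_def sum.inter_filter[OF finB] by (intro sum.cong) auto
    then have "V - M = (\<Sum>e\<in>B. (\<omega> e - (if int s dvd w e then 0 else 1)) * (m e 0 - m e k))"
      by (simp only: V_def sum_subtractf[symmetric] left_diff_distrib)
    moreover have "int s ^ q dvd \<omega> e - (if int s dvd w e then 0 else 1)" for e
    proof -
      have "int s ^ q dvd int s ^ r" by (simp add: r_def le_imp_power_dvd)
      then show ?thesis unfolding \<omega>_def using prime_power_teichmueller[OF s] by (rule dvd_trans)
    qed
    ultimately have "int s ^ q dvd V - M" by (simp add: dvd_sum)
    then show ?thesis using dV by (metis dvd_diff_right_iff dvd_diff_commute)
  qed
  show ?thesis
  proof (rule ccontr)
    assume "\<not> ?thesis"
    then have "M \<noteq> 0" by (simp add: M_def)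
    moreover have "int s ^ nat \<bar>M\<bar> dvd M" by (rule main)
    ultimately have "int s ^ nat \<bar>M\<bar> \<le> \<bar>M\<bar>" by (intro zdvd_imp_le) auto
    moreover have "int (nat \<bar>M\<bar>) < int (s ^ nat \<bar>M\<bar>)"
      using s0 by (simp only: of_nat_less_iff) (simp add: power_gt_expt)
    ultimately show False by simp
  qed
qed

end

section \<open>Conjugacy classes of prime power size\<close>

context group
begin

text \<open>In the abelian quotient by the derived subgroup the class of \<open>x\<close> collapses
  to one element. The quotient is therefore cyclic, generated by the image of
  \<open>x\<close>.\<close>

lemma index_derived_dvd:
  assumes fin: "finite (carrier G)" and x: "x \<in> carrier G" "x [^] (n::nat) = \<one>"
    and gen: "generate G (conj_class G x) = carrier G"
  shows "card (rcosets (derived G (carrier G))) dvd n"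
proof -
  let ?D = "derived G (carrier G)"
  let ?h = "\<lambda>a. ?D #> a"
  interpret D: normal ?D G by (rule derived_self_is_normal)
  interpret Q: comm_group "G Mod ?D" by (rule derived_quot_is_comm_group)
  interpret h: group_hom G "G Mod ?D" ?h
    by unfold_locales (rule D.r_coset_hom_Mod)
  have hx: "?h x \<in> carrier (G Mod ?D)" using x by simp
  have "?h ` conj_class G x = {?h x}"
  proof -
    have "?h (g \<otimes> x \<otimes> inv g) = ?h x" if g: "g \<in> carrier G" for g
    proof -
      have "?h (g \<otimes> x \<otimes> inv g) = ?h g \<otimes>\<^bsub>G Mod ?D\<^esub> ?h x \<otimes>\<^bsub>G Mod ?D\<^esub> inv\<^bsub>G Mod ?D\<^esub> (?h g)"
        using g x by simp
      also have "\<dots> = ?h x" using g x by (simp add: Q.m_comm[of "?h g" "?h x"] Q.m_assoc del: mult_FactGroup one_FactGroup)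
      finally show ?thesis .
    qed
    then show ?thesis using one_closed by (auto simp: conj_class_def image_image)
  qed
  then have "generate (G Mod ?D) {?h x} = ?h ` carrier G"
    using h.generate_img[OF conj_class_subset[OF x(1)]] gen by simp
  also have "\<dots> = rcosets ?D" by (auto simp: RCOSETS_def)
  finally have "card (rcosets ?D) = Q.ord (?h x)" using Q.generate_pow_card[OF hx] by simp
  moreover have "?h x [^]\<^bsub>G Mod ?D\<^esub> n = \<one>\<^bsub>G Mod ?D\<^esub>"
    using h.hom_nat_pow[OF x(1), of n] x(2) by (metis h.hom_one)
  ultimately show ?thesis using Q.pow_eq_id[OF hx] by simp
qed

text \<open>Cauchy's theorem, from a subgroup of order \<open>s\<close> supplied by Sylow's
  theorem.\<close>

lemma prime_order_element:
  assumes fin: "finite (carrier G)" and D: "subgroup D G" and s: "Factorial_Ring.prime (s::nat)" "s dvd card D"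
  shows "\<exists>g\<in>D. g \<noteq> \<one> \<and> g [^] s = \<one>"
proof -
  let ?D = "G\<lparr>carrier := D\<rparr>"
  interpret D: group ?D using D by (rule subgroup_imp_group)
  have finD: "finite (carrier ?D)" using fin finite_subset[OF subgroup.subset[OF D]] by simp
  obtain t where "card D = s ^ 1 * t" using s(2) by auto
  then obtain K where K: "subgroup K ?D" "card K = s"
    using sylow_thm[OF s(1) D.is_group, of 1 t] finD by (auto simp: Coset.order_def)
  have KG: "subgroup K G" using incl_subgroup[OF D K(1)] .
  have "\<not> K \<subseteq> {\<one>}"
    using K(2) prime_gt_1_nat[OF s(1)] card_mono[of "{\<one>}" K] by auto
  then obtain g where "g \<in> K" "g \<noteq> \<one>" by blast
  then show ?thesis using subgroup_pow_card[OF KG] K subgroup.subset[OF K(1)] by auto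
qed

end

context finite_group
begin

lemma derived_trivial_at_derived:
  assumes e: "derived_trivial e" and h: "h \<in> derived G (carrier G)"
  shows "e (inv h) = e \<one>"
proof -
  have hG: "h \<in> carrier G" using h derived_in_carrier[of "carrier G"] by blast
  have "delta h \<star> e = e" using e h by (simp add: derived_trivial_def)
  then have "(delta h \<star> e) \<one> = e \<one>" by simp
  then show ?thesis using hG by (simp add: delta_conv)
qed

text \<open>On a linear block \<open>g\<close> acts trivially, so its only eigenvalue is 1, which
  has the index 0.\<close>

lemma eigen_mult_derived_trivial:
  assumes e: "derived_trivial e" and g: "g \<in> derived G (carrier G)" and s: "s > 1"
  shows "eigen_mult g s e 0 = of_nat (card (carrier G)) * e \<one>" "eigen_mult g s e 1 = 0"
proof -
  have gG: "g \<in> carrier G" using g derived_in_carrier[of "carrier G"] by blast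
  interpret D: subgroup "derived G (carrier G)" G by (rule derived_is_subgroup) simp
  have gj: "g [^] j \<in> derived G (carrier G)" for j :: nat
    using g by (induction j) auto
  have e1: "e (inv (g [^] j)) = e \<one>" for j :: nat
    by (rule derived_trivial_at_derived[OF e gj])
  show "eigen_mult g s e 0 = of_nat (card (carrier G)) * e \<one>"
    using s by (simp add: eigen_mult_alt[OF gG] e1)
  have "(\<Sum>j<s. inverse (cis (2 * pi / s)) ^ (j * 1)) = 0"
    using root_of_unity_orthogonality[of 0 s 1] s by (simp del: cis_inverse)
  then show "eigen_mult g s e 1 = 0"
    by (simp add: eigen_mult_alt[OF gG] e1 del: cis_inverse flip: sum_distrib_right)
qed

text \<open>The averaging idempotent \<open>f\<close> of the derived subgroup acts as 1 on linear
  blocks and as 0 on the others; its spectral expansion is evaluated at the identity. The sum counts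
  the linear characters.\<close>

lemma sum_derived_trivial_at_one:
  assumes B: "orth_family B" "(\<lambda>h. \<Sum>b\<in>B. b h) = delta \<one>"
  shows "(\<Sum>e | e \<in> B \<and> derived_trivial e. of_nat (card (carrier G)) * e \<one>) =
    of_nat (card (rcosets (derived G (carrier G))))"
proof -
  let ?D = "derived G (carrier G)"
  interpret D: normal ?D G by (rule derived_self_is_normal)
  have finD: "finite ?D" using fin D.subset finite_subset by blast
  have D0: "card ?D \<noteq> 0" using finD D.one_closed by (metis card_0_eq empty_iff)
  define f where "f = (\<lambda>h. inverse (of_nat (card ?D)) * (\<Sum>d\<in>?D. delta d h))"
  have fD: "f h = (if h \<in> ?D then inverse (of_nat (card ?D)) else 0)" for h
    using finD by (simp add: f_def delta_def)
  have fc: "central f"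
    unfolding central_def
  proof (intro conjI ballI)
    show "f \<in> group_alg" using D.subset by (auto simp: group_alg_def fD)
    fix g h assume gh: "g \<in> carrier G" "h \<in> carrier G"
    have "h \<in> ?D" if "g \<otimes> h \<otimes> inv g \<in> ?D"
      using D.inv_op_closed1[OF gh(1) that] conj_inv_cancel[OF gh] by simp
    then show "f (g \<otimes> h \<otimes> inv g) = f h" using D.inv_op_closed2[OF gh(1)] by (auto simp: fD)
  qed
  have f_conv: "(f \<star> e) h = inverse (of_nat (card ?D)) * (\<Sum>d\<in>?D. (delta d \<star> e) h)" for e h
    by (simp add: f_def conv_linear conv_sum)
  have eig: "f \<star> e = (\<lambda>h. (if derived_trivial e then 1 else 0) * e h)" if e: "e \<in> B" for e
  proof (cases "derived_trivial e")
    case True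
    then have "(f \<star> e) h = e h" for h using D0 by (simp add: f_conv derived_trivial_def)
    then show ?thesis using True by auto
  next
    case False
    have pe: "primitive e" using B(1) e by (simp add: orth_family_def)
    then obtain \<theta> where \<theta>: "f \<star> e = (\<lambda>h. \<theta> * e h)" using primitiveD(7)[OF _ fc] by blast
    obtain d where d: "d \<in> ?D" "delta d \<star> e \<noteq> e" using False by (auto simp: derived_trivial_def)
    have dG: "d \<in> carrier G" using d D.subset by blast
    have "delta d \<star> f = f"
    proof (rule group_alg_eqI)
      fix h assume h: "h \<in> carrier G"
      have "inv d \<otimes> h \<in> ?D \<longleftrightarrow> h \<in> ?D"
      proof
        assume "inv d \<otimes> h \<in> ?D"
        then have "d \<otimes> (inv d \<otimes> h) \<in> ?D" using d by simp
        then show "h \<in> ?D" using inv_mult_cancel(2)[OF dG h] by simp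
      qed (use d in simp)
      then show "(delta d \<star> f) h = f h" using dG h by (simp add: delta_conv fD)
    qed (use centralD(1)[OF fc] in auto)
    then have "delta d \<star> (f \<star> e) = f \<star> e" by (simp add: conv_assoc[symmetric])
    then have "(\<lambda>h. \<theta> * (delta d \<star> e) h) = (\<lambda>h. \<theta> * e h)" by (simp only: \<theta> conv_linear)
    then have eq: "\<theta> * (delta d \<star> e) h = \<theta> * e h" for h by (rule fun_cong)
    have "\<theta> = 0"
    proof (rule ccontr)
      assume "\<theta> \<noteq> 0"
      then have "delta d \<star> e = e" using eq by (simp add: fun_eq_iff)
      then show False using d by simp
    qed
    then show ?thesis using \<theta> False by simp
  qed
  have finB: "finite B" using B(1) by (simp add: orth_family_def)
  have "f = (\<lambda>h. \<Sum>e\<in>B. (if derived_trivial e then 1 else 0) * e h)"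
    by (rule spectral_sum[OF B centralD(1)[OF fc] eig])
  then have "f \<one> = (\<Sum>e\<in>B. (if derived_trivial e then 1 else 0) * e \<one>)" by metis
  also have "\<dots> = (\<Sum>e | e \<in> B \<and> derived_trivial e. e \<one>)"
    unfolding sum.inter_filter[OF finB] by (intro sum.cong) auto
  finally have 1: "(\<Sum>e | e \<in> B \<and> derived_trivial e. e \<one>) = inverse (of_nat (card ?D))" by (simp add: fD)
  have "of_nat (card (carrier G)) = (of_nat (card (rcosets ?D)) * of_nat (card ?D) :: complex)"
    using lagrange[OF D.subgroup_axioms] by (metis Coset.order_def of_nat_mult)
  then show ?thesis using D0 by (simp add: sum_distrib_left[symmetric] 1)
qed

text \<open>For \<open>s\<close> different from \<open>p\<close>, the balance of the eigenvalue
  indices 0 and 1 of an element \<open>g\<close> of order \<open>s\<close>, read modulo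
  \<open>p\<close>, would make \<open>p\<close> divide the index of the derived subgroup and hence
  \<open>n\<close>.\<close>

theorem derived_prime_divisor:
  assumes x: "x \<in> carrier G" "x [^] n = \<one>" and n: "n > 0"
    and gen: "generate G (conj_class G x) = carrier G"
    and p: "Factorial_Ring.prime p" "\<not> p dvd n" and cls: "card (conj_class G x) = p ^ a"
    and s: "Factorial_Ring.prime s" "s dvd card (derived G (carrier G))"
  shows "s = p"
proof (rule ccontr)
  assume sp: "s \<noteq> p"
  let ?D = "derived G (carrier G)" and ?N = "of_nat (card (carrier G)) :: complex"
  have D: "subgroup ?D G" by (rule derived_is_subgroup) simp
  obtain g where g: "g \<in> ?D" "g \<noteq> \<one>" "g [^] s = \<one>" using prime_order_element[OF fin D s] by blast
  have gG: "g \<in> carrier G" using g(1) subgroup.subset[OF D] by blast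
  have s1: "s > 1" "s > 0" using s(1) prime_gt_1_nat prime_gt_0_nat by auto
  have "\<exists>b. card (conj_class G (x [^] i)) = p ^ b" for i :: nat
    using card_conj_class_pow_dvd[OF fin x(1), of i] cls p(1) divides_primepow_nat by metis
  then obtain b where b: "\<And>i. card (conj_class G (x [^] (i::nat))) = p ^ b i" by metis
  have "idem (delta \<one>)" by (simp add: idem_def conv_one)
  then obtain B where B: "orth_family B" "(\<lambda>h. \<Sum>e\<in>B. e h) = delta \<one>"
    using primitive_decomposition[OF central_linear(1)] by blast
  have finB: "finite B" using B(1) by (simp add: orth_family_def)
  have primitive: "primitive e" if "e \<in> B" for e using B(1) that by (simp add: orth_family_def)
  have "\<exists>d. ?N * e \<one> = of_nat d" if "e \<in> B" for e
    using idem_at_one_Nats[OF primitiveD(2)[OF primitive[OF that]]] by (metis Nats_cases)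
  then obtain d where d: "\<And>e. e \<in> B \<Longrightarrow> ?N * e \<one> = of_nat (d e)" by metis
  have "\<exists>w. weight e x n = of_int w" if "e \<in> B" for e
    using weight_int[OF primitive[OF that] x n b d[OF that]] by blast
  then obtain w where w: "\<And>e. e \<in> B \<Longrightarrow> weight e x n = of_int (w e)" by metis
  have "\<exists>m. eigen_mult g s e k = of_int m" if "e \<in> B" for e k
    using eigen_mult_Nats[OF gG g(3) s1(2) primitiveD(1,2)[OF primitive[OF that]], of k] by (metis Nats_cases of_int_of_nat_eq)
  then obtain m where m: "\<And>e k. e \<in> B \<Longrightarrow> eigen_mult g s e k = of_int (m e k)" by metis
  let ?U = "{e\<in>B. \<not> int s dvd w e}" and ?L = "{e\<in>B. derived_trivial e}"
  have bal: "(\<Sum>e\<in>?U. m e 0 - m e 1) = 0"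
  proof (rule multiplicity_balance[OF B class_sum_prod_central[OF x(1)] class_sum_prod_Ints[OF x(1)] _ s(1) gG g(2,3) m])
    fix e assume "e \<in> B"
    then show "class_sum_prod x n \<star> e = (\<lambda>h. of_int (w e) * e h)"
      using class_sum_prod_eigenvalue[OF primitive x(1), of e n] w by simp
  qed
  \<comment> \<open>The weight of a linear block is a power of \<open>p\<close> up to sign, hence
    prime to \<open>s\<close>.\<close>
  have LU: "?L \<subseteq> ?U"
  proof safe
    fix e assume e: "e \<in> B" "derived_trivial e" "int s dvd w e"
    have "real_of_int \<bar>w e\<bar> = real p ^ (\<Sum>i<n. b i)"
      using cmod_weight_derived_trivial[OF primitive[OF e(1)] e(2) x n b] w[OF e(1)] by simp
    then have "real_of_int \<bar>w e\<bar> = real_of_int (int (p ^ (\<Sum>i<n. b i)))" by simp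
    then have "\<bar>w e\<bar> = int (p ^ (\<Sum>i<n. b i))" by (simp only: of_int_eq_iff)
    then have "int s dvd int (p ^ (\<Sum>i<n. b i))" using e(3) by (metis dvd_abs_iff)
    then have "s dvd p ^ (\<Sum>i<n. b i)" by (simp only: int_dvd_int_iff)
    then have "s dvd p" using s(1) prime_dvd_power by blast
    then show False using sp s(1) p(1) primes_dvd_imp_eq by blast
  qed
  have L: "m e 0 - m e 1 = int (d e)" if e: "e \<in> ?L" for e
  proof -
    have "(of_int (m e 0 - m e 1) :: complex) = eigen_mult g s e 0 - eigen_mult g s e 1" using e m by simp
    also have "\<dots> = of_int (int (d e))" using e d eigen_mult_derived_trivial[OF _ g(1) s1(1)] by simp
    finally show ?thesis by (simp only: of_int_eq_iff)
  qed
  \<comment> \<open>By Burnside's argument \<open>p\<close> divides \<open>d e\<close>, and the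
    square of each multiplicity is a multiple of \<open>d e\<close>.\<close>
  have nonlin: "int p dvd m e 0 - m e 1" if e: "e \<in> ?U - ?L" for e
  proof -
    have eB: "e \<in> B" and nl: "\<not> derived_trivial e" and "\<not> int s dvd w e" using e by auto
    then have "weight e x n \<noteq> 0" using w by auto
    then have "p dvd d e" using derived_trivial_if_weight[OF primitive[OF eB] x n gen p(1) b d[OF eB]] nl by blast
    have "int p dvd m e k" for k
    proof -
      obtain t where "(eigen_mult g s e k)\<^sup>2 = ?N * e \<one> * of_nat t"
        using eigen_mult_square[OF gG g(3) s1(2) primitive[OF eB], of k] by (auto elim!: Nats_cases)
      then have "(of_int ((m e k)\<^sup>2) :: complex) = of_int (int (d e * t))" using m[OF eB] d[OF eB] by simp
      then have "(m e k)\<^sup>2 = int (d e * t)" by (simp only: of_int_eq_iff)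
      then have "int p dvd (m e k)\<^sup>2" using \<open>p dvd d e\<close> by simp
      then show ?thesis using p(1) prime_dvd_power[of "int p"] by simp
    qed
    then show ?thesis by simp
  qed
  have "(\<Sum>e\<in>?U. m e 0 - m e 1) = (\<Sum>e\<in>?L. int (d e)) + (\<Sum>e\<in>?U - ?L. m e 0 - m e 1)"
    using sum.subset_diff[OF LU, of "\<lambda>e. m e 0 - m e 1"] finB L by simp
  then have minus: "(\<Sum>e\<in>?L. int (d e)) = - (\<Sum>e\<in>?U - ?L. m e 0 - m e 1)" using bal by simp
  have dvd: "int p dvd (\<Sum>e\<in>?U - ?L. m e 0 - m e 1)" by (rule dvd_sum) (rule nonlin)
  have index: "(\<Sum>e\<in>?L. int (d e)) = int (card (rcosets ?D))"
  proof -
    have "(of_int (\<Sum>e\<in>?L. int (d e)) :: complex) = (\<Sum>e\<in>?L. ?N * e \<one>)" using d by simp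
    also have "\<dots> = of_int (int (card (rcosets ?D)))" using sum_derived_trivial_at_one[OF B] by simp
    finally show ?thesis by (simp only: of_int_eq_iff)
  qed
  have "int p dvd int (card (rcosets ?D))"
    unfolding index[symmetric] minus dvd_minus_iff by (rule dvd)
  then have "p dvd card (rcosets ?D)" by (simp only: int_dvd_int_iff)
  then show False using index_derived_dvd[OF fin x gen] p(2) dvd_trans by blast
qed

end

context group
begin

lemma solvable_if_derived_prime_power:
  assumes fin: "finite (carrier G)" and p: "Factorial_Ring.prime (p::nat)" and D: "card (derived G (carrier G)) = p ^ k"
  shows "solvable G"
  unfolding solvable_def
  using augment_solvable_seq[OF subgroup_self] solvable_seq_prime_power_subgroup[OF fin p _ D]
    derived_is_subgroup[of "carrier G"] by blast

text \<open>Kazarin's theorem. The normal closure \<open>V\<close> of the \<open>p\<close>-part of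
  \<open>x\<close> is a \<open>p\<close>-group; modulo \<open>V\<close> the order of
  \<open>x\<close> is prime to \<open>p\<close>, so the derived subgroup of the quotient is a
  \<open>p\<close>-group too.\<close>

theorem solvable_if_prime_power_conj_class:
  assumes fin: "finite (carrier G)" and p: "Factorial_Ring.prime (p::nat)"
    and x: "x \<in> carrier G" and cls: "card (conj_class G x) = p ^ a"
    and gen: "generate G (conj_class G x) = carrier G"
  shows "solvable G"
proof -
  have o: "ord x > 0" using fin x ord_ge_1 by (simp add: Suc_le_eq)
  define b where "b = multiplicity p (ord x)"
  obtain n where n: "ord x = p ^ b * n" "\<not> p dvd n"
    using multiplicity_decompose'[of "ord x" p] o prime_gt_1_nat[OF p] unfolding b_def
    by (metis less_numeral_extra(4) nat_dvd_1_iff_1 not_gr_zero)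
  have n0: "n > 0" using n o by (cases n) auto
  \<comment> \<open>A generator of the Sylow \<open>p\<close>-subgroup of the cyclic group of
    \<open>x\<close>.\<close>
  define y where "y = x [^] n"
  have y: "y \<in> carrier G" "y [^] (p ^ b) = \<one>"
    using x n(1) pow_ord_eq_1[OF x] by (simp_all add: y_def nat_pow_pow mult.commute)
  obtain a' where a': "card (conj_class G y) = p ^ a'"
    using card_conj_class_pow_dvd[OF fin x, of n] cls p divides_primepow_nat unfolding y_def by metis
  define V where "V = generate G (conj_class G y)"
  obtain c where c: "card V = p ^ c"
    using generate_conj_class_prime_power[OF fin p y a'] by (auto simp: V_def)
  have V: "V \<lhd> G"
    unfolding V_def using conj_class_subset[OF y(1)] conj_class_closed[OF y(1)] by (intro normal_generateI)
  interpret V: normal V G by (rule V)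
  let ?Q = "G Mod V" and ?h = "\<lambda>g. V #> g"
  interpret Q: group ?Q by (rule V.factorgroup_is_group)
  interpret h: group_hom G ?Q ?h
    by unfold_locales (rule V.r_coset_hom_Mod)
  have carrQ: "carrier ?Q = ?h ` carrier G" by (rule carrier_FactGroup)
  have finQ: "finite (carrier ?Q)" using fin by (simp add: carrQ)
  interpret FQ: finite_group ?Q by unfold_locales (rule finQ)
  have hconj: "?h (g \<otimes> u \<otimes> inv g) = ?h g \<otimes>\<^bsub>?Q\<^esub> ?h u \<otimes>\<^bsub>?Q\<^esub> inv\<^bsub>?Q\<^esub> (?h g)"
    if "g \<in> carrier G" "u \<in> carrier G" for g u using that by simp
  have img: "conj_class ?Q (?h x) = ?h ` conj_class G x"
    using x hconj by (auto simp: conj_class_def carrQ image_image)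
  have "card (?h ` conj_class G x) dvd card (conj_class G x)"
    using hconj by (intro card_conj_class_image_dvd[OF fin x]) simp
  then obtain a'' where a'': "card (conj_class ?Q (?h x)) = p ^ a''"
    using cls p divides_primepow_nat img by metis
  have genQ: "generate ?Q (conj_class ?Q (?h x)) = carrier ?Q"
    using h.generate_img[OF conj_class_subset[OF x]] gen by (simp add: img carrQ)
  have hx: "?h x \<in> carrier ?Q" using x by simp
  have "y \<in> V" unfolding V_def by (rule generate.incl) (rule self_in_conj_class[OF y(1)])
  then have "?h y = V" using coset_join2[OF y(1) V.subgroup_axioms] by simp
  then have hxn: "?h x [^]\<^bsub>?Q\<^esub> n = \<one>\<^bsub>?Q\<^esub>"
    using h.hom_nat_pow[OF x, of n] by (simp add: y_def)
  have "\<exists>k. card (derived ?Q (carrier ?Q)) = p ^ k"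
  proof -
    let ?D = "derived ?Q (carrier ?Q)"
    interpret D: subgroup ?D ?Q by (rule Q.derived_is_subgroup) simp
    have "finite ?D" using finQ D.subset finite_subset by blast
    then have D0: "card ?D \<noteq> 0" using D.one_closed by (metis card_0_eq empty_iff)
    obtain m where m: "card ?D = p ^ multiplicity p (card ?D) * m" "\<not> p dvd m"
      using multiplicity_decompose'[of "card ?D" p] D0 prime_gt_1_nat[OF p]
      by (metis less_numeral_extra(4) nat_dvd_1_iff_1)
    \<comment> \<open>A prime divisor of the \<open>p\<close>-free part of the order would have to
      be \<open>p\<close>.\<close>
    have "m = 1"
    proof (rule ccontr)
      assume "m \<noteq> 1"
      then obtain s where s: "Factorial_Ring.prime s" "s dvd m" using prime_factor_nat by blast
      have "s dvd card ?D" using s(2) by (subst m(1)) simp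
      then have "s = p" using FQ.derived_prime_divisor[OF hx hxn n0 genQ p n(2) a'' s(1)] by blast
      then show False using s(2) m(2) by simp
    qed
    then show ?thesis using m(1) by auto
  qed
  then have "solvable ?Q" using Q.solvable_if_derived_prime_power[OF finQ p] by blast
  moreover have "solvable (G\<lparr>carrier := V\<rparr>)"
  proof -
    interpret VG: group "G\<lparr>carrier := V\<rparr>" by (rule V.subgroup_is_group[OF is_group])
    have "finite (carrier (G\<lparr>carrier := V\<rparr>))" using fin finite_subset[OF V.subset] by simp
    from VG.solvable_seq_prime_power_subgroup[OF this p VG.subgroup_self, of c]
    show ?thesis using c by (simp add: solvable_def)
  qed
  moreover have "group_hom (G\<lparr>carrier := V\<rparr>) G (\<lambda>v. v)"
    using V.subgroup_is_group[OF is_group] V.subset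
    by (auto simp: group_hom_def group_hom_axioms_def hom_def is_group)
  moreover have "kernel G ?Q ?h \<subseteq> (\<lambda>v. v) ` carrier (G\<lparr>carrier := V\<rparr>)"
    using coset_join1[OF _ _ V.subgroup_axioms] by (auto simp: kernel_def)
  ultimately show ?thesis
    using solvable_condition[OF _ h.group_hom_axioms carrQ[symmetric]] by blast
qed

end

section \<open>Right multiplication groups\<close>

lemma finite_carrier_BijGroup: "finite S \<Longrightarrow> finite (carrier (BijGroup S))"
  by (rule finite_subset[OF _ finite_PiE[of S "\<lambda>_. S"]])
     (auto simp: BijGroup_def Bij_def bij_betw_def PiE_def)

context quandle
begin

lemma RMlt_elem_Bij: "g \<in> carrier (RMlt Q m) \<Longrightarrow> g \<in> Bij Q"
  using subgroup.subset[OF subgroup_RMlt] by (auto simp: BijGroup_def)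

lemma RMlt_mult_apply:
  assumes "g \<in> carrier (RMlt Q m)" "h \<in> carrier (RMlt Q m)" "y \<in> Q"
  shows "(g \<otimes>\<^bsub>RMlt Q m\<^esub> h) y = g (h y)"
  using RMlt_elem_Bij[OF assms(1)] RMlt_elem_Bij[OF assms(2)] assms(3)
  by (simp add: RMlt_def BijGroup_def compose_def)

lemma right_translation_in_RMlt: "x \<in> Q \<Longrightarrow> right_translation Q m x \<in> carrier (RMlt Q m)"
  by (auto simp: RMlt_def intro: generate.incl)

text \<open>Induction over the generation of the group: automorphisms are closed under composition
  and inversion.\<close>

lemma RMlt_hom:
  assumes "g \<in> carrier (RMlt Q m)" "y \<in> Q" "z \<in> Q"
  shows "g (m y z) = m (g y) (g z)"
proof -
  interpret B: group "BijGroup Q" by (rule group_BijGroup)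
  have "g \<in> generate (BijGroup Q) (right_translation Q m ` Q)" using assms(1) by (simp add: RMlt_def)
  then have "\<forall>y\<in>Q. \<forall>z\<in>Q. g (m y z) = m (g y) (g z)"
  proof (induction g rule: generate.induct)
    case one
    then show ?case by (simp add: BijGroup_def closed)
  next
    case (incl h)
    then show ?case using right_translation_auto by (auto simp: magma_auto_def)
  next
    case (inv h)
    then have h: "h \<in> Bij Q" and hom: "\<forall>y\<in>Q. \<forall>z\<in>Q. h (m y z) = m (h y) (h z)"
      using right_translation_auto by (auto simp: magma_auto_def)
    have bij: "bij_betw h Q Q" using h by (simp add: Bij_def)
    have i: "inv\<^bsub>BijGroup Q\<^esub> h = (\<lambda>x\<in>Q. inv_into Q h x)" by (rule inv_BijGroup[OF h])
    show ?case
    proof (intro ballI)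
      fix y z assume yz: "y \<in> Q" "z \<in> Q"
      have "inv_into Q h (m y z) = m (inv_into Q h y) (inv_into Q h z)"
      proof (rule inv_into_f_eq)
        show "inj_on h Q" using bij by (simp add: bij_betw_def)
        have iQ: "inv_into Q h y \<in> Q" "inv_into Q h z \<in> Q"
          using yz bij inv_into_into[of _ h Q] by (auto simp: bij_betw_def)
        then show "m (inv_into Q h y) (inv_into Q h z) \<in> Q" by (rule closed)
        show "h (m (inv_into Q h y) (inv_into Q h z)) = m y z"
        proof -
          have "h (inv_into Q h y) = y" "h (inv_into Q h z) = z"
            using yz bij by (simp_all add: bij_betw_inv_into_right)
          then show ?thesis using bspec[OF bspec[OF hom iQ(1)] iQ(2)] by simp
        qed
      qed
      then show "(inv\<^bsub>BijGroup Q\<^esub> h) (m y z) = m ((inv\<^bsub>BijGroup Q\<^esub> h) y) ((inv\<^bsub>BijGroup Q\<^esub> h) z)"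
        using yz closed[OF yz] unfolding i by simp
    qed
  next
    case (eng g h)
    have "g \<in> carrier (BijGroup Q)" "h \<in> carrier (BijGroup Q)"
      using B.generate_in_carrier[OF right_translations_subset] eng.hyps by blast+
    then have Bij: "g \<in> Bij Q" "h \<in> Bij Q" by (simp_all add: BijGroup_def)
    have comp: "(g \<otimes>\<^bsub>BijGroup Q\<^esub> h) y = g (h y)" if "y \<in> Q" for y
      using Bij that by (simp add: BijGroup_def compose_def)
    have "h y \<in> Q" if "y \<in> Q" for y
      using Bij(2) that Bij_imp_funcset by blast
    then show ?case using eng.IH comp closed by auto
  qed
  then show ?thesis using assms by blast
qed

lemma RMlt_maps: "g \<in> carrier (RMlt Q m) \<Longrightarrow> y \<in> Q \<Longrightarrow> g y \<in> Q"
  using RMlt_elem_Bij Bij_imp_funcset by blast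

text \<open>As \<open>g\<close> is an automorphism, applying it after multiplication by
  \<open>x\<close> is the same as multiplying by \<open>g x\<close> after applying it.\<close>

lemma conj_right_translation:
  assumes g: "g \<in> carrier (RMlt Q m)" and x: "x \<in> Q"
  shows "g \<otimes>\<^bsub>RMlt Q m\<^esub> right_translation Q m x \<otimes>\<^bsub>RMlt Q m\<^esub> inv\<^bsub>RMlt Q m\<^esub> g =
    right_translation Q m (g x)"
proof -
  interpret G: group "RMlt Q m" by (rule group_RMlt)
  note gx = RMlt_maps[OF g x]
  have "g \<otimes>\<^bsub>RMlt Q m\<^esub> right_translation Q m x = right_translation Q m (g x) \<otimes>\<^bsub>RMlt Q m\<^esub> g"
  proof (rule extensionalityI[where A = Q])
    fix y assume y: "y \<in> Q"
    then show "(g \<otimes>\<^bsub>RMlt Q m\<^esub> right_translation Q m x) y =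
        (right_translation Q m (g x) \<otimes>\<^bsub>RMlt Q m\<^esub> g) y"
      using g x gx RMlt_maps[OF g y]
      by (simp add: RMlt_mult_apply right_translation_in_RMlt) (simp add: right_translation_def RMlt_hom)
  qed (use g x gx right_translation_in_RMlt RMlt_elem_Bij Bij_imp_extensional in \<open>blast intro: G.m_closed\<close>)+
  then show ?thesis
    using g gx right_translation_in_RMlt by (simp add: G.m_assoc)
qed

end

theorem proposition9p2:
  fixes Q :: "'a set" and m :: "'a \<Rightarrow> 'a \<Rightarrow> 'a" and p k :: nat
  assumes "connected_quandle Q m"
    and "Factorial_Ring.prime p" and "card Q = p ^ k"
  shows "solvable (RMlt Q m)"
proof -
  interpret quandle Q m using assms(1) by (simp add: connected_quandle_def)
  interpret G: group "RMlt Q m" by (rule group_RMlt)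
  let ?R = "right_translation Q m"
  have card0: "card Q > 0" using assms(2,3) by (simp add: prime_gt_0_nat)
  then have finQ: "finite Q" by (rule card_ge_0_finite)
  obtain x where x: "x \<in> Q" using card0 by (metis card_gt_0_iff ex_in_conv)
  have fin: "finite (carrier (RMlt Q m))"
    using finite_carrier_BijGroup[OF finQ] subgroup.subset[OF subgroup_RMlt] finite_subset by blast
  have trans: "\<exists>g\<in>carrier (RMlt Q m). g u = v" if "u \<in> Q" "v \<in> Q" for u v
    using assms(1) that by (simp add: connected_quandle_iff)
  \<comment> \<open>Conjugation by \<open>g\<close> replaces \<open>x\<close> by \<open>g x\<close>,
    and by transitivity every element of \<open>Q\<close> arises in this way.\<close>
  have cls: "conj_class (RMlt Q m) (?R x) = ?R ` Q"
  proof
    show "conj_class (RMlt Q m) (?R x) \<subseteq> ?R ` Q"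
      using RMlt_maps x by (auto simp: conj_class_def conj_right_translation)
    show "?R ` Q \<subseteq> conj_class (RMlt Q m) (?R x)"
    proof
      fix f assume "f \<in> ?R ` Q"
      then obtain v where v: "v \<in> Q" "f = ?R v" by blast
      obtain g where "g \<in> carrier (RMlt Q m)" "g x = v" using trans[OF x v(1)] by blast
      then show "f \<in> conj_class (RMlt Q m) (?R x)"
        using v conj_right_translation[OF _ x] by (force simp: conj_class_def)
    qed
  qed
  \<comment> \<open>Distinct elements may have the same translation, but transitivity makes the
    fibres equally large.\<close>
  have "card (?R ` Q) dvd card Q"
  proof (rule card_dvd_of_equal_fibers[OF finQ])
    fix u v assume uv: "u \<in> Q" "v \<in> Q"
    obtain g where g: "g \<in> carrier (RMlt Q m)" "g u = v" using trans[OF uv] by blast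
    have "inj_on g Q" using RMlt_elem_Bij[OF g(1)] by (simp add: Bij_def bij_betw_def)
    moreover have "?R (g u') = ?R v" if "u' \<in> Q" "?R u' = ?R u" for u'
      using conj_right_translation[OF g(1)] that uv(1) g(2) by metis
    ultimately show "\<exists>f. inj_on f Q \<and> f ` Q \<subseteq> Q \<and> (\<forall>u'\<in>Q. ?R u' = ?R u \<longrightarrow> ?R (f u') = ?R v)"
      using RMlt_maps[OF g(1)] by blast
  qed
  then obtain a where a: "card (conj_class (RMlt Q m) (?R x)) = p ^ a"
    using assms(2,3) cls divides_primepow_nat by metis
  have "generate (RMlt Q m) (?R ` Q) = carrier (RMlt Q m)"
    using group.generate_consistent[OF group_BijGroup _ subgroup_RMlt, of "?R ` Q"]
      right_translation_in_RMlt by (auto simp: RMlt_def)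
  then show ?thesis
    using G.solvable_if_prime_power_conj_class[OF fin assms(2) right_translation_in_RMlt[OF x] a] cls by simp
qed

end
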